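(* Let $s>0$ and consider the following evolution equation for $v=v(t,x)$, $x\in\mathbb{T}$, with initial datum $v(0)=v_0\in H^s(\mathbb{T})$, written for the Fourier coefficients $\widehat v(n)=\widehat v(t,n)$, $n\in\mathbb{Z}$: $$\begin{aligned}\partial_t\widehat v(n)-i(n^5+d_1n^3+d_2n)\widehat v(n)=&-20in^3|\widehat v(n)|^2\widehat v(n)+10in\sum_{\mathcal N_{3,n}}\widehat v(n_1)\widehat v(n_2)n_3^2\widehat v(n_3)\\&+10in\sum_{\mathcal N_{3,n}}\widehat v(n_1)n_2\widehat v(n_2)n_3\widehat v(n_3)\\&+6in\sum_{\mathcal N_{5,n}}\widehat v(n_1)\widehat v(n_2)\widehat v(n_3)\widehat v(n_4)\widehat v(n_5).\end{aligned}$$ Then there does not exist $T>0$ such that this equation admits a unique local solution on $[-T,T]$ and the flow map $v_0\mapsto v(t)$, $t\in[-T,T]$, is $C^5$-differentiable at the origin from $H^s(\mathbb{T})$ to $H^s(\mathbb{T})$.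
   Context: $\mathbb{T}=\mathbb{R}/2\pi\mathbb{Z}$. Here $d_1,d_2$ are constants (in the paper they come from conserved quantities, $d_1=10\|u_0\|_{L^2}^2$, $d_2=10(\|u_0\|_{\dot H^1}^2+\|u_0\|_{L^4}^4)$, and are treated as fixed nonnegative constants), and $$\mathcal N_{3,n}=\{(n_1,n_2,n_3)\in\mathbb{Z}^3:\ n_1+n_2+n_3=n,\ (n_1+n_2)(n_1+n_3)(n_2+n_3)\neq0\},$$ $$\mathcal N_{5,n}=\{(n_1,\dots,n_5)\in\mathbb{Z}^5:\ n_1+\dots+n_5=n,\ n_\ell+n_j+n_m+n_p\ne0\text{ for all }1\le\ell<j<m<p\le5\}.$$ Solutions are understood in the sense of the associated Duhamel integral equation with linear propagator $\widehat v(n)\mapsto e^{it(n^5+d_1n^3+d_2n)}\widehat v(n)$. *)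

theory Defs
  imports "HOL-Analysis.Analysis"
begin

typedef ell2 = "{a :: int \<Rightarrow> complex. (\<lambda>n. (cmod (a n))\<^sup>2) summable_on UNIV}"
  morphisms coord Abs_ell2
  by (rule exI[of _ "\<lambda>_. 0"]) simp

setup_lifting type_definition_ell2

lemma ell2_sum_bound:
  fixes a b :: "int \<Rightarrow> complex"
  assumes "(\<lambda>n. (cmod (a n))\<^sup>2) summable_on UNIV" "(\<lambda>n. (cmod (b n))\<^sup>2) summable_on UNIV"
  shows "(\<lambda>n. (cmod (a n + b n))\<^sup>2) summable_on UNIV"
proof (rule summable_on_comparison_test)
  show "(\<lambda>n. 2 * (cmod (a n))\<^sup>2 + 2 * (cmod (b n))\<^sup>2) summable_on UNIV"
    by (intro summable_on_add summable_on_cmult_right assms)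
  fix n
  have "(cmod (a n + b n))\<^sup>2 \<le> (cmod (a n) + cmod (b n))\<^sup>2"
    by (intro power_mono norm_triangle_ineq) auto
  also have "\<dots> \<le> 2 * (cmod (a n))\<^sup>2 + 2 * (cmod (b n))\<^sup>2"
    using zero_le_power2[of "cmod (a n) - cmod (b n)"] by (simp add: power2_eq_square algebra_simps)
  finally show "(cmod (a n + b n))\<^sup>2 \<le> 2 * (cmod (a n))\<^sup>2 + 2 * (cmod (b n))\<^sup>2" .
qed auto

instantiation ell2 :: real_vector
begin

lift_definition zero_ell2 :: ell2 is "\<lambda>_. 0" by simp
lift_definition plus_ell2 :: "ell2 \<Rightarrow> ell2 \<Rightarrow> ell2" is "\<lambda>a b n. a n + b n"
  by (rule ell2_sum_bound)
lift_definition uminus_ell2 :: "ell2 \<Rightarrow> ell2" is "\<lambda>a n. - a n" by simp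
lift_definition minus_ell2 :: "ell2 \<Rightarrow> ell2 \<Rightarrow> ell2" is "\<lambda>a b n. a n - b n"
  using ell2_sum_bound[where b = "\<lambda>n. - b n" for b] by simp
lift_definition scaleR_ell2 :: "real \<Rightarrow> ell2 \<Rightarrow> ell2" is "\<lambda>r a n. r *\<^sub>R a n"
  by (simp add: power_mult_distrib summable_on_cmult_right)

instance
  by standard (transfer, simp add: algebra_simps fun_eq_iff)+

end

lemma ell2_inner_summable:
  fixes a b :: "int \<Rightarrow> complex"
  assumes "(\<lambda>n. (cmod (a n))\<^sup>2) summable_on UNIV" "(\<lambda>n. (cmod (b n))\<^sup>2) summable_on UNIV"
  shows "(\<lambda>n. a n \<bullet> b n) summable_on UNIV"
proof -
  have "(\<lambda>n. ((cmod (a n + b n))\<^sup>2 - ((cmod (a n))\<^sup>2 + (cmod (b n))\<^sup>2)) * (1/2)) summable_on UNIV"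
    using summable_on_cmult_left[OF summable_on_add[OF ell2_sum_bound[OF assms]
        summable_on_uminus[THEN iffD2, OF summable_on_add[OF assms]]], of "1/2"] by (simp add: algebra_simps)
  moreover have "((cmod (a n + b n))\<^sup>2 - ((cmod (a n))\<^sup>2 + (cmod (b n))\<^sup>2)) * (1/2) = a n \<bullet> b n" for n
    by (simp add: power2_norm_eq_inner algebra_simps inner_commute)
  ultimately show ?thesis by simp
qed

instantiation ell2 :: real_inner
begin

definition inner_ell2 :: "ell2 \<Rightarrow> ell2 \<Rightarrow> real" where
  "inner_ell2 a b = (\<Sum>\<^sub>\<infinity>n. coord a n \<bullet> coord b n)"
definition norm_ell2 :: "ell2 \<Rightarrow> real" where
  "norm_ell2 a = sqrt (\<Sum>\<^sub>\<infinity>n. (cmod (coord a n))\<^sup>2)"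
definition dist_ell2 :: "ell2 \<Rightarrow> ell2 \<Rightarrow> real" where
  "dist_ell2 a b = norm (a - b)"
definition sgn_ell2 :: "ell2 \<Rightarrow> ell2" where
  "sgn_ell2 a = a /\<^sub>R norm a"
definition uniformity_ell2 :: "(ell2 \<times> ell2) filter" where
  "uniformity_ell2 = (INF e\<in>{0<..}. principal {(x, y). dist x y < e})"
definition open_ell2 :: "ell2 set \<Rightarrow> bool" where
  "open_ell2 U \<longleftrightarrow> (\<forall>x\<in>U. eventually (\<lambda>(x', y). x' = x \<longrightarrow> y \<in> U) uniformity)"

instance
proof
  note s = ell2_inner_summable[OF coord[unfolded mem_Collect_eq] coord[unfolded mem_Collect_eq]]
  fix x y z :: ell2 and r :: real
  show "inner x y = inner y x"
    by (simp add: inner_ell2_def inner_commute)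
  show "inner (x + y) z = inner x z + inner y z"
    unfolding inner_ell2_def plus_ell2.rep_eq inner_add_left by (rule infsum_add[OF s s])
  show "inner (r *\<^sub>R x) y = r * inner x y"
    unfolding inner_ell2_def scaleR_ell2.rep_eq inner_scaleR_left by (rule infsum_cmult_right')
  show "0 \<le> inner x x"
    unfolding inner_ell2_def by (rule infsum_nonneg) simp
  show "inner x x = 0 \<longleftrightarrow> x = 0"
  proof
    assume 0: "inner x x = 0"
    have "coord x n \<bullet> coord x n = 0" for n
      by (rule nonneg_infsum_le_0D[of "\<lambda>n. coord x n \<bullet> coord x n" UNIV])
        (use 0 s[of x x] in \<open>auto simp: inner_ell2_def\<close>)
    then have "coord x = coord 0"
      by (simp add: zero_ell2.rep_eq fun_eq_iff)
    then show "x = 0" by (simp add: coord_inject)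
  qed (simp add: inner_ell2_def zero_ell2.rep_eq)
  show "norm x = sqrt (inner x x)"
    by (simp add: norm_ell2_def inner_ell2_def power2_norm_eq_inner)
qed (simp_all add: dist_ell2_def sgn_ell2_def uniformity_ell2_def open_ell2_def)

end

text \<open>
  \<open>H\<^sup>s(T)\<close>, described through Fourier coefficients, consists of the sequences
  \<open>v\<close> with \<open>\<Sum>n. (1 + n\<^sup>2)\<^sup>s |v n|\<^sup>2 < \<infinity>\<close>, normed by the square root of this sum.  As \<open>s\<close> is
  a parameter of the theorem, \<open>H\<^sup>s\<close> is represented by the single normed type \<^typ>\<open>ell2\<close>,
  via the isometry sending \<open>a\<close> to the distribution with \<open>n\<close>-th Fourier coefficient
  \<open>(1 + n\<^sup>2)\<^bsup>-s/2\<^esup> a n\<close>.  See \<open>norm_fourier\<close> and \<open>bij_betw_fourier\<close> below.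
  Functions are complex valued, and \<open>H\<^sup>s\<close> is regarded as a real normed space: the term
  \<open>|v n|\<^sup>2 v n\<close> is not complex differentiable.
\<close>

definition fourier :: "real \<Rightarrow> ell2 \<Rightarrow> int \<Rightarrow> complex" where
  "fourier s a n = of_real ((1 + (of_int n)\<^sup>2) powr (- s / 2)) * coord a n"

definition Hs :: "real \<Rightarrow> (int \<Rightarrow> complex) set" where
  "Hs s = {v. (\<lambda>n. (1 + (of_int n)\<^sup>2) powr s * (cmod (v n))\<^sup>2) summable_on UNIV}"

lemma weight_pos: "(0::real) < 1 + (of_int n)\<^sup>2"
  by (simp add: add_pos_nonneg)

lemma weighted_fourier:
  "(1 + (of_int n)\<^sup>2) powr s * (cmod (fourier s a n))\<^sup>2 = (cmod (coord a n))\<^sup>2"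
proof -
  have "((1 + (of_int n)\<^sup>2) powr (- s / 2))\<^sup>2 = (1 + (of_int n :: real)\<^sup>2) powr (- s)"
    using weight_pos[of n] by (simp add: power2_eq_square flip: powr_add)
  then have "(1 + (of_int n)\<^sup>2) powr s * (cmod (fourier s a n))\<^sup>2 =
      (1 + (of_int n)\<^sup>2) powr s * (1 + (of_int n)\<^sup>2) powr (- s) * (cmod (coord a n))\<^sup>2"
    by (simp add: fourier_def norm_mult power_mult_distrib)
  then show ?thesis
    using weight_pos[of n] by (simp flip: powr_add)
qed

lemma norm_fourier:
  "norm a = sqrt (\<Sum>\<^sub>\<infinity>n. (1 + (of_int n)\<^sup>2) powr s * (cmod (fourier s a n))\<^sup>2)"
  by (simp add: weighted_fourier norm_ell2_def)

lemma bij_betw_fourier: "bij_betw (fourier s) UNIV (Hs s)"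
proof (rule bij_betwI')
  show "(fourier s a = fourier s b) = (a = b)" for a b
  proof
    assume *: "fourier s a = fourier s b"
    have "coord a n = coord b n" for n
      using fun_cong[OF *, of n] weight_pos[of n] by (simp add: fourier_def)
    then show "a = b" by (simp add: fun_eq_iff flip: coord_inject)
  qed simp
  show "fourier s a \<in> Hs s" for a
    using coord[of a] by (simp add: Hs_def weighted_fourier)
  fix v assume v: "v \<in> Hs s"
  define b where "b n = of_real ((1 + (of_int n)\<^sup>2) powr (s / 2)) * v n" for n
  have "(cmod (b n))\<^sup>2 = (1 + (of_int n)\<^sup>2) powr s * (cmod (v n))\<^sup>2" for n
    using weight_pos[of n]
    by (simp add: b_def norm_mult power_mult_distrib power2_eq_square flip: powr_add)
  with v have "coord (Abs_ell2 b) = b"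
    by (intro Abs_ell2_inverse) (simp add: Hs_def)
  moreover have "(1 + (of_int n :: real)\<^sup>2) powr (- s / 2) * (1 + (of_int n)\<^sup>2) powr (s / 2) = 1" for n
    using weight_pos[of n] by (simp flip: powr_add)
  ultimately have "v = fourier s (Abs_ell2 b)"
    by (simp add: fun_eq_iff fourier_def b_def mult.assoc[symmetric] flip: of_real_mult)
  then show "\<exists>a\<in>UNIV. v = fourier s a" by blast
qed

definition N3 :: "int \<Rightarrow> (int \<times> int \<times> int) set" where
  "N3 n = {(n1, n2, n3). n1 + n2 + n3 = n \<and> (n1 + n2) * (n1 + n3) * (n2 + n3) \<noteq> 0}"

definition N5 :: "int \<Rightarrow> (int \<times> int \<times> int \<times> int \<times> int) set" where
  "N5 n = {(n1, n2, n3, n4, n5). n1 + n2 + n3 + n4 + n5 = n \<and>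
     n1 + n2 + n3 + n4 \<noteq> 0 \<and> n1 + n2 + n3 + n5 \<noteq> 0 \<and> n1 + n2 + n4 + n5 \<noteq> 0 \<and>
     n1 + n3 + n4 + n5 \<noteq> 0 \<and> n2 + n3 + n4 + n5 \<noteq> 0}"

definition dispersion :: "real \<Rightarrow> real \<Rightarrow> int \<Rightarrow> real" where
  "dispersion d1 d2 n = of_int n ^ 5 + d1 * of_int n ^ 3 + d2 * of_int n"

definition cubicA :: "(int \<Rightarrow> complex) \<Rightarrow> int \<times> int \<times> int \<Rightarrow> complex" where
  "cubicA v = (\<lambda>(n1, n2, n3). v n1 * v n2 * (of_int n3 ^ 2 * v n3))"

definition cubicB :: "(int \<Rightarrow> complex) \<Rightarrow> int \<times> int \<times> int \<Rightarrow> complex" where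
  "cubicB v = (\<lambda>(n1, n2, n3). v n1 * (of_int n2 * v n2) * (of_int n3 * v n3))"

definition quintic :: "(int \<Rightarrow> complex) \<Rightarrow> int \<times> int \<times> int \<times> int \<times> int \<Rightarrow> complex" where
  "quintic v = (\<lambda>(n1, n2, n3, n4, n5). v n1 * v n2 * v n3 * v n4 * v n5)"

definition nonlinearity :: "(int \<Rightarrow> complex) \<Rightarrow> int \<Rightarrow> complex" where
  "nonlinearity v n =
     - 20 * \<i> * of_int n ^ 3 * of_real ((cmod (v n))\<^sup>2) * v n
     + 10 * \<i> * of_int n * (\<Sum>\<^sub>\<infinity>p\<in>N3 n. cubicA v p)
     + 10 * \<i> * of_int n * (\<Sum>\<^sub>\<infinity>p\<in>N3 n. cubicB v p)
     + 6 * \<i> * of_int n * (\<Sum>\<^sub>\<infinity>p\<in>N5 n. quintic v p)"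

text \<open>
  Since \<^const>\<open>infsum\<close> is 0 on families that are not summable, convergence of the sums
  is demanded separately.
\<close>

definition nonlinearity_converges :: "(int \<Rightarrow> complex) \<Rightarrow> int \<Rightarrow> bool" where
  "nonlinearity_converges v n \<longleftrightarrow>
     cubicA v summable_on N3 n \<and> cubicB v summable_on N3 n \<and> quintic v summable_on N5 n"

text \<open>
  As usual for the Duhamel formula, the integrand is only required to be defined for almost every time.
  The interval integral is oriented, so that negative \<open>t\<close> are covered.
\<close>

definition solution :: "real \<Rightarrow> real \<Rightarrow> real \<Rightarrow> real \<Rightarrow> ell2 \<Rightarrow> (real \<Rightarrow> ell2) \<Rightarrow> bool" where
  "solution d1 d2 s T a u \<longleftrightarrow>
     continuous_on {-T..T} u \<and>
     (\<forall>n. (AE \<tau> in lborel. \<tau> \<in> {-T..T} \<longrightarrow> nonlinearity_converges (fourier s (u \<tau>)) n)) \<and>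
     (\<forall>n. \<forall>t\<in>{-T..T}.
        interval_lebesgue_integrable lborel 0 t
          (\<lambda>\<tau>. cis ((t - \<tau>) * dispersion d1 d2 n) * nonlinearity (fourier s (u \<tau>)) n) \<and>
        fourier s (u t) n =
          cis (t * dispersion d1 d2 n) * fourier s a n +
          (LBINT \<tau>=0..t. cis ((t - \<tau>) * dispersion d1 d2 n) * nonlinearity (fourier s (u \<tau>)) n))"

definition unique_local_flow ::
  "real \<Rightarrow> real \<Rightarrow> real \<Rightarrow> real \<Rightarrow> real \<Rightarrow> (real \<Rightarrow> ell2 \<Rightarrow> ell2) \<Rightarrow> bool" where
  "unique_local_flow d1 d2 s T r S \<longleftrightarrow>
     (\<forall>a. norm a < r \<longrightarrow>
        solution d1 d2 s T a (\<lambda>t. S t a) \<and>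
        (\<forall>w. solution d1 d2 s T a w \<longrightarrow> (\<forall>t\<in>{-T..T}. w t = S t a)))"

text \<open>
  Continuity of the fifth derivative is only asked at \<open>x\<close>; this holds in particular if
  \<open>f\<close> is of class \<open>C\<^sup>5\<close> on a neighbourhood of \<open>x\<close>.
\<close>

definition C5_at :: "('a::real_normed_vector \<Rightarrow> 'b::real_normed_vector) \<Rightarrow> 'a \<Rightarrow> bool" where
  "C5_at f x \<longleftrightarrow>
     (\<exists>\<delta>>0. \<exists>(f1 :: 'a \<Rightarrow> 'a \<Rightarrow>\<^sub>L 'b)
              (f2 :: 'a \<Rightarrow> 'a \<Rightarrow>\<^sub>L 'a \<Rightarrow>\<^sub>L 'b)
              (f3 :: 'a \<Rightarrow> 'a \<Rightarrow>\<^sub>L 'a \<Rightarrow>\<^sub>L 'a \<Rightarrow>\<^sub>L 'b)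
              (f4 :: 'a \<Rightarrow> 'a \<Rightarrow>\<^sub>L 'a \<Rightarrow>\<^sub>L 'a \<Rightarrow>\<^sub>L 'a \<Rightarrow>\<^sub>L 'b)
              (f5 :: 'a \<Rightarrow> 'a \<Rightarrow>\<^sub>L 'a \<Rightarrow>\<^sub>L 'a \<Rightarrow>\<^sub>L 'a \<Rightarrow>\<^sub>L 'a \<Rightarrow>\<^sub>L 'b).
        (\<forall>y\<in>ball x \<delta>.
           (f has_derivative blinfun_apply (f1 y)) (at y) \<and>
           (f1 has_derivative blinfun_apply (f2 y)) (at y) \<and>
           (f2 has_derivative blinfun_apply (f3 y)) (at y) \<and>
           (f3 has_derivative blinfun_apply (f4 y)) (at y) \<and>
           (f4 has_derivative blinfun_apply (f5 y)) (at y)) \<and>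
        isCont f5 x)"

end

theory Submission
  imports Defs "HOL-Real_Asymp.Real_Asymp"
begin

text \<open>
  A flow map that is \<open>C\<^sup>5\<close> at the origin has Taylor expansions along lines \<open>x \<mapsto> x a\<close> whose
  remainders are bounded uniformly over all directions \<open>a\<close> of bounded norm (\<open>C5_at_jets\<close>).  In particular, the coefficients that belong
  to data with a high frequency mode \<open>N\<close> of unit size must stay bounded for \<open>N \<rightarrow> \<infinity>\<close>.  Two different mechanisms violate
  this, one below and one above \<open>s = 3/2\<close>.

  For \<open>s < 3/2\<close> the culprit is the resonant term \<open>n\<^sup>3 |v n|\<^sup>2 v n\<close>.  It makes the frequency of a mode depend on its
  amplitude, and for a mode of unit size in \<open>H\<^sup>s\<close> the shift is of size \<open>N\<^bsup>3-2s\<^esup>\<close>, which becomes the third derivative of the flow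
  map.  For small \<open>s\<close> the nonlinearity is not continuous on \<open>H\<^sup>s\<close>, and solutions cannot be expanded by means of the
  Duhamel formula.  Instead, exact solutions are constructed: travelling waves with positive frequencies \<open>N, 2N, 3N, \<dots>\<close>.  For these
  all sums are finite, and the amplitudes solve a triangular system that gains two powers of \<open>N\<close> (\<open>amplitudes_exist\<close>).
  Uniqueness identifies the waves with orbits of the flow (\<open>third_order_bound\<close>).

  For \<open>s \<ge> 3/2\<close> every coordinate of the nonlinearity is a bounded multilinear expression on \<open>H\<^sup>s\<close>
  (\<open>cubic_bounded\<close>, \<open>quintic_bounded\<close>), and the Duhamel formula can be iterated.  The iteration needs estimates uniform
  in time, while the hypothesis speaks about each time separately.  They are recovered from the Baire category theorem, which gives
  uniformity on some time interval, and from the group property of the flow, which moves this interval to the origin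
  (\<open>uniform_bound_on_subinterval\<close>, \<open>backward_gluing\<close>, \<open>uniform_cubic_bound\<close>).

  The fifth order coefficient is computed for data with the modes \<open>1\<close>, \<open>-3\<close> and \<open>N\<close>.  Since \<open>1 + 1 + 1 - 3 = 0\<close>, the mode \<open>N\<close>
  returns to itself by two cubic interactions, either via \<open>N + 2\<close> or via \<open>N - 2\<close>.  Each path contributes two derivatives;
  their leading parts cancel, but a multiple of \<open>N\<close> survives, which no weight compensates (\<open>G_eq\<close>,
  \<open>fifth_order_coefficient_asymptotics\<close>).  The quintic sum does not see this interaction, since it
  excludes vanishing sums of four frequencies.  Hence the fifth derivative is unbounded.
\<close>

section \<open>Coordinates of square summable sequences\<close>

lemmas coord_rep = zero_ell2.rep_eq plus_ell2.rep_eq minus_ell2.rep_eq uminus_ell2.rep_eq scaleR_ell2.rep_eq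

lemma coord_summable: "(\<lambda>n. (cmod (coord a n))\<^sup>2) summable_on UNIV"
  using coord[of a] by simp

lemma ell2_eqI: "(\<And>n. coord a n = coord b n) \<Longrightarrow> a = b"
  by (simp add: coord_inject[symmetric] fun_eq_iff)

lemma sum_coord_le_norm: "finite F \<Longrightarrow> (\<Sum>n\<in>F. (cmod (coord a n))\<^sup>2) \<le> (norm a)\<^sup>2"
  unfolding norm_ell2_def
  by (simp add: infsum_nonneg finite_sum_le_infsum[OF coord_summable])

lemma cmod_coord_le: "cmod (coord a n) \<le> norm a"
  using sum_coord_le_norm[of "{n}" a] by (simp add: power2_le_iff_abs_le)

lemma norm_le_if_partial_sums_le:
  assumes "c \<ge> 0" "\<And>F. finite F \<Longrightarrow> (\<Sum>n\<in>F. (cmod (coord a n))\<^sup>2) \<le> c\<^sup>2"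
  shows "norm a \<le> c"
proof -
  have "(\<Sum>\<^sub>\<infinity>n. (cmod (coord a n))\<^sup>2) \<le> c\<^sup>2"
    by (rule infsum_le_finite_sums[OF coord_summable]) (use assms in auto)
  then show ?thesis
    unfolding norm_ell2_def using assms(1) by (simp add: real_le_lsqrt infsum_nonneg)
qed

lemma norm_le_iff_partial_sums_le:
  "c \<ge> 0 \<Longrightarrow> norm a \<le> c \<longleftrightarrow> (\<forall>F. finite F \<longrightarrow> (\<Sum>n\<in>F. (cmod (coord a n))\<^sup>2) \<le> c\<^sup>2)"
  using norm_le_if_partial_sums_le[of c a] order_trans[OF sum_coord_le_norm[of _ a] power_mono[of "norm a" c 2]]
  by auto

lift_definition single :: "int \<Rightarrow> complex \<Rightarrow> ell2" is "\<lambda>n z k. if k = n then z else 0"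
proof -
  fix n z
  have "(\<lambda>k. (cmod (if k = n then z else 0))\<^sup>2) summable_on {n}" by simp
  then show "(\<lambda>k. (cmod (if k = n then z else 0))\<^sup>2) summable_on UNIV"
    by (rule summable_on_cong_neutral[THEN iffD1, rotated -1]) auto
qed

lemma inner_single: "inner (single n z) a = inner z (coord a n)"
proof -
  have "inner (single n z) a = (\<Sum>\<^sub>\<infinity>k\<in>{n}. inner z (coord a k))"
    unfolding inner_ell2_def by (rule infsum_cong_neutral) (auto simp: single.rep_eq)
  then show ?thesis by simp
qed

lemma norm_single [simp]: "norm (single n z) = cmod z"
proof -
  have "(norm (single n z))\<^sup>2 = (cmod z)\<^sup>2"
    unfolding power2_norm_eq_inner inner_single by (simp add: single.rep_eq)
  then show ?thesis by (simp add: power2_eq_iff_nonneg)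
qed

lemma coord_sum: "coord (\<Sum>i\<in>F. g i) n = (\<Sum>i\<in>F. coord (g i) n)"
  by (induction F rule: infinite_finite_induct) (auto simp: coord_rep)

text \<open>
  The truncation of \<open>a\<close> to \<open>F\<close> is the extremal test vector.  This reduces norm estimates to
  scalar functions, for which one-dimensional Taylor expansions are available.
\<close>
lemma norm_le_by_finite_duality:
  assumes "c \<ge> 0"
    and test: "\<And>F z. finite F \<Longrightarrow> norm (\<Sum>n\<in>F. single n (z n)) \<le> 1 \<Longrightarrow> inner (\<Sum>n\<in>F. single n (z n)) a \<le> c"
  shows "norm a \<le> c"
proof (rule norm_le_if_partial_sums_le[OF assms(1)])
  fix F :: "int set"
  assume F: "finite F"
  define w where "w = (\<Sum>n\<in>F. single n (coord a n))"
  define q where "q = (\<Sum>n\<in>F. (cmod (coord a n))\<^sup>2)"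
  have wa: "inner w a = q"
    by (simp add: w_def q_def inner_sum_left inner_single power2_norm_eq_inner)
  have cw: "coord w n = (if n \<in> F then coord a n else 0)" for n
    using F by (auto simp: w_def coord_sum single.rep_eq)
  have "inner w w = (\<Sum>n\<in>F. inner (coord a n) (coord w n))"
    by (subst (1) w_def) (simp add: inner_sum_left inner_single)
  also have "\<dots> = q" by (simp add: cw q_def power2_norm_eq_inner)
  finally have nw: "(norm w)\<^sup>2 = q" by (simp add: power2_norm_eq_inner)
  show "q \<le> c\<^sup>2"
  proof (cases "norm w = 0")
    case True then show ?thesis using nw by auto
  next
    case False
    have sc: "(1 / norm w) *\<^sub>R w = (\<Sum>n\<in>F. single n ((1 / norm w) *\<^sub>R coord a n))"
      by (rule ell2_eqI) (use F in \<open>simp add: coord_rep coord_sum single.rep_eq cw\<close>)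
    have "inner ((1 / norm w) *\<^sub>R w) a \<le> c"
      unfolding sc by (rule test[OF F]) (use False in \<open>simp flip: sc\<close>)
    then have "norm w \<le> c"
      using False wa nw by (simp add: power2_eq_square field_simps flip: nw)
    then show ?thesis using nw by (metis norm_ge_zero power_mono)
  qed
qed

section \<open>Taylor expansions along lines\<close>

lemma has_derivative_along_line:
  fixes F :: "'a::real_normed_vector \<Rightarrow> 'c::real_normed_vector"
  assumes F: "(F has_derivative F') (at (x *\<^sub>R a))" and L: "bounded_linear (L :: 'c \<Rightarrow> real)"
  shows "((\<lambda>x. L (F (x *\<^sub>R a))) has_real_derivative L (F' a)) (at x)"
proof -
  have 1: "((\<lambda>x. x *\<^sub>R a) has_derivative (\<lambda>y. y *\<^sub>R a)) (at x)"
    by (auto intro!: derivative_eq_intros)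
  have "((\<lambda>x. F (x *\<^sub>R a)) has_derivative (\<lambda>y. F' (y *\<^sub>R a))) (at x)"
    using diff_chain_at[OF 1 F] by (simp add: o_def)
  then have "((\<lambda>x. L (F (x *\<^sub>R a))) has_derivative (\<lambda>y. L (F' (y *\<^sub>R a)))) (at x)"
    by (rule bounded_linear.has_derivative[OF L])
  moreover have "(\<lambda>y. L (F' (y *\<^sub>R a))) = (*) (L (F' a))"
    using linear_scale[OF has_derivative_linear[OF F]] linear_scale[OF bounded_linear.linear[OF L]]
    by (auto simp: fun_eq_iff mult.commute)
  ultimately show ?thesis by (simp add: has_field_derivative_def)
qed

lemma isCont_bounded_near:
  assumes "isCont (F :: 'a::real_normed_vector \<Rightarrow> 'c::real_normed_vector) 0"
  shows "\<exists>d>0. \<forall>y\<in>ball 0 d. norm (F y) \<le> norm (F 0) + 1"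
proof -
  obtain d where "d > 0" and d: "\<And>y. dist y 0 < d \<Longrightarrow> dist (F y) (F 0) < 1"
    using assms unfolding continuous_at_eps_delta by (metis zero_less_one)
  have "norm (F y) \<le> norm (F 0) + 1" if "y \<in> ball 0 d" for y
    using d[of y] that norm_triangle_ineq2[of "F y" "F 0"] by (simp add: dist_norm)
  then show ?thesis using \<open>d > 0\<close> by blast
qed

lemma maclaurin_bound:
  fixes D :: "nat \<Rightarrow> real \<Rightarrow> real"
  assumes "p > 0" "\<And>m t. m < p \<Longrightarrow> 0 \<le> t \<Longrightarrow> t < d \<Longrightarrow> (D m has_real_derivative D (Suc m) t) (at t)"
    and "\<And>t. 0 \<le> t \<Longrightarrow> t < d \<Longrightarrow> \<bar>D p t\<bar> \<le> M"
  shows "\<exists>c. \<forall>x. 0 < x \<longrightarrow> x < d \<longrightarrow> \<bar>D 0 x - (\<Sum>k<p. c k * x ^ k)\<bar> \<le> M * x ^ p"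
proof (intro exI allI impI)
  fix x assume x: "0 < x" "x < d"
  obtain t where t: "0 < t" "t < x" and eq: "D 0 x = (\<Sum>m<p. (D m 0 / fact m) * x ^ m) + (D p t / fact p) * x ^ p"
    using Maclaurin[of x p D "D 0"] x assms(1,2) by force
  have "\<bar>D p t / fact p\<bar> \<le> M / 1"
    unfolding abs_divide by (rule frac_le) (use assms(3)[of t] t x in \<open>auto intro: order_trans[OF abs_ge_zero]\<close>)
  then have "\<bar>(D p t / fact p) * x ^ p\<bar> \<le> M * x ^ p"
    unfolding abs_mult using mult_right_mono[of "\<bar>D p t / fact p\<bar>" M "\<bar>x ^ p\<bar>"] x by simp
  then show "\<bar>D 0 x - (\<Sum>k<p. (D k 0 / fact k) * x ^ k)\<bar> \<le> M * x ^ p"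
    by (simp add: eq)
qed

lemma blinfun_mono:
  assumes "norm F \<le> K" "norm a \<le> R"
  shows "norm (blinfun_apply F a) \<le> K * R"
  by (rule order_trans[OF norm_blinfun mult_mono[OF assms]])
    (use assms(1) norm_ge_zero[of F] in \<open>linarith, simp\<close>)

text \<open>
  Restricted to a line and tested against a fixed vector, \<open>f\<close> is a real function of one
  variable whose derivatives are those of \<open>f\<close>, evaluated on copies of \<open>a\<close>.  Its Lagrange remainder is
  controlled by the norm of the \<open>p\<close>-th derivative near the origin, so that neither \<open>M\<close> nor \<open>d\<close> depends on the
  direction \<open>a\<close> or on the test vector \<open>w\<close>.  This uniformity is what makes high frequencies dangerous.
\<close>
lemma C5_at_jets:
  fixes f :: "'a::real_normed_vector \<Rightarrow> 'b::real_inner"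
  assumes "C5_at f 0" and "R > 0"
  shows "\<exists>M>0. \<exists>d>0. \<forall>a w p. norm a \<le> R \<longrightarrow> norm w \<le> 1 \<longrightarrow> p \<in> {1, 3, 5} \<longrightarrow>
    (\<exists>c. \<forall>x. 0 < x \<longrightarrow> x < d \<longrightarrow> \<bar>inner w (f (x *\<^sub>R a)) - (\<Sum>k<p. c k * x ^ k)\<bar> \<le> M * x ^ p)"
proof -
  obtain e f1 f2 f3 f4 f5 where "e > 0" and
    der: "\<forall>y\<in>ball 0 e.
           (f has_derivative blinfun_apply (f1 y)) (at y) \<and>
           (f1 has_derivative blinfun_apply (f2 y)) (at y) \<and>
           (f2 has_derivative blinfun_apply (f3 y)) (at y) \<and>
           (f3 has_derivative blinfun_apply (f4 y)) (at y) \<and>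
           (f4 has_derivative blinfun_apply (f5 y)) (at y)"
    and c5: "isCont f5 0"
    using assms(1) unfolding C5_at_def by blast
  have z: "0 \<in> ball 0 e" using \<open>e > 0\<close> by simp
  have "isCont f1 0" "isCont f3 0" using der z by (blast intro: has_derivative_continuous)+
  then obtain e1 e3 e5 where e135: "e1 > 0" "e3 > 0" "e5 > 0"
    and b1: "\<And>y. y \<in> ball 0 e1 \<Longrightarrow> norm (f1 y) \<le> norm (f1 0) + 1"
    and b3: "\<And>y. y \<in> ball 0 e3 \<Longrightarrow> norm (f3 y) \<le> norm (f3 0) + 1"
    and b5: "\<And>y. y \<in> ball 0 e5 \<Longrightarrow> norm (f5 y) \<le> norm (f5 0) + 1"
    using isCont_bounded_near[of f1] isCont_bounded_near[of f3] isCont_bounded_near[OF c5] by blast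
  define d where "d = min (min e e1) (min e3 e5) / R"
  have "d > 0" using \<open>e > 0\<close> e135 assms(2) by (simp add: d_def)
  define K where "K = norm (f1 0) + norm (f3 0) + norm (f5 0) + 1"
  define M where "M = K * (R + R^3 + R^5)"
  have "K > 0" by (simp add: K_def add_nonneg_pos)
  then have "M > 0" using assms(2) by (simp add: M_def add_pos_pos)
  have "\<exists>c. \<forall>x. 0 < x \<longrightarrow> x < d \<longrightarrow> \<bar>inner w (f (x *\<^sub>R a)) - (\<Sum>k<p. c k * x ^ k)\<bar> \<le> M * x ^ p"
    if a: "norm a \<le> R" and w: "norm w \<le> 1" and p: "p \<in> {1,3,5}" for a w and p :: nat
  proof -
    define D :: "nat \<Rightarrow> real \<Rightarrow> real" where "D m x =
      (if m = 0 then inner w (f (x *\<^sub>R a))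
       else if m = 1 then inner w (f1 (x *\<^sub>R a) a)
       else if m = 2 then inner w (f2 (x *\<^sub>R a) a a)
       else if m = 3 then inner w (f3 (x *\<^sub>R a) a a a)
       else if m = 4 then inner w (f4 (x *\<^sub>R a) a a a a)
       else inner w (f5 (x *\<^sub>R a) a a a a a))" for m x
    have line: "norm (x *\<^sub>R a) < min (min e e1) (min e3 e5)" if "0 \<le> x" "x < d" for x
    proof -
      have "norm (x *\<^sub>R a) \<le> x * R" using a that by (simp add: mult_left_mono)
      also have "\<dots> < d * R" using that assms(2) by simp
      finally show ?thesis using assms(2) by (simp add: d_def)
    qed
    note L = bounded_linear_compose[OF bounded_linear_inner_right[of w] blinfun.bounded_linear_left[of a]]
    note L2 = bounded_linear_compose[OF L blinfun.bounded_linear_left[of a]]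
    note L3 = bounded_linear_compose[OF L2 blinfun.bounded_linear_left[of a]]
    note L4 = bounded_linear_compose[OF L3 blinfun.bounded_linear_left[of a]]
    have DD: "(D m has_real_derivative D (Suc m) x) (at x)" if "m < 5" "0 \<le> x" "x < d" for m x
    proof -
      note * = der[rule_format, of "x *\<^sub>R a"]
      have y: "x *\<^sub>R a \<in> ball 0 e" using line[OF that(2,3)] by simp
      consider "m = 0" | "m = 1" | "m = 2" | "m = 3" | "m = 4" using \<open>m < 5\<close> by linarith
      then show ?thesis
      proof cases
        case 1
        have "((\<lambda>x. inner w (f (x *\<^sub>R a))) has_real_derivative inner w (f1 (x *\<^sub>R a) a)) (at x)"
          by (rule has_derivative_along_line[where L = "\<lambda>F. inner w F"]) (use *[OF y] bounded_linear_inner_right in auto)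
        then show ?thesis using 1 by (simp add: D_def[abs_def])
      next
        case 2
        have "((\<lambda>x. inner w (f1 (x *\<^sub>R a) a)) has_real_derivative inner w (f2 (x *\<^sub>R a) a a)) (at x)"
          by (rule has_derivative_along_line[where L = "\<lambda>F. inner w (blinfun_apply F a)"]) (use *[OF y] L in auto)
        then show ?thesis using 2 by (simp add: D_def[abs_def])
      next
        case 3
        have "((\<lambda>x. inner w (f2 (x *\<^sub>R a) a a)) has_real_derivative inner w (f3 (x *\<^sub>R a) a a a)) (at x)"
          by (rule has_derivative_along_line[where L = "\<lambda>F. inner w (blinfun_apply (blinfun_apply F a) a)"]) (use *[OF y] L2 in auto)
        then show ?thesis using 3 by (simp add: D_def[abs_def] numeral_3_eq_3[symmetric])
      next
        case 4
        have "((\<lambda>x. inner w (f3 (x *\<^sub>R a) a a a)) has_real_derivative inner w (f4 (x *\<^sub>R a) a a a a)) (at x)"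
          by (rule has_derivative_along_line[where L = "\<lambda>F. inner w (blinfun_apply (blinfun_apply (blinfun_apply F a) a) a)"]) (use *[OF y] L3 in auto)
        then show ?thesis using 4 by (simp add: D_def[abs_def])
      next
        case 5
        have "((\<lambda>x. inner w (f4 (x *\<^sub>R a) a a a a)) has_real_derivative inner w (f5 (x *\<^sub>R a) a a a a a)) (at x)"
          by (rule has_derivative_along_line[where L = "\<lambda>F. inner w (blinfun_apply (blinfun_apply (blinfun_apply (blinfun_apply F a) a) a) a)"]) (use *[OF y] L4 in auto)
        then show ?thesis using 5 by (simp add: D_def[abs_def])
      qed
    qed
    have bound: "\<bar>D p x\<bar> \<le> M" if "0 \<le> x" "x < d" for x
    proof -
      note y = line[OF that]
      have cs: "\<bar>inner w v\<bar> \<le> norm v" for v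
        using Cauchy_Schwarz_ineq2[of w v] w mult_right_mono[OF w norm_ge_zero[of v]] by simp
      have "norm (f1 (x *\<^sub>R a) a) \<le> K * R"
        by (intro blinfun_mono a order_trans[OF b1]) (use y in \<open>auto simp: K_def\<close>)
      moreover have "norm (f3 (x *\<^sub>R a) a a a) \<le> K * R * R * R"
        by (intro blinfun_mono a order_trans[OF b3]) (use y in \<open>auto simp: K_def\<close>)
      moreover have "norm (f5 (x *\<^sub>R a) a a a a a) \<le> K * R * R * R * R * R"
        by (intro blinfun_mono a order_trans[OF b5]) (use y in \<open>auto simp: K_def\<close>)
      moreover have "K * R \<le> M" "K * R * R * R \<le> M" "K * R * R * R * R * R \<le> M"
        using \<open>K > 0\<close> assms(2) by (simp_all add: M_def algebra_simps power_numeral_reduce add_nonneg_nonneg)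
      ultimately show ?thesis
        using p cs[of "f1 (x *\<^sub>R a) a"] cs[of "f3 (x *\<^sub>R a) a a a"] cs[of "f5 (x *\<^sub>R a) a a a a a"]
        by (auto simp: D_def)
    qed
    have "\<exists>c. \<forall>x. 0 < x \<longrightarrow> x < d \<longrightarrow> \<bar>D 0 x - (\<Sum>k<p. c k * x ^ k)\<bar> \<le> M * x ^ p"
      by (rule maclaurin_bound) (use p DD bound in auto)
    then show ?thesis by (simp add: D_def)
  qed
  then show ?thesis using \<open>M > 0\<close> \<open>d > 0\<close> by blast
qed

lemma C5_at_lipschitz:
  fixes f :: "'a::real_normed_vector \<Rightarrow> 'b::real_normed_vector"
  assumes "C5_at f 0"
  shows "\<exists>M>0. \<exists>d>0. \<forall>a\<in>ball 0 d. \<forall>b\<in>ball 0 d. norm (f a - f b) \<le> M * norm (a - b)"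
proof -
  obtain e f1 and f2 :: "'a \<Rightarrow> 'a \<Rightarrow>\<^sub>L 'a \<Rightarrow>\<^sub>L 'b" where "e > 0" and
    der: "\<And>y. y \<in> ball 0 e \<Longrightarrow> (f has_derivative blinfun_apply (f1 y)) (at y)"
         "\<And>y. y \<in> ball 0 e \<Longrightarrow> (f1 has_derivative blinfun_apply (f2 y)) (at y)"
    using assms unfolding C5_at_def by blast
  have "isCont f1 0" using der(2)[of 0] \<open>e > 0\<close> by (auto intro: has_derivative_continuous)
  then obtain e1 where "e1 > 0" and b1: "\<And>y. y \<in> ball 0 e1 \<Longrightarrow> norm (f1 y) \<le> norm (f1 0) + 1"
    using isCont_bounded_near[of f1] by blast
  have "norm (f a - f b) \<le> (norm (f1 0) + 1) * norm (a - b)"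
    if "a \<in> ball 0 (min e e1)" "b \<in> ball 0 (min e e1)" for a b
  proof (rule differentiable_bound[where S = "ball 0 (min e e1)" and f' = "\<lambda>y. blinfun_apply (f1 y)"])
    fix y :: 'a assume y: "y \<in> ball 0 (min e e1)"
    show "(f has_derivative blinfun_apply (f1 y)) (at y within ball 0 (min e e1))"
      using der(1)[of y] y by (simp add: has_derivative_at_withinI)
    show "onorm (blinfun_apply (f1 y)) \<le> norm (f1 0) + 1"
      using b1[of y] y by (simp add: norm_blinfun.rep_eq)
  qed (use that in auto)
  moreover have "norm (f1 0) + 1 > 0" by (simp add: add_nonneg_pos)
  moreover have "min e e1 > 0" using \<open>e > 0\<close> \<open>e1 > 0\<close> by simp
  ultimately show ?thesis by blast
qed

lemma polynomial_zero_if_small: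
  fixes c :: "nat \<Rightarrow> real"
  assumes "d > 0" "\<And>x. 0 < x \<Longrightarrow> x < d \<Longrightarrow> \<bar>\<Sum>k<p. c k * x ^ k\<bar> \<le> B * x ^ p" "k < p"
  shows "c k = 0"
  using assms
proof (induction p arbitrary: c k)
  case 0 then show ?case by simp
next
  case (Suc p)
  have split: "(\<Sum>k<Suc p. c k * x ^ k) = c 0 + x * (\<Sum>k<p. c (Suc k) * x ^ k)" for x
    by (simp add: sum.lessThan_Suc_shift sum_distrib_left algebra_simps del: sum.lessThan_Suc)
  have "c 0 = 0"
  proof -
    have ev: "\<forall>\<^sub>F x in at_right 0. \<bar>c 0 + x * (\<Sum>k<p. c (Suc k) * x ^ k)\<bar> \<le> B * x ^ Suc p"
      unfolding eventually_at_right_field using Suc.prems(1,2) split by auto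
    have 1: "((\<lambda>x. \<bar>c 0 + x * (\<Sum>k<p. c (Suc k) * x ^ k)\<bar>) \<longlongrightarrow> \<bar>c 0 + 0 * (\<Sum>k<p. c (Suc k) * 0 ^ k)\<bar>) (at_right 0)"
      by (intro tendsto_intros)
    have 2: "((\<lambda>x. B * x ^ Suc p) \<longlongrightarrow> B * 0 ^ Suc p) (at_right 0)"
      by (intro tendsto_intros)
    have "\<bar>c 0 + 0 * (\<Sum>k<p. c (Suc k) * 0 ^ k)\<bar> \<le> B * 0 ^ Suc p"
      by (rule tendsto_le[OF _ 2 1 ev]) simp
    then show ?thesis by simp
  qed
  moreover have "c (Suc j) = 0" if "j < p" for j
  proof (rule Suc.IH[OF \<open>d > 0\<close> _ that])
    fix x :: real assume x: "0 < x" "x < d"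
    have "x * \<bar>\<Sum>k<p. c (Suc k) * x ^ k\<bar> \<le> x * (B * x ^ p)"
      using Suc.prems(2)[OF x] split[of x] \<open>c 0 = 0\<close> x by (simp add: abs_mult algebra_simps)
    then show "\<bar>\<Sum>k<p. c (Suc k) * x ^ k\<bar> \<le> B * x ^ p" using x by simp
  qed
  ultimately show ?case using Suc.prems(3) by (cases k) auto
qed

text \<open>
  A Taylor polynomial can be read off from any other expansion of the same function.  The bound on
  \<open>G\<close> is how the size of a derivative is measured: the two remainders alone have to account for the
  coefficient of \<open>x\<^sup>p\<close>.  The range \<open>d'\<close> of the second expansion may
  shrink with the frequency under consideration.
\<close>
lemma jet_unique:
  fixes g :: "real \<Rightarrow> real"
  assumes "d > 0" "\<And>x. 0 < x \<Longrightarrow> x < d \<Longrightarrow> \<bar>g x - (\<Sum>k<p. c k * x ^ k)\<bar> \<le> M * x ^ p"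
    and "d' > 0" "\<And>x. 0 < x \<Longrightarrow> x < d' \<Longrightarrow> \<bar>g x - (\<Sum>k<p. c' k * x ^ k) - G * x ^ p\<bar> \<le> B * x ^ p"
  shows "\<And>k. k < p \<Longrightarrow> c k = c' k" and "\<bar>G\<bar> \<le> M + B"
proof -
  have diff: "\<bar>(\<Sum>k<p. (c k - c' k) * x ^ k) - G * x ^ p\<bar> \<le> (M + B) * x ^ p"
    if "0 < x" "x < min d d'" for x
    using assms(2)[of x] assms(4)[of x] that by (simp add: left_diff_distrib sum_subtractf algebra_simps)
  show eq: "c k = c' k" if k: "k < p" for k
  proof -
    have "c k - c' k = 0"
    proof (rule polynomial_zero_if_small[where d = "min d d'" and p = p and B = "\<bar>G\<bar> + (M + B)"])
      fix x :: real assume x: "0 < x" "x < min d d'"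
      have "\<bar>G * x ^ p\<bar> = \<bar>G\<bar> * x ^ p" using x by (simp add: abs_mult)
      then show "\<bar>\<Sum>k<p. (c k - c' k) * x ^ k\<bar> \<le> (\<bar>G\<bar> + (M + B)) * x ^ p"
        using diff[OF x] by (simp add: algebra_simps)
    qed (use assms k in auto)
    then show ?thesis by simp
  qed
  define x where "x = min d d' / 2"
  have x: "0 < x" "x < min d d'" using assms(1,3) by (auto simp: x_def)
  have "\<bar>G\<bar> * x ^ p \<le> (M + B) * x ^ p"
    using diff[OF x] eq x by (simp add: abs_mult)
  then show "\<bar>G\<bar> \<le> M + B" using x by simp
qed

section \<open>The Duhamel formula in the interaction picture\<close>

text \<open>
  After multiplication with \<open>cis (-t * dispersion d1 d2 n)\<close> the linear part disappears from the
  Duhamel formula, and the integrand no longer depends on the endpoint \<open>t\<close>.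
\<close>
definition duhamel_integrand :: "real \<Rightarrow> real \<Rightarrow> real \<Rightarrow> (real \<Rightarrow> ell2) \<Rightarrow> int \<Rightarrow> real \<Rightarrow> complex" where
  "duhamel_integrand d1 d2 s u n \<tau> = cis (- \<tau> * dispersion d1 d2 n) * nonlinearity (fourier s (u \<tau>)) n"

lemma interval_integrable_cmult_iff:
  fixes c :: complex
  assumes "c \<noteq> 0"
  shows "interval_lebesgue_integrable M a b (\<lambda>x. c * f x) \<longleftrightarrow> interval_lebesgue_integrable M a b f"
proof
  assume "interval_lebesgue_integrable M a b (\<lambda>x. c * f x)"
  then have "interval_lebesgue_integrable M a b (\<lambda>x. inverse c * (c * f x))" by simp
  then show "interval_lebesgue_integrable M a b f" using assms by (simp add: mult.assoc[symmetric])
qed simp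

lemma solution_iff:
  "solution d1 d2 s T a u \<longleftrightarrow>
     continuous_on {-T..T} u \<and>
     (\<forall>n. (AE \<tau> in lborel. \<tau> \<in> {-T..T} \<longrightarrow> nonlinearity_converges (fourier s (u \<tau>)) n)) \<and>
     (\<forall>n. \<forall>t\<in>{-T..T}.
        interval_lebesgue_integrable lborel 0 t (duhamel_integrand d1 d2 s u n) \<and>
        fourier s (u t) n = cis (t * dispersion d1 d2 n) *
          (fourier s a n + (LBINT \<tau>=0..t. duhamel_integrand d1 d2 s u n \<tau>)))"
proof -
  have eq: "(\<lambda>\<tau>. cis ((t - \<tau>) * dispersion d1 d2 n) * nonlinearity (fourier s (u \<tau>)) n) =
      (\<lambda>\<tau>. cis (t * dispersion d1 d2 n) * duhamel_integrand d1 d2 s u n \<tau>)" for t n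
    by (simp add: fun_eq_iff duhamel_integrand_def cis_mult mult.assoc[symmetric] left_diff_distrib)
  show ?thesis
    unfolding solution_def eq by (simp add: interval_integrable_cmult_iff distrib_left)
qed

lemma set_integrable_closed_interval:
  assumes "interval_lebesgue_integrable lborel (ereal a) (ereal b) f" "a \<le> b"
  shows "set_integrable lborel {a..b} f"
proof -
  have "set_integrable lborel {a<..<b} f"
    using assms by (simp add: interval_lebesgue_integrable_def)
  then show ?thesis
    unfolding set_integrable_def
    by (rule integrable_discrete_difference[where X="{a,b}", THEN iffD1, rotated -1])
       (auto simp: indicator_def)
qed

lemma solution_set_integrable:
  assumes sol: "solution d1 d2 s T a u" and T: "0 \<le> T"
  shows "set_integrable lborel {-T..T} (duhamel_integrand d1 d2 s u n)"
proof -
  have "interval_lebesgue_integrable lborel 0 T (duhamel_integrand d1 d2 s u n)"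
    "interval_lebesgue_integrable lborel (-T) 0 (duhamel_integrand d1 d2 s u n)"
    using sol[unfolded solution_iff, THEN conjunct2, THEN conjunct2, rule_format, of T n]
      sol[unfolded solution_iff, THEN conjunct2, THEN conjunct2, rule_format, of "-T" n] T
      interval_integrable_endpoints_reverse[of 0 "ereal (-T)" "duhamel_integrand d1 d2 s u n"] by auto
  then have "set_integrable lborel {0..T} (duhamel_integrand d1 d2 s u n)"
    "set_integrable lborel {-T..0} (duhamel_integrand d1 d2 s u n)"
    using T by (auto intro!: set_integrable_closed_interval simp: zero_ereal_def)
  then have "set_integrable lborel ({-T..0} \<union> {0..T}) (duhamel_integrand d1 d2 s u n)"
    by (intro set_integrable_Un) auto
  moreover have "{-T..0} \<union> {0..T} = {-T..T}" using T by auto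
  ultimately show ?thesis by simp
qed

lemma interval_integrable_within:
  assumes "set_integrable lborel {-T..T} f" "a \<in> {-T..T}" "b \<in> {-T..T}"
  shows "interval_lebesgue_integrable lborel (ereal a) (ereal b) f"
  unfolding interval_lebesgue_integrable_def
  using assms(2,3) by (auto intro!: set_integrable_subset[OF assms(1)])

lemma solution_initial:
  assumes "solution d1 d2 s T a u" "0 \<le> T"
  shows "u 0 = a"
proof -
  have "fourier s (u 0) n = fourier s a n" for n
    using assms unfolding solution_iff by (auto simp: zero_ereal_def[symmetric])
  then have "fourier s (u 0) = fourier s a" by auto
  then show ?thesis
    using bij_betw_fourier[of s] by (auto simp: bij_betw_def inj_on_def)
qed

lemma shifted_integral:
  fixes h :: "real \<Rightarrow> complex"
  assumes t: "0 \<le> t" and h: "set_integrable lborel {-p..t - p} h"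
  shows "set_integrable lborel {0..t} (\<lambda>\<sigma>. h (\<sigma> - p))"
    and "(LBINT \<sigma>=0..t. h (\<sigma> - p)) = (LBINT \<sigma>=-p..t-p. h \<sigma>)"
proof -
  have ind: "indicator {-p..t - p} (- p + 1 * x) *\<^sub>R h (- p + 1 * x) = indicator {0..t} x *\<^sub>R h (x - p)" for x
    by (auto simp: indicator_def algebra_simps)
  show "set_integrable lborel {0..t} (\<lambda>\<sigma>. h (\<sigma> - p))"
    using h lborel_integrable_real_affine_iff[of 1 "\<lambda>x. indicator {-p..t - p} x *\<^sub>R h x" "-p"]
    unfolding set_integrable_def ind by simp
  show "(LBINT \<sigma>=0..t. h (\<sigma> - p)) = (LBINT \<sigma>=-p..t-p. h \<sigma>)"
    using t lborel_integral_real_affine[of 1 "\<lambda>x. indicator {-p..t - p} x *\<^sub>R h x" "-p"]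
    unfolding ind zero_ereal_def
    by (simp add: interval_integral_Icc set_lebesgue_integral_def)
qed

lemma AE_shift:
  assumes "AE x in lborel. P (x :: real)"
  shows "AE x in lborel. P (x - p)"
proof -
  have "AE x in distr lborel borel ((+) (-p)). P x"
    unfolding lborel_distr_plus by (rule assms)
  then have "AE x in lborel. P (-p + x)" by (rule AE_distrD[rotated]) simp
  then show ?thesis by (simp add: algebra_simps)
qed

section \<open>The flow\<close>

locale flow =
  fixes d1 d2 s T r :: real and S :: "real \<Rightarrow> ell2 \<Rightarrow> ell2"
  assumes T: "T > 0" and r: "r > 0" and unique_flow: "unique_local_flow d1 d2 s T r S"
begin

lemma sol: "norm a < r \<Longrightarrow> solution d1 d2 s T a (\<lambda>t. S t a)"
  using unique_flow by (simp add: unique_local_flow_def)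

lemma uniq: "norm a < r \<Longrightarrow> solution d1 d2 s T a w \<Longrightarrow> t \<in> {-T..T} \<Longrightarrow> S t a = w t"
  using unique_flow by (simp add: unique_local_flow_def)

lemma at_time_zero: "norm a < r \<Longrightarrow> S 0 a = a"
  using solution_initial[OF sol] T by simp

lemma zero_sol: "t \<in> {-T..T} \<Longrightarrow> S t 0 = 0"
proof (rule uniq)
  have f0: "fourier s 0 = (\<lambda>_. 0)" by (simp add: fourier_def fun_eq_iff coord_rep)
  have "cubicA (\<lambda>_. 0) = (\<lambda>_. 0)" "cubicB (\<lambda>_. 0) = (\<lambda>_. 0)" "quintic (\<lambda>_. 0) = (\<lambda>_. 0)"
    by (auto simp: cubicA_def cubicB_def quintic_def)
  then show "solution d1 d2 s T 0 (\<lambda>_. 0)"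
    unfolding solution_def by (simp add: f0 nonlinearity_def nonlinearity_converges_def interval_lebesgue_integrable_def set_integrable_def)
qed (use r in auto)

text \<open>
  Uniqueness turns the flow into a group.  The orbit that follows \<open>a = S (-p) b\<close> for negative times and
  the orbit of \<open>b\<close>, delayed by \<open>p\<close>, for positive times is a solution with datum \<open>a\<close>.  Gluing is needed
  because uniqueness is only known for solutions on the whole interval.
\<close>
lemma backward_gluing:
  assumes b: "norm b < r" and a: "norm (S (-p) b) < r" and p: "0 \<le> p" "p \<le> T" and t: "t \<in> {0..T}"
  shows "S t (S (-p) b) = S (t - p) b"
proof -
  define a where "a = S (-p) b"
  note solb = sol[OF b] and sola = sol[OF assms(2), folded a_def]
  define z where "z t = (if t \<le> 0 then S t a else S (t - p) b)" for t
  have z_pos: "z t = S (t - p) b" if "0 \<le> t" for t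
    using that at_time_zero[OF assms(2)] by (auto simp: z_def a_def)
  let ?L = "dispersion d1 d2"
  have zpp: "-p \<in> {-T..T}" using p by auto
  have "solution d1 d2 s T a z"
    unfolding solution_iff
  proof (intro conjI allI ballI)
    have ca: "continuous_on {-T..T} (\<lambda>t. S t a)" and cb: "continuous_on {-T..T} (\<lambda>t. S t b)"
      using sola solb by (auto simp: solution_def)
    show "continuous_on {-T..T} z"
      unfolding z_def
    proof (rule continuous_on_cases_le)
      show "continuous_on {t \<in> {-T..T}. t \<le> 0} (\<lambda>t. S t a)"
        by (rule continuous_on_subset[OF ca]) auto
      show "continuous_on {t \<in> {-T..T}. 0 \<le> t} (\<lambda>t. S (t - p) b)"
        by (rule continuous_on_compose2[OF cb]) (use p in \<open>auto intro!: continuous_intros\<close>)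
      show "S t a = S (t - p) b" if "t = 0" for t
        using that at_time_zero[OF assms(2)] by (simp add: a_def)
    qed (auto intro: continuous_intros)
  next
    fix n
    have "AE \<tau> in lborel. \<tau> \<in> {-T..T} \<longrightarrow> nonlinearity_converges (fourier s (S \<tau> a)) n"
      using sola by (simp add: solution_def)
    moreover have "AE \<tau> in lborel. \<tau> - p \<in> {-T..T} \<longrightarrow> nonlinearity_converges (fourier s (S (\<tau> - p) b)) n"
      by (rule AE_shift[where P = "\<lambda>\<tau>. \<tau> \<in> {-T..T} \<longrightarrow> nonlinearity_converges (fourier s (S \<tau> b)) n"])
        (use solb in \<open>unfold solution_def, blast\<close>)
    ultimately show "AE \<tau> in lborel. \<tau> \<in> {-T..T} \<longrightarrow> nonlinearity_converges (fourier s (z \<tau>)) n"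
      by eventually_elim (use p in \<open>auto simp: z_def\<close>)
  next
    fix n t assume t: "t \<in> {-T..T}"
    define h where "h = duhamel_integrand d1 d2 s (\<lambda>t. S t b) n"
    have hI: "set_integrable lborel {-T..T} h"
      unfolding h_def using solution_set_integrable[OF solb] T by simp
    have Gz: "duhamel_integrand d1 d2 s z n \<sigma> = cis (- p * ?L n) * h (\<sigma> - p)" if "0 \<le> \<sigma>" for \<sigma>
      using that by (simp add: duhamel_integrand_def h_def z_pos cis_mult mult.assoc[symmetric] algebra_simps)
    have Gz': "duhamel_integrand d1 d2 s z n \<sigma> = duhamel_integrand d1 d2 s (\<lambda>t. S t a) n \<sigma>" if "\<sigma> \<le> 0" for \<sigma>
      using that by (simp add: duhamel_integrand_def z_def)
    have main: "interval_lebesgue_integrable lborel 0 t (duhamel_integrand d1 d2 s z n) \<and>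
        fourier s (z t) n = cis (t * ?L n) * (fourier s a n + (LBINT \<tau>=0..t. duhamel_integrand d1 d2 s z n \<tau>))"
    proof (cases "t \<le> 0")
      case True
      have "interval_lebesgue_integrable lborel 0 t (duhamel_integrand d1 d2 s z n) =
        interval_lebesgue_integrable lborel 0 t (duhamel_integrand d1 d2 s (\<lambda>t. S t a) n)"
        unfolding interval_lebesgue_integrable_def
        using True set_integrable_cong[OF refl refl Gz', of "{t<..<0}"] by (auto simp: zero_ereal_def)
      moreover have "(LBINT \<tau>=0..t. duhamel_integrand d1 d2 s z n \<tau>) = (LBINT \<tau>=0..t. duhamel_integrand d1 d2 s (\<lambda>t. S t a) n \<tau>)"
        by (rule interval_integral_cong) (use True in \<open>auto intro!: Gz' simp: zero_ereal_def min_def max_def split: if_splits\<close>)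
      ultimately show ?thesis
        using sola t True unfolding solution_iff z_def by auto
    next
      case False
      then have t0: "0 \<le> t" and tp: "t - p \<in> {-T..T}" using t p by auto
      have sub: "set_integrable lborel {-p..t - p} h"
        by (rule set_integrable_subset[OF hI]) (use p t in auto)
      note sh = shifted_integral[OF t0 sub]
      have int_z: "set_integrable lborel {0..t} (duhamel_integrand d1 d2 s z n)"
        using set_integrable_mult_right[OF sh(1), of "cis (- p * ?L n)"]
        by (subst set_integrable_cong[OF refl refl Gz]) auto
      then have 1: "interval_lebesgue_integrable lborel 0 t (duhamel_integrand d1 d2 s z n)"
        unfolding interval_lebesgue_integrable_def zero_ereal_def
        using t0 by (auto intro: set_integrable_subset)
      have "(LBINT \<tau>=0..t. duhamel_integrand d1 d2 s z n \<tau>) = (LBINT \<tau>=0..t. cis (- p * ?L n) * h (\<tau> - p))"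
      proof (rule interval_integral_cong)
        fix x assume "x \<in> einterval (min 0 (ereal t)) (max 0 (ereal t))"
        then have "0 \<le> x" using t0 by (simp add: zero_ereal_def min_def max_def split: if_splits)
        then show "duhamel_integrand d1 d2 s z n x = cis (- p * ?L n) * h (x - p)" by (rule Gz)
      qed
      also have "\<dots> = cis (- p * ?L n) * (LBINT \<sigma>=-p..t-p. h \<sigma>)"
        using sh(2) by simp
      finally have 2: "(LBINT \<tau>=0..t. duhamel_integrand d1 d2 s z n \<tau>) = cis (- p * ?L n) * (LBINT \<sigma>=-p..t-p. h \<sigma>)" .
      have db: "fourier s (S t' b) n = cis (t' * ?L n) * (fourier s b n + (LBINT \<tau>=0..t'. h \<tau>))" if "t' \<in> {-T..T}" for t'
        using solb that unfolding solution_iff h_def by blast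
      have add: "(LBINT \<tau>=0..-p. h \<tau>) + (LBINT \<tau>=-p..t-p. h \<tau>) = (LBINT \<tau>=0..t-p. h \<tau>)"
        unfolding zero_ereal_def uminus_ereal.simps
        by (rule interval_integral_sum, unfold ereal_min[symmetric] ereal_max[symmetric], rule interval_integrable_within[OF hI])
          (use T p tp in \<open>auto simp: min_def max_def\<close>)
      have "fourier s (z t) n = cis ((t - p) * ?L n) * (fourier s b n + ((LBINT \<tau>=0..-p. h \<tau>) + (LBINT \<tau>=-p..t-p. h \<tau>)))"
        unfolding add z_pos[OF t0] using db[OF tp] by simp
      also have "\<dots> = cis (t * ?L n) * (cis (- p * ?L n) * (fourier s b n + (LBINT \<tau>=0..-p. h \<tau>))
          + cis (- p * ?L n) * (LBINT \<tau>=-p..t-p. h \<tau>))"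
      proof -
        have "cis ((t - p) * ?L n) = cis (t * ?L n) * cis (- p * ?L n)"
          by (simp add: cis_mult algebra_simps)
        then show ?thesis by (simp only: distrib_left mult.assoc add.assoc)
      qed
      also have "cis (- p * ?L n) * (fourier s b n + (LBINT \<tau>=0..-p. h \<tau>)) = fourier s a n"
        using db[OF zpp] by (simp add: a_def)
      finally show ?thesis using 1 2 by simp
    qed
    then show "interval_lebesgue_integrable lborel 0 t (duhamel_integrand d1 d2 s z n)"
      "fourier s (z t) n = cis (t * ?L n) * (fourier s a n + (LBINT \<tau>=0..t. duhamel_integrand d1 d2 s z n \<tau>))"
      by auto
  qed
  then have "S t a = z t"
    using uniq[of a z t] assms(2) t by (simp add: a_def)
  then show ?thesis using z_pos t by (simp add: a_def)
qed

end

section \<open>A uniform boundedness principle in time\<close>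

text \<open>
  The Baire category theorem on a compact interval.
\<close>
lemma closed_cover_interval:
  fixes E :: "nat \<Rightarrow> real set"
  assumes "T > 0" "\<And>m. closed (E m)" "{0..T} \<subseteq> (\<Union>m. E m)"
  shows "\<exists>m t0 \<eta>. 0 \<le> t0 \<and> 0 < \<eta> \<and> t0 + \<eta> \<le> T \<and> {t0..t0+\<eta>} \<subseteq> E m"
proof -
  define G where "G m = {0..T} - E m" for m
  have op: "openin (top_of_set {0..T}) (G m)" for m
    unfolding G_def using assms(2)[of m] by (metis Diff_Compl Diff_eq Int_commute closed_open openin_open)
  \<comment> \<open>Otherwise the intersection of all \<open>G m\<close> would be dense, but it is empty.\<close>
  have "\<exists>m. \<not> {0..T} \<subseteq> closure (G m)"
  proof (rule ccontr)
    assume "\<nexists>m. \<not> {0..T} \<subseteq> closure (G m)"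
    then have "{0..T} \<subseteq> closure (\<Inter> (range G))"
      using op by (intro Baire) auto
    moreover have "\<Inter> (range G) = {}"
      using assms(3) unfolding G_def by blast
    ultimately show False using \<open>T > 0\<close> by auto
  qed
  then obtain m x where x: "x \<in> {0..T}" "x \<notin> closure (G m)" by blast
  then obtain e where "e > 0" and e: "\<And>y. y \<in> G m \<Longrightarrow> \<not> dist y x < e"
    by (meson closure_approachable)
  define t0 where "t0 = max 0 (x - e/2)"
  define t1 where "t1 = min T (x + e/2)"
  have "t0 < t1" "0 \<le> t0" "t1 \<le> T" using x(1) \<open>e > 0\<close> \<open>T > 0\<close> by (auto simp: t0_def t1_def)
  moreover have "{t0..t1} \<subseteq> E m"
  proof
    fix y assume y: "y \<in> {t0..t1}"
    then have "dist y x < e" using \<open>e > 0\<close> by (auto simp: t0_def t1_def dist_real_def)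
    then have "y \<notin> G m" using e by blast
    then show "y \<in> E m" using y \<open>0 \<le> t0\<close> \<open>t1 \<le> T\<close> by (auto simp: G_def)
  qed
  ultimately show ?thesis
    by (intro exI[of _ m] exI[of _ t0] exI[of _ "t1 - t0"]) auto
qed

text \<open>
  Differentiability of each \<open>S t\<close> comes without any uniformity in \<open>t\<close>.  The sets of times at which the
  bound holds with a fixed constant are closed, because the norm is lower semicontinuous
  under convergence of coordinates; by Baire one of them contains an interval.
\<close>
lemma uniform_bound_on_subinterval:
  fixes D :: "real \<Rightarrow> ell2 \<Rightarrow> ell2"
  assumes "T > 0" "(r::real) > 0"
    and cont: "\<And>a n. norm (a::ell2) < r \<Longrightarrow> continuous_on {0..T} (\<lambda>t. coord (D t a) n)"
    and bound: "\<And>t. t \<in> {0..T} \<Longrightarrow> \<exists>C>0. \<exists>d>0. \<forall>a. norm (a::ell2) < d \<longrightarrow> norm (D t a) \<le> C * norm a ^ k"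
  shows "\<exists>t0 \<eta> C d. 0 \<le> t0 \<and> 0 < \<eta> \<and> t0 + \<eta> \<le> T \<and> 0 < C \<and> 0 < d \<and>
    (\<forall>t\<in>{t0..t0+\<eta>}. \<forall>a. norm (a::ell2) < d \<longrightarrow> norm (D t a) \<le> C * norm a ^ k)"
proof -
  define A where "A m = {a :: ell2. norm a < r \<and> norm a < 1 / Suc m}" for m
  define E where "E m = {t \<in> {0..T}. \<forall>a\<in>A m. norm (D t a) \<le> Suc m * norm a ^ k}" for m
  have "closed (E m)" for m
  proof -
    have "E m = {0..T} \<inter> (\<Inter>a\<in>A m. \<Inter>F\<in>Collect finite.
       {t \<in> {0..T}. (\<Sum>n\<in>F. (cmod (coord (D t a) n))\<^sup>2) \<le> (Suc m * norm a ^ k)\<^sup>2})"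
      by (auto simp: E_def norm_le_iff_partial_sums_le)
    also have "closed \<dots>"
      by (intro closed_Int closed_INT closed_atLeastAtMost ballI continuous_on_closed_Collect_le continuous_intros cont)
        (auto simp: A_def)
    finally show ?thesis .
  qed
  moreover have "{0..T} \<subseteq> (\<Union>m. E m)"
  proof
    fix t assume t: "t \<in> {0..T}"
    then obtain C d where "C > 0" "d > 0" and Cd: "\<And>a. norm (a::ell2) < d \<Longrightarrow> norm (D t a) \<le> C * norm a ^ k"
      using bound by blast
    obtain m where m: "real m \<ge> max C (1 / d)" using real_arch_simple by blast
    have "norm (D t a) \<le> Suc m * norm a ^ k" if a: "a \<in> A m" for a
    proof -
      have "1 / Suc m \<le> d" using m \<open>d > 0\<close> by (simp add: field_simps)
      then have "norm (D t a) \<le> C * norm a ^ k" using a Cd by (auto simp: A_def)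
      also have "\<dots> \<le> Suc m * norm a ^ k" using m by (intro mult_right_mono) auto
      finally show ?thesis .
    qed
    then show "t \<in> (\<Union>m. E m)" using t by (auto simp: E_def)
  qed
  ultimately obtain m t0 \<eta> where *: "0 \<le> t0" "0 < \<eta>" "t0 + \<eta> \<le> T" "{t0..t0+\<eta>} \<subseteq> E m"
    using closed_cover_interval[OF \<open>T > 0\<close>] by metis
  show ?thesis
  proof (rule exI[of _ t0], rule exI[of _ \<eta>], rule exI[of _ "real (Suc m)"], rule exI[of _ "min r (1 / Suc m)"], intro conjI ballI allI impI)
    show "norm (D t a) \<le> real (Suc m) * norm a ^ k"
      if "t \<in> {t0..t0+\<eta>}" "norm a < min r (1 / Suc m)" for t and a :: ell2
      using that *(4) by (auto simp: E_def A_def)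
  qed (use *(1-3) \<open>r > 0\<close> in simp_all)
qed

section \<open>The nonlinearity as a bounded multilinear map\<close>

definition weight :: "real \<Rightarrow> int \<Rightarrow> real" where
  "weight s n = (1 + (of_int n)\<^sup>2) powr (- s / 2)"

lemma fourier_weight: "fourier s a n = of_real (weight s n) * coord a n"
  by (simp add: fourier_def weight_def)

lemma weight_gt_0 [simp]: "weight s n > 0"
  using weight_pos[of n] by (simp add: weight_def)

lemma weight_ne_0 [simp]: "weight s n \<noteq> 0"
  using weight_gt_0[of s n] by linarith

lemma weight_ge_0 [simp]: "weight s n \<ge> 0"
  using weight_gt_0[of s n] by linarith

lemma weight_le_1: "0 \<le> s \<Longrightarrow> weight s n \<le> 1"
  using powr_mono[of "-s/2" 0 "1 + (of_int n)\<^sup>2"] weight_pos[of n] by (simp add: weight_def)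

definition bracket :: "int \<Rightarrow> real" where
  "bracket n = sqrt (1 + (of_int n)\<^sup>2)"

lemma bracket_ge: "1 \<le> bracket n" "\<bar>of_int n\<bar> \<le> bracket n" "bracket n \<le> 1 + \<bar>of_int n\<bar>"
proof -
  show "1 \<le> bracket n" "\<bar>of_int n\<bar> \<le> bracket n" by (auto simp: bracket_def real_le_rsqrt)
  show "bracket n \<le> 1 + \<bar>of_int n\<bar>"
    unfolding bracket_def by (rule real_le_lsqrt) (auto simp: power2_eq_square algebra_simps abs_if)
qed

lemma weight_le_bracket:
  assumes "3 / 2 \<le> s"
  shows "weight s n \<le> 1 / (bracket n * sqrt (bracket n))"
proof -
  have 1: "(1::real) \<le> 1 + (of_int n)\<^sup>2" by simp
  have "weight s n \<le> (1 + (of_int n)\<^sup>2) powr (- (3/4))"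
    unfolding weight_def by (rule powr_mono) (use assms in auto)
  also have "\<dots> = 1 / (bracket n * sqrt (bracket n))"
  proof -
    define y where "y = 1 + (of_int n :: real)\<^sup>2"
    have y: "y > 0" using weight_pos[of n] by (simp add: y_def)
    have "bracket n * sqrt (bracket n) = y powr (1/2) * (y powr (1/2)) powr (1/2)"
      using y by (simp add: bracket_def powr_half_sqrt y_def[symmetric])
    also have "\<dots> = y powr (3/4)"
      unfolding powr_powr powr_add[symmetric] by simp
    finally show ?thesis by (simp add: y_def powr_minus_divide)
  qed
  finally show ?thesis .
qed

lemma weight_le_inverse_bracket:
  assumes "3 / 2 \<le> s"
  shows "weight s n \<le> 1 / bracket n"
proof -
  have "1 / (bracket n * sqrt (bracket n)) \<le> 1 / (bracket n * 1)"
    using bracket_ge(1)[of n] by (intro divide_left_mono mult_left_mono) auto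
  then show ?thesis using weight_le_bracket[OF assms, of n] by simp
qed

text \<open>
  Already for \<open>s = 3/2\<close> the weight \<open>\<langle>k\<rangle>\<^bsup>-3/2\<^esup>\<close> leaves only half a derivative on the frequency \<open>k\<close>.
  Since \<open>k = n - p - q\<close>, the factor \<open>\<langle>k\<rangle>\<^bsup>1/2\<^esup>\<close> is at most a multiple of \<open>\<langle>p\<rangle>\<^bsup>1/2\<^esup> \<langle>q\<rangle>\<^bsup>1/2\<^esup>\<close>, which the other
  two weights can pay for; what remains, \<open>1/(\<langle>p\<rangle> \<langle>q\<rangle>)\<close>, is square summable in both variables.
\<close>
lemma two_derivatives_absorbed:
  assumes s: "3 / 2 \<le> s" and n: "p + q + k = n"
  shows "(of_int k)\<^sup>2 * (weight s p * weight s q * weight s k)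
     \<le> sqrt (\<bar>of_int n\<bar> + 3) / (bracket p * bracket q)"
proof -
  let ?D = "\<bar>of_int n\<bar> + 3 :: real"
  note b = bracket_ge(1)[of p] bracket_ge(1)[of q] bracket_ge(1)[of k]
  have pq: "1 \<le> bracket p * bracket q" "bracket p \<le> bracket p * bracket q" "bracket q \<le> bracket p * bracket q"
    using b mult_mono[of 1 "bracket p" 1 "bracket q"] by auto
  have k: "of_int k = (of_int n - of_int p - of_int q :: real)" using n by (metis add_diff_cancel_left' diff_diff_eq of_int_diff)
  have "bracket k \<le> 1 + \<bar>of_int n\<bar> + bracket p + bracket q"
    using bracket_ge(3)[of k] bracket_ge(2)[of p] bracket_ge(2)[of q] k by linarith
  also have "\<dots> \<le> (1 + \<bar>of_int n\<bar>) * (bracket p * bracket q) + bracket p * bracket q + bracket p * bracket q"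
    using mult_left_mono[OF pq(1), of "1 + \<bar>of_int n\<bar>"] by (intro add_mono pq(2,3)) simp
  also have "\<dots> = ?D * (bracket p * bracket q)" by (simp add: algebra_simps)
  finally have "sqrt (bracket k) \<le> sqrt ?D * (sqrt (bracket p) * sqrt (bracket q))"
    by (metis real_sqrt_le_mono real_sqrt_mult)
  moreover have "(of_int k)\<^sup>2 \<le> (bracket k)\<^sup>2"
    by (simp add: bracket_def)
  ultimately have "(of_int k)\<^sup>2 * (weight s p * weight s q * weight s k)
      \<le> (bracket k)\<^sup>2 * (1 / (bracket p * sqrt (bracket p)) * (1 / (bracket q * sqrt (bracket q))) * (1 / (bracket k * sqrt (bracket k))))"
    using b by (intro mult_mono weight_le_bracket[OF s]) (auto intro!: mult_nonneg_nonneg less_imp_le[OF weight_gt_0])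
  also have "\<dots> = sqrt (bracket k) / (sqrt (bracket p) * sqrt (bracket q)) / (bracket p * bracket q)"
  proof -
    have "bracket k = sqrt (bracket k) * sqrt (bracket k)" using b by simp
    then have "(bracket k)\<^sup>2 / (bracket k * sqrt (bracket k)) = sqrt (bracket k)"
      using b by (simp add: power2_eq_square divide_simps)
    moreover have "(bracket k)\<^sup>2 * (1 / (bracket p * sqrt (bracket p)) * (1 / (bracket q * sqrt (bracket q))) * (1 / (bracket k * sqrt (bracket k))))
      = ((bracket k)\<^sup>2 / (bracket k * sqrt (bracket k))) / (sqrt (bracket p) * sqrt (bracket q)) / (bracket p * bracket q)"
      by simp
    ultimately show ?thesis by simp
  qed
  also have "\<dots> \<le> sqrt ?D / (bracket p * bracket q)"
  proof (rule divide_right_mono)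
    show "sqrt (bracket k) / (sqrt (bracket p) * sqrt (bracket q)) \<le> sqrt ?D"
      using \<open>sqrt (bracket k) \<le> _\<close> b by (subst pos_divide_le_eq) auto
  qed (use b in auto)
  finally show ?thesis .
qed

lemma inverse_square_partial_sums_bounded: "\<exists>K>0. \<forall>F :: int set. finite F \<longrightarrow> (\<Sum>k\<in>F. 1 / (bracket k)\<^sup>2) \<le> K"
proof -
  define f where "f k = 1 / (bracket k)\<^sup>2" for k
  have f_eq: "f k = 1 / (1 + (of_int k)\<^sup>2)" for k
    using weight_pos[of k] by (simp add: f_def bracket_def)
  have sm: "summable (\<lambda>n. f (int n))"
  proof (rule summable_comparison_test')
    show "summable (\<lambda>n. inverse ((real n)\<^sup>2))" using inverse_power_summable[of 2] by simp
    show "norm (f (int n)) \<le> inverse ((real n)\<^sup>2)" if "n \<ge> 1" for n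
      using that by (simp add: f_eq divide_simps not_less)
  qed
  define K where "K = (\<Sum>n. f (int n)) + (\<Sum>n. f (int n)) + 1"
  have nn: "f k \<ge> 0" for k by (simp add: f_def)
  have "sum f F \<le> K" if F: "finite F" for F
  proof -
    have "sum f F \<le> sum f (int ` nat ` {k\<in>F. k \<ge> 0}) + sum f ((\<lambda>n. - int n) ` (\<lambda>k. nat (-k)) ` {k\<in>F. k < 0})"
      (is "_ \<le> sum f ?A + sum f ?B")
    proof -
      have "F \<subseteq> ?A \<union> ?B" by (auto simp: image_iff)
      then have "sum f F \<le> sum f (?A \<union> ?B)" using F nn by (intro sum_mono2) auto
      also have "\<dots> \<le> sum f ?A + sum f ?B"
        using F nn by (subst sum_Un) (auto intro: sum_nonneg)
      finally show ?thesis .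
    qed
    also have "sum f ?A = (\<Sum>n\<in>nat ` {k\<in>F. k \<ge> 0}. f (int n))"
      by (subst sum.reindex) (auto simp: inj_on_def)
    also have "sum f ?B = (\<Sum>n\<in>(\<lambda>k. nat (-k)) ` {k\<in>F. k < 0}. f (int n))"
      by (subst sum.reindex) (auto simp: inj_on_def f_eq)
    also have "(\<Sum>n\<in>nat ` {k\<in>F. k \<ge> 0}. f (int n)) \<le> (\<Sum>n. f (int n))"
      using F nn by (intro sum_le_suminf[OF sm]) auto
    also have "(\<Sum>n\<in>(\<lambda>k. nat (-k)) ` {k\<in>F. k < 0}. f (int n)) \<le> (\<Sum>n. f (int n))"
      using F nn by (intro sum_le_suminf[OF sm]) auto
    finally show ?thesis by (simp add: K_def)
  qed
  moreover have "K > 0" using suminf_nonneg[OF sm] nn by (simp add: K_def add_nonneg_pos)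
  ultimately show ?thesis unfolding f_def by blast
qed

lemma weighted_sum_bounded: "\<exists>K>0. \<forall>a F. finite F \<longrightarrow> (\<Sum>k\<in>F. cmod (coord a k) / bracket k) \<le> K * norm a"
proof -
  obtain K where K: "K > 0" "\<And>F :: int set. finite F \<Longrightarrow> (\<Sum>k\<in>F. 1 / (bracket k)\<^sup>2) \<le> K"
    using inverse_square_partial_sums_bounded by blast
  have "(\<Sum>k\<in>F. cmod (coord a k) / bracket k) \<le> sqrt K * norm a" if F: "finite F" for a F
  proof -
    have "(\<Sum>k\<in>F. cmod (coord a k) * (1 / bracket k))\<^sup>2 \<le> (\<Sum>k\<in>F. (cmod (coord a k))\<^sup>2) * (\<Sum>k\<in>F. (1 / bracket k)\<^sup>2)"
      by (rule Cauchy_Schwarz_ineq_sum)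
    also have "\<dots> \<le> (norm a)\<^sup>2 * K"
      using K(2)[OF F] sum_coord_le_norm[OF F, of a] by (intro mult_mono) (auto simp: power_divide intro: sum_nonneg)
    finally have "(\<Sum>k\<in>F. cmod (coord a k) / bracket k)\<^sup>2 \<le> (sqrt K * norm a)\<^sup>2"
      using K(1) by (simp add: power_mult_distrib mult.commute)
    then show ?thesis by (rule power2_le_imp_le) (use K(1) in simp)
  qed
  then show ?thesis using K(1) by (intro exI[of _ "sqrt K"]) auto
qed

definition cubic_term :: "real \<Rightarrow> (int \<times> int \<times> int \<Rightarrow> complex) \<Rightarrow> ell2 \<Rightarrow> ell2 \<Rightarrow> ell2 \<Rightarrow> int \<times> int \<times> int \<Rightarrow> complex" where
  "cubic_term s m a b c = (\<lambda>(p, q, k). m (p, q, k) * fourier s a p * fourier s b q * fourier s c k)"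

lemma sum_pairs_le_product:
  fixes f g :: "int \<Rightarrow> real"
  assumes F: "finite F" and inj: "inj_on (\<lambda>x. (\<pi> x, \<rho> x)) F" and f: "\<And>k. f k \<ge> 0" and g: "\<And>k. g k \<ge> 0"
    and A: "\<And>F. finite F \<Longrightarrow> sum f F \<le> A" and B: "\<And>F. finite F \<Longrightarrow> sum g F \<le> B"
  shows "(\<Sum>x\<in>F. f (\<pi> x) * g (\<rho> x)) \<le> A * B"
proof -
  have "(\<Sum>x\<in>F. f (\<pi> x) * g (\<rho> x)) = (\<Sum>(i,j)\<in>(\<lambda>x. (\<pi> x, \<rho> x)) ` F. f i * g j)"
    by (subst sum.reindex[OF inj]) simp
  also have "\<dots> \<le> (\<Sum>(i,j)\<in>\<pi> ` F \<times> \<rho> ` F. f i * g j)"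
    using F f g by (intro sum_mono2) auto
  also have "\<dots> = sum f (\<pi> ` F) * sum g (\<rho> ` F)"
    by (simp add: sum_product sum.cartesian_product)
  also have "\<dots> \<le> A * B"
    using F f g A[of "{}"] by (intro mult_mono A B) (auto intro: sum_nonneg)
  finally show ?thesis .
qed

lemma abs_summable_and_bounded:
  fixes f :: "'i \<Rightarrow> complex"
  assumes "\<And>F. finite F \<Longrightarrow> F \<subseteq> I \<Longrightarrow> (\<Sum>x\<in>F. cmod (f x)) \<le> B"
  shows "f summable_on I" "cmod (infsum f I) \<le> B"
proof -
  have "(\<lambda>x. norm (f x)) summable_on I"
    by (rule nonneg_bounded_partial_sums_imp_summable_on[where C = B])
      (use assms in \<open>auto intro!: eventually_finite_subsets_at_top_weakI\<close>)
  then show "f summable_on I" by (rule abs_summable_summable)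
  have "cmod (infsum f I) \<le> infsum (\<lambda>x. cmod (f x)) I"
    using \<open>(\<lambda>x. norm (f x)) summable_on I\<close> by (rule norm_infsum_bound)
  also have "\<dots> \<le> B" by (rule infsum_le_finite_sums) (use assms \<open>(\<lambda>x. norm (f x)) summable_on I\<close> in auto)
  finally show "cmod (infsum f I) \<le> B" .
qed

lemma norm_fourier_eq: "cmod (fourier s a n) = weight s n * cmod (coord a n)"
  by (simp add: fourier_weight norm_mult less_imp_le)

text \<open>
  Cauchy and Schwarz in the two frequencies that carry the weights; the third factor is bounded by
  its supremum, and its frequency is determined by the other two.  The estimate is not uniform in \<open>n\<close>.
\<close>
lemma cubic_bounded:
  assumes s: "3 / 2 \<le> s"
  shows "\<exists>C>0. \<forall>a b c m. (\<forall>p q k. cmod (m (p, q, k)) \<le> 2 * ((of_int q)\<^sup>2 + (of_int k)\<^sup>2)) \<longrightarrow>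
     cubic_term s m a b c summable_on N3 n \<and>
     cmod (infsum (cubic_term s m a b c) (N3 n)) \<le> C * (norm a * norm b * norm c)"
proof -
  obtain K where K: "K > 0" "\<And>a F. finite F \<Longrightarrow> (\<Sum>k\<in>F. cmod (coord a k) / bracket k) \<le> K * norm a"
    using weighted_sum_bounded by blast
  define D where "D = sqrt (\<bar>of_int n\<bar> + 3)"
  define C where "C = 4 * D * K\<^sup>2"
  have "D > 0" by (simp add: D_def)
  have bp: "bracket k > 0" for k using bracket_ge(1)[of k] by simp
  have main: "(\<Sum>x\<in>F. cmod (cubic_term s m a b c x)) \<le> C * (norm a * norm b * norm c)"
    if m: "\<And>p q k. cmod (m (p, q, k)) \<le> 2 * ((of_int q)\<^sup>2 + (of_int k)\<^sup>2)" and F: "finite F" "F \<subseteq> N3 n" for a b c m F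
  proof -
    define A where "A u k = cmod (coord u k) / bracket k" for u k
    have A0: "A u k \<ge> 0" for u k using bp[of k] by (simp add: A_def)
    have term_bound: "cmod (cubic_term s m a b c (p, q, k)) \<le>
        2 * D * (norm b * (A a p * A c k)) + 2 * D * (norm c * (A a p * A b q))" if "(p, q, k) \<in> F" for p q k
    proof -
      have n: "p + q + k = n" and n': "p + k + q = n" using that F(2) by (auto simp: N3_def)
      let ?w = "weight s p * weight s q * weight s k" and ?X = "cmod (coord a p) * cmod (coord b q) * cmod (coord c k)"
      have w0: "?w \<ge> 0" by (auto intro!: mult_nonneg_nonneg less_imp_le[OF weight_gt_0])
      have "cmod (cubic_term s m a b c (p, q, k)) = cmod (m (p, q, k)) * (?w * ?X)"
        by (simp add: cubic_term_def norm_mult norm_fourier_eq mult_ac)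
      also have "\<dots> \<le> 2 * ((of_int q)\<^sup>2 + (of_int k)\<^sup>2) * (?w * ?X)"
        using w0 by (intro mult_right_mono m mult_nonneg_nonneg) auto
      also have "\<dots> = 2 * (((of_int q)\<^sup>2 * (weight s p * weight s k * weight s q)) * ?X) + 2 * (((of_int k)\<^sup>2 * ?w) * ?X)"
        by (simp add: algebra_simps)
      also have "\<dots> \<le> 2 * ((D / (bracket p * bracket k)) * ?X) + 2 * ((D / (bracket p * bracket q)) * ?X)"
        unfolding D_def by (intro add_mono mult_left_mono mult_right_mono two_derivatives_absorbed[OF s] n n') auto
      also have "\<dots> = 2 * D * (cmod (coord b q) * (A a p * A c k)) + 2 * D * (cmod (coord c k) * (A a p * A b q))"
        by (simp add: A_def mult_ac)
      also have "\<dots> \<le> 2 * D * (norm b * (A a p * A c k)) + 2 * D * (norm c * (A a p * A b q))"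
        using A0 \<open>D > 0\<close> by (intro add_mono mult_left_mono mult_right_mono cmod_coord_le mult_nonneg_nonneg) auto
      finally show ?thesis .
    qed
    have "(\<Sum>x\<in>F. cmod (cubic_term s m a b c x)) \<le>
        (\<Sum>x\<in>F. 2 * D * (norm b * (A a (fst x) * A c (snd (snd x)))) + 2 * D * (norm c * (A a (fst x) * A b (fst (snd x)))))"
      using term_bound by (intro sum_mono) auto
    also have "\<dots> = 2 * D * (norm b * (\<Sum>x\<in>F. A a (fst x) * A c (snd (snd x))))
        + 2 * D * (norm c * (\<Sum>x\<in>F. A a (fst x) * A b (fst (snd x))))"
      by (simp add: sum.distrib sum_distrib_left)
    also have "\<dots> \<le> 2 * D * (norm b * ((K * norm a) * (K * norm c))) + 2 * D * (norm c * ((K * norm a) * (K * norm b)))"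
    proof -
      have inj: "inj_on (\<lambda>x. (fst x, snd (snd x))) F" "inj_on (\<lambda>x. (fst x, fst (snd x))) F"
      proof -
        have "x \<in> F \<Longrightarrow> fst x + fst (snd x) + snd (snd x) = n" for x
          using F(2) by (auto simp: N3_def)
        then show "inj_on (\<lambda>x. (fst x, snd (snd x))) F" "inj_on (\<lambda>x. (fst x, fst (snd x))) F"
          by (auto simp: inj_on_def prod_eq_iff) (smt (verit))+
      qed
      have "(\<Sum>x\<in>F. A a (fst x) * A c (snd (snd x))) \<le> (K * norm a) * (K * norm c)"
        by (rule sum_pairs_le_product[OF F(1) inj(1)]) (use A0 K(2) in \<open>auto simp: A_def\<close>)
      moreover have "(\<Sum>x\<in>F. A a (fst x) * A b (fst (snd x))) \<le> (K * norm a) * (K * norm b)"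
        by (rule sum_pairs_le_product[OF F(1) inj(2)]) (use A0 K(2) in \<open>auto simp: A_def\<close>)
      ultimately show ?thesis using \<open>D > 0\<close> by (intro add_mono mult_left_mono) auto
    qed
    also have "\<dots> = C * (norm a * norm b * norm c)"
      by (simp add: C_def power2_eq_square)
    finally show ?thesis .
  qed
  have "C > 0" using \<open>D > 0\<close> K(1) by (simp add: C_def)
  moreover have "cubic_term s m a b c summable_on N3 n \<and>
     cmod (infsum (cubic_term s m a b c) (N3 n)) \<le> C * (norm a * norm b * norm c)"
    if "\<forall>p q k. cmod (m (p, q, k)) \<le> 2 * ((of_int q)\<^sup>2 + (of_int k)\<^sup>2)" for a b c m
  proof
    show "cubic_term s m a b c summable_on N3 n"
      by (rule abs_summable_and_bounded(1), rule main[rule_format]) (use that in auto)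
    show "cmod (infsum (cubic_term s m a b c) (N3 n)) \<le> C * (norm a * norm b * norm c)"
      by (rule abs_summable_and_bounded(2), rule main[rule_format]) (use that in auto)
  qed
  ultimately show ?thesis by blast
qed

definition quintic_term :: "real \<Rightarrow> ell2 \<Rightarrow> ell2 \<Rightarrow> ell2 \<Rightarrow> ell2 \<Rightarrow> ell2 \<Rightarrow> int \<times> int \<times> int \<times> int \<times> int \<Rightarrow> complex" where
  "quintic_term s a b c d e = (\<lambda>(n1, n2, n3, n4, n5).
     fourier s a n1 * fourier s b n2 * fourier s c n3 * fourier s d n4 * fourier s e n5)"

lemma sum_quadruples_le_product:
  fixes f1 f2 f3 f4 :: "int \<Rightarrow> real" and F :: "(int \<times> int \<times> int \<times> int \<times> int) set"
  assumes F: "finite F" "F \<subseteq> N5 n" and f: "\<And>k. f1 k \<ge> 0" "\<And>k. f2 k \<ge> 0" "\<And>k. f3 k \<ge> 0" "\<And>k. f4 k \<ge> 0"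
    and A: "\<And>F. finite F \<Longrightarrow> sum f1 F \<le> A1" "\<And>F. finite F \<Longrightarrow> sum f2 F \<le> A2"
      "\<And>F. finite F \<Longrightarrow> sum f3 F \<le> A3" "\<And>F. finite F \<Longrightarrow> sum f4 F \<le> A4"
  shows "(\<Sum>(n1,n2,n3,n4,n5)\<in>F. f1 n1 * f2 n2 * f3 n3 * f4 n4) \<le> A1 * A2 * A3 * A4"
proof -
  define P :: "int \<times> int \<times> int \<times> int \<times> int \<Rightarrow> int \<times> int \<times> int \<times> int"
    where "P x = (fst x, fst (snd x), fst (snd (snd x)), fst (snd (snd (snd x))))" for x
  have inj: "inj_on P F"
  proof (rule inj_onI)
    fix x y assume "x \<in> F" "y \<in> F" and eq: "P x = P y"
    then have "x \<in> N5 n" "y \<in> N5 n" using F(2) by blast+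
    then have "fst x + fst (snd x) + fst (snd (snd x)) + fst (snd (snd (snd x))) + snd (snd (snd (snd x))) = n"
      "fst y + fst (snd y) + fst (snd (snd y)) + fst (snd (snd (snd y))) + snd (snd (snd (snd y))) = n"
      unfolding N5_def case_prod_unfold mem_Collect_eq by blast+
    then have "snd (snd (snd (snd x))) = snd (snd (snd (snd y)))"
      using eq unfolding P_def prod_eq_iff fst_conv snd_conv by linarith
    then show "x = y" using eq unfolding P_def prod_eq_iff by simp
  qed
  define G1 where "G1 = (\<lambda>x. fst x) ` F"
  define G2 where "G2 = (\<lambda>x. fst (snd x)) ` F"
  define G3 where "G3 = (\<lambda>x. fst (snd (snd x))) ` F"
  define G4 where "G4 = (\<lambda>x. fst (snd (snd (snd x)))) ` F"
  have fin: "finite G1" "finite G2" "finite G3" "finite G4" using F(1) by (auto simp: G1_def G2_def G3_def G4_def)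
  have A0: "0 \<le> A1" "0 \<le> A2" "0 \<le> A3" "0 \<le> A4" using A[of "{}"] by auto
  have "(\<Sum>(n1,n2,n3,n4,n5)\<in>F. f1 n1 * f2 n2 * f3 n3 * f4 n4) = (\<Sum>(n1,n2,n3,n4)\<in>P ` F. f1 n1 * f2 n2 * f3 n3 * f4 n4)"
    by (subst sum.reindex[OF inj]) (simp add: P_def case_prod_unfold)
  also have "\<dots> \<le> (\<Sum>(n1,n2,n3,n4)\<in>G1 \<times> G2 \<times> G3 \<times> G4. f1 n1 * f2 n2 * f3 n3 * f4 n4)"
  proof (rule sum_mono2)
    show "P ` F \<subseteq> G1 \<times> G2 \<times> G3 \<times> G4"
      unfolding P_def G1_def G2_def G3_def G4_def
      by (rule image_subsetI, unfold mem_Times_iff fst_conv snd_conv) blast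
  qed (use fin f in auto)
  also have "\<dots> = (\<Sum>x\<in>G1 \<times> G2 \<times> G3 \<times> G4. f1 (fst x) * (f2 (fst (snd x)) * (f3 (fst (snd (snd x))) * f4 (snd (snd (snd x))))))"
    by (simp add: case_prod_unfold mult.assoc)
  also have "\<dots> = sum f1 G1 * (sum f2 G2 * (sum f3 G3 * sum f4 G4))"
    by (simp add: sum_product sum.cartesian_product case_prod_unfold)
  also have "\<dots> \<le> A1 * (A2 * (A3 * A4))"
    using A0 fin f by (intro mult_mono A mult_nonneg_nonneg sum_nonneg) auto
  finally show ?thesis by (simp add: mult.assoc)
qed

lemma quintic_bounded:
  assumes s: "3 / 2 \<le> s"
  shows "\<exists>C>0. \<forall>a b c d e. quintic_term s a b c d e summable_on N5 n \<and>
     cmod (infsum (quintic_term s a b c d e) (N5 n)) \<le> C * (norm a * norm b * norm c * norm d * norm e)"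
proof -
  obtain K where K: "K > 0" "\<And>a F. finite F \<Longrightarrow> (\<Sum>k\<in>F. cmod (coord a k) / bracket k) \<le> K * norm a"
    using weighted_sum_bounded by blast
  have bp: "bracket k > 0" for k using bracket_ge(1)[of k] by simp
  have main: "(\<Sum>x\<in>F. cmod (quintic_term s a b c d e x)) \<le> K^4 * (norm a * norm b * norm c * norm d * norm e)"
    if F: "finite F" "F \<subseteq> N5 n" for a b c d e F
  proof -
    define A where "A u k = cmod (coord u k) / bracket k" for u k
    have A0: "A u k \<ge> 0" for u k using bp[of k] by (simp add: A_def)
    have fA: "cmod (fourier s u k) \<le> A u k" for u k
      unfolding norm_fourier_eq A_def
      using mult_right_mono[OF weight_le_inverse_bracket[OF s, of k], of "cmod (coord u k)"] by simp
    have f1: "cmod (fourier s u k) \<le> norm u" for u k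
      unfolding norm_fourier_eq
      using mult_mono[OF weight_le_1[of s k] cmod_coord_le[of u k]] s by simp
    have "(\<Sum>x\<in>F. cmod (quintic_term s a b c d e x)) \<le>
       (\<Sum>(n1,n2,n3,n4,n5)\<in>F. A a n1 * A b n2 * A c n3 * A d n4 * norm e)"
      using A0 by (intro sum_mono) (auto simp: quintic_term_def norm_mult intro!: mult_mono fA f1 mult_nonneg_nonneg)
    also have "\<dots> = (\<Sum>(n1,n2,n3,n4,n5)\<in>F. A a n1 * A b n2 * A c n3 * A d n4) * norm e"
      by (simp add: sum_distrib_right case_prod_unfold)
    also have "\<dots> \<le> ((K * norm a) * (K * norm b) * (K * norm c) * (K * norm d)) * norm e"
      by (intro mult_right_mono sum_quadruples_le_product[OF F]) (use A0 K(2) in \<open>auto simp: A_def\<close>)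
    also have "\<dots> = K^4 * (norm a * norm b * norm c * norm d * norm e)"
      by (simp add: power_numeral_reduce)
    finally show ?thesis .
  qed
  show ?thesis
  proof (intro exI[of _ "K^4"] conjI allI)
    fix a b c d e
    show "quintic_term s a b c d e summable_on N5 n"
      by (rule abs_summable_and_bounded(1), rule main) auto
    show "cmod (infsum (quintic_term s a b c d e) (N5 n)) \<le> K^4 * (norm a * norm b * norm c * norm d * norm e)"
      by (rule abs_summable_and_bounded(2), rule main) auto
  qed (use K(1) in auto)
qed

text \<open>
  The two cubic sums of the equation have the same prefactor and are added up.
\<close>
definition cubic_multiplier :: "int \<times> int \<times> int \<Rightarrow> complex" where
  "cubic_multiplier = (\<lambda>(p, q, k). of_int (k\<^sup>2 + q * k))"

definition trilinear :: "real \<Rightarrow> int \<Rightarrow> ell2 \<Rightarrow> ell2 \<Rightarrow> ell2 \<Rightarrow> complex" where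
  "trilinear s n a b c = infsum (cubic_term s cubic_multiplier a b c) (N3 n)"

definition quintilinear :: "real \<Rightarrow> int \<Rightarrow> ell2 \<Rightarrow> ell2 \<Rightarrow> ell2 \<Rightarrow> ell2 \<Rightarrow> ell2 \<Rightarrow> complex" where
  "quintilinear s n a b c d e = infsum (quintic_term s a b c d e) (N5 n)"

lemma multiplier_bounds:
  "cmod (of_int (k\<^sup>2)) \<le> 2 * ((of_int q)\<^sup>2 + (of_int k)\<^sup>2)"
  "cmod (of_int (q * k)) \<le> 2 * ((of_int q)\<^sup>2 + (of_int k)\<^sup>2)"
  "cmod (of_int (k\<^sup>2 + q * k)) \<le> 2 * ((of_int q)\<^sup>2 + (of_int k)\<^sup>2)"
proof -
  have 1: "\<bar>x * y\<bar> \<le> 2 * (x\<^sup>2 + y\<^sup>2)" "\<bar>y\<^sup>2 + x * y\<bar> \<le> 2 * (x\<^sup>2 + y\<^sup>2)" for x y :: real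
  proof -
    have "0 \<le> (x - y)\<^sup>2" "0 \<le> (x + y)\<^sup>2" "0 \<le> x\<^sup>2" "0 \<le> y\<^sup>2" by simp_all
    then have *: "2 * (x * y) \<le> x\<^sup>2 + y\<^sup>2" "- (2 * (x * y)) \<le> x\<^sup>2 + y\<^sup>2" "0 \<le> x\<^sup>2" "0 \<le> y\<^sup>2"
      by (simp_all add: power2_sum power2_diff)
    have lin: "\<bar>z\<bar> \<le> 2 * (X + Y)" "\<bar>Y + z\<bar> \<le> 2 * (X + Y)"
      if "2 * z \<le> X + Y" "- (2 * z) \<le> X + Y" "0 \<le> X" "0 \<le> Y" for X Y z :: real
      using that by auto
    show "\<bar>x * y\<bar> \<le> 2 * (x\<^sup>2 + y\<^sup>2)" "\<bar>y\<^sup>2 + x * y\<bar> \<le> 2 * (x\<^sup>2 + y\<^sup>2)"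
      by (rule lin[OF *])+
  qed
  show "cmod (of_int (k\<^sup>2)) \<le> 2 * ((of_int q)\<^sup>2 + (of_int k)\<^sup>2)" by (simp add: norm_power)
  show "cmod (of_int (q * k)) \<le> 2 * ((of_int q)\<^sup>2 + (of_int k)\<^sup>2)"
    unfolding norm_of_int unfolding of_int_mult by (rule 1)
  show "cmod (of_int (k\<^sup>2 + q * k)) \<le> 2 * ((of_int q)\<^sup>2 + (of_int k)\<^sup>2)"
    unfolding norm_of_int unfolding of_int_mult of_int_add of_int_power by (rule 1)
qed

context
  fixes s :: real
  assumes s: "3 / 2 \<le> s"
begin

lemma cubic_multiplier_bound:
  "\<forall>p q k. cmod (cubic_multiplier (p, q, k)) \<le> 2 * ((of_int q)\<^sup>2 + (of_int k)\<^sup>2)"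
  unfolding cubic_multiplier_def prod.case using multiplier_bounds(3) by blast

lemma cubic_summable: "cubic_term s cubic_multiplier a b c summable_on N3 n"
  using cubic_bounded[OF s, of n] cubic_multiplier_bound by blast

lemma trilinear_bounded: "\<exists>C>0. \<forall>a b c. cmod (trilinear s n a b c) \<le> C * (norm a * norm b * norm c)"
  using cubic_bounded[OF s, of n] cubic_multiplier_bound unfolding trilinear_def by blast

lemma quintic_summable: "quintic_term s a b c d e summable_on N5 n"
  using quintic_bounded[OF s, of n] by blast

lemma quintilinear_bounded:
  "\<exists>C>0. \<forall>a b c d e. cmod (quintilinear s n a b c d e) \<le> C * (norm a * norm b * norm c * norm d * norm e)"
  using quintic_bounded[OF s, of n] unfolding quintilinear_def by blast

lemma fourier_add: "fourier s (a + b) n = fourier s a n + fourier s b n"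
  by (simp add: fourier_weight coord_rep distrib_left)

lemma trilinear_add:
  "trilinear s n (a + a') b c = trilinear s n a b c + trilinear s n a' b c"
  "trilinear s n a (b + b') c = trilinear s n a b c + trilinear s n a b' c"
  "trilinear s n a b (c + c') = trilinear s n a b c + trilinear s n a b c'"
proof -
  have "cubic_term s m (a + a') b c = (\<lambda>x. cubic_term s m a b c x + cubic_term s m a' b c x)"
    "cubic_term s m a (b + b') c = (\<lambda>x. cubic_term s m a b c x + cubic_term s m a b' c x)"
    "cubic_term s m a b (c + c') = (\<lambda>x. cubic_term s m a b c x + cubic_term s m a b c' x)" for m
    by (auto simp: cubic_term_def fourier_add algebra_simps fun_eq_iff)
  then show "trilinear s n (a + a') b c = trilinear s n a b c + trilinear s n a' b c"
    "trilinear s n a (b + b') c = trilinear s n a b c + trilinear s n a b' c"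
    "trilinear s n a b (c + c') = trilinear s n a b c + trilinear s n a b c'"
    by (simp_all add: trilinear_def infsum_add cubic_summable)
qed

lemma quintilinear_add:
  "quintilinear s n (a + a') b c d e = quintilinear s n a b c d e + quintilinear s n a' b c d e"
  "quintilinear s n a (b + b') c d e = quintilinear s n a b c d e + quintilinear s n a b' c d e"
  "quintilinear s n a b (c + c') d e = quintilinear s n a b c d e + quintilinear s n a b c' d e"
  "quintilinear s n a b c (d + d') e = quintilinear s n a b c d e + quintilinear s n a b c d' e"
  "quintilinear s n a b c d (e + e') = quintilinear s n a b c d e + quintilinear s n a b c d e'"
proof -
  have "quintic_term s (a + a') b c d e = (\<lambda>x. quintic_term s a b c d e x + quintic_term s a' b c d e x)"
    "quintic_term s a (b + b') c d e = (\<lambda>x. quintic_term s a b c d e x + quintic_term s a b' c d e x)"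
    "quintic_term s a b (c + c') d e = (\<lambda>x. quintic_term s a b c d e x + quintic_term s a b c' d e x)"
    "quintic_term s a b c (d + d') e = (\<lambda>x. quintic_term s a b c d e x + quintic_term s a b c d' e x)"
    "quintic_term s a b c d (e + e') = (\<lambda>x. quintic_term s a b c d e x + quintic_term s a b c d e' x)"
    by (auto simp: quintic_term_def fourier_add algebra_simps fun_eq_iff)
  then show "quintilinear s n (a + a') b c d e = quintilinear s n a b c d e + quintilinear s n a' b c d e"
    "quintilinear s n a (b + b') c d e = quintilinear s n a b c d e + quintilinear s n a b' c d e"
    "quintilinear s n a b (c + c') d e = quintilinear s n a b c d e + quintilinear s n a b c' d e"
    "quintilinear s n a b c (d + d') e = quintilinear s n a b c d e + quintilinear s n a b c d' e"
    "quintilinear s n a b c d (e + e') = quintilinear s n a b c d e + quintilinear s n a b c d e'"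
    by (simp_all add: quintilinear_def infsum_add quintic_summable)
qed

lemma nonlinearity_multilinear:
  "nonlinearity (fourier s a) n =
     - 20 * \<i> * of_int n ^ 3 * of_real ((cmod (fourier s a n))\<^sup>2) * fourier s a n
     + 10 * \<i> * of_int n * trilinear s n a a a + 6 * \<i> * of_int n * quintilinear s n a a a a a"
proof -
  have A: "cubicA (fourier s a) = cubic_term s (\<lambda>(p, q, k). of_int (k\<^sup>2)) a a a"
    and B: "cubicB (fourier s a) = cubic_term s (\<lambda>(p, q, k). of_int (q * k)) a a a"
    and Q: "quintic (fourier s a) = quintic_term s a a a a a"
    by (auto simp: cubicA_def cubicB_def quintic_def cubic_term_def quintic_term_def fun_eq_iff)
  have "cubicA (fourier s a) summable_on N3 n" "cubicB (fourier s a) summable_on N3 n"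
    unfolding A B
  proof -
    have C: "\<And>a b c m. \<forall>p q k. cmod (m (p, q, k)) \<le> 2 * ((of_int q)\<^sup>2 + (of_int k)\<^sup>2) \<Longrightarrow>
        cubic_term s m a b c summable_on N3 n"
      using cubic_bounded[OF s, of n] by blast
    show "cubic_term s (\<lambda>(p, q, k). of_int (k\<^sup>2)) a a a summable_on N3 n"
      "cubic_term s (\<lambda>(p, q, k). of_int (q * k)) a a a summable_on N3 n"
      by (rule C, unfold prod.case, use multiplier_bounds in blast)+
  qed
  then have sum: "infsum (cubicA (fourier s a)) (N3 n) + infsum (cubicB (fourier s a)) (N3 n) = trilinear s n a a a"
    unfolding trilinear_def
    by (subst infsum_add[symmetric]) (auto intro!: infsum_cong simp: A B cubic_term_def cubic_multiplier_def algebra_simps)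
  then show ?thesis
    by (simp add: nonlinearity_def Q quintilinear_def distrib_left flip: sum)
qed

lemma nonlinearity_cubic_bound:
  "\<exists>C>0. \<forall>a. norm a \<le> 1 \<longrightarrow> cmod (nonlinearity (fourier s a) n) \<le> C * norm a ^ 3"
proof -
  obtain C3 where C3: "C3 > 0" "\<And>a b c. cmod (trilinear s n a b c) \<le> C3 * (norm a * norm b * norm c)"
    using trilinear_bounded by blast
  obtain C5 where C5: "C5 > 0" "\<And>a b c d e. cmod (quintilinear s n a b c d e) \<le> C5 * (norm a * norm b * norm c * norm d * norm e)"
    using quintilinear_bounded by blast
  define C where "C = 20 * \<bar>of_int n\<bar>^3 + 10 * \<bar>of_int n\<bar> * C3 + 6 * \<bar>of_int n\<bar> * C5 + 1"
  have "cmod (nonlinearity (fourier s a) n) \<le> C * norm a ^ 3" if a: "norm a \<le> 1" for a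
  proof -
    have f1: "cmod (fourier s a n) \<le> norm a"
      unfolding norm_fourier_eq
      using mult_mono[OF weight_le_1[of s n] cmod_coord_le[of a n]] s by simp
    have "cmod (nonlinearity (fourier s a) n) \<le>
      20 * \<bar>of_int n\<bar>^3 * (cmod (fourier s a n))\<^sup>2 * cmod (fourier s a n)
      + 10 * \<bar>of_int n\<bar> * cmod (trilinear s n a a a) + 6 * \<bar>of_int n\<bar> * cmod (quintilinear s n a a a a a)"
      unfolding nonlinearity_multilinear
      by (intro norm_triangle_mono) (auto simp: norm_mult norm_power)
    also have "\<dots> \<le> 20 * \<bar>of_int n\<bar>^3 * (norm a)\<^sup>2 * norm a
      + 10 * \<bar>of_int n\<bar> * (C3 * (norm a * norm a * norm a)) + 6 * \<bar>of_int n\<bar> * (C5 * (norm a * norm a * norm a * 1 * 1))"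
    proof (intro add_mono mult_mono mult_left_mono power_mono f1 C3(2) order_trans[OF C5(2)])
    qed (use a C5(1) in auto)
    also have "\<dots> \<le> C * norm a ^ 3"
      by (simp add: C_def algebra_simps power_numeral_reduce)
    finally show ?thesis .
  qed
  moreover have "C > 0" using C3(1) C5(1) by (simp add: C_def add_nonneg_pos)
  ultimately show ?thesis by blast
qed

end

section \<open>Uniform comparison with the free evolution\<close>

lift_definition free :: "real \<Rightarrow> real \<Rightarrow> real \<Rightarrow> ell2 \<Rightarrow> ell2"
  is "\<lambda>d1 d2 t a n. cis (t * dispersion d1 d2 n) * a n"
  by (simp add: norm_mult)

lemma norm_free [simp]: "norm (free d1 d2 t a) = norm a"
  by (simp add: norm_ell2_def free.rep_eq norm_mult)

lemma free_diff: "free d1 d2 t (a - b) = free d1 d2 t a - free d1 d2 t b"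
  by (rule ell2_eqI) (simp add: free.rep_eq coord_rep right_diff_distrib)

lemma free_scaleR: "free d1 d2 t (x *\<^sub>R a) = x *\<^sub>R free d1 d2 t a"
  by (rule ell2_eqI) (simp add: free.rep_eq coord_rep)

lemma free_free: "free d1 d2 t (free d1 d2 t' a) = free d1 d2 (t + t') a"
  by (rule ell2_eqI) (simp add: free.rep_eq cis_mult mult.assoc[symmetric] distrib_right)

lemma bounded_linear_coord: "bounded_linear (\<lambda>a. coord a n)"
  by (rule bounded_linear_intro[where K = 1]) (auto simp: coord_rep cmod_coord_le)

lemma norm_interval_integral_le:
  fixes f :: "real \<Rightarrow> complex"
  assumes "0 \<le> t" "set_integrable lborel {0..t} f" "\<And>x. x \<in> {0..t} \<Longrightarrow> cmod (f x) \<le> K"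
  shows "cmod (LBINT x=0..t. f x) \<le> K * t"
proof -
  have I: "(LBINT x=0..t. f x) = integral {0..t} f" and fi: "f integrable_on {0..t}"
    using interval_integral_eq_integral[of 0 t f] set_borel_integral_eq_integral[OF assms(2)] assms(1,2)
    by (auto simp: zero_ereal_def)
  have "K \<ge> 0" using assms(3)[of 0] assms(1) by (auto intro: order_trans[OF norm_ge_zero])
  then show ?thesis
    unfolding I using has_integral_bound_real[OF \<open>K \<ge> 0\<close> finite.emptyI integrable_integral[OF fi]] assms(1,3)
    by fastforce
qed

locale smooth_flow = flow +
  assumes C5: "t \<in> {-T..T} \<Longrightarrow> C5_at (S t) 0"
begin

abbreviation "U \<equiv> free d1 d2"

lemma continuous_coord: "norm a < r \<Longrightarrow> continuous_on {-T..T} (\<lambda>t. coord (S t a) n)"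
  using sol[of a] bounded_linear.continuous_on[OF bounded_linear_coord] by (auto simp: solution_def)

lemma linear_bound_at_time:
  assumes "t \<in> {-T..T}"
  shows "\<exists>C>0. \<exists>d>0. \<forall>a. norm a < d \<longrightarrow> norm (S t a) \<le> C * norm a"
proof -
  obtain M d where "M > 0" "d > 0" and L: "\<And>a b. a \<in> ball 0 d \<Longrightarrow> b \<in> ball 0 d \<Longrightarrow> norm (S t a - S t b) \<le> M * norm (a - b)"
    using C5_at_lipschitz[OF C5[OF assms]] by blast
  have "norm (S t a) \<le> M * norm a" if "norm a < d" for a
    using L[of a 0] that \<open>d > 0\<close> zero_sol[OF assms] by simp
  then show ?thesis using \<open>M > 0\<close> \<open>d > 0\<close> by blast
qed

text \<open>
  Going back by \<open>p\<close> and forward again transports an estimate that is uniform on a time interval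
  \<open>[p, p + \<eta>]\<close> to the interval \<open>[0, \<eta>]\<close>, at the cost of the Lipschitz constant of \<open>S (-p)\<close>.
\<close>
lemma retrace:
  assumes p: "0 \<le> p" "p \<le> T"
  shows "\<exists>M>0. \<exists>d>0. \<forall>b. norm b < d \<longrightarrow> norm (S (-p) b) \<le> M * norm b \<and>
    (\<forall>\<sigma>. 0 \<le> \<sigma> \<longrightarrow> p + \<sigma> \<le> T \<longrightarrow> S (p + \<sigma>) (S (-p) b) = S \<sigma> b) \<and> S p (S (-p) b) = b"
proof -
  obtain M d where M: "M > 0" "d > 0" "\<And>a. norm a < d \<Longrightarrow> norm (S (-p) a) \<le> M * norm a"
    using linear_bound_at_time[of "-p"] p by auto
  have "norm (S (-p) b) \<le> M * norm b \<and>
    (\<forall>\<sigma>. 0 \<le> \<sigma> \<longrightarrow> p + \<sigma> \<le> T \<longrightarrow> S (p + \<sigma>) (S (-p) b) = S \<sigma> b) \<and> S p (S (-p) b) = b"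
    if b: "norm b < min (min d r) (r / M)" for b
  proof -
    have 1: "norm (S (-p) b) \<le> M * norm b" using M(3)[of b] b by simp
    also have "\<dots> < r" using b M(1) by (simp add: field_simps)
    finally have glue: "S t (S (-p) b) = S (t - p) b" if "t \<in> {0..T}" for t
      using backward_gluing[of b p t] b p that by simp
    then show ?thesis using 1 glue[of p] p at_time_zero[of b] b by (auto simp: glue)
  qed
  moreover have "min (min d r) (r / M) > 0" using M r by simp
  ultimately show ?thesis using M(1) by blast
qed

text \<open>
  Baire yields the bound on some interval of times, which \<open>retrace\<close> moves to the origin.
\<close>
lemma uniform_linear_bound:
  "\<exists>\<eta> C d. 0 < \<eta> \<and> \<eta> \<le> T \<and> 0 < C \<and> 0 < d \<and> (\<forall>t\<in>{0..\<eta>}. \<forall>b. norm b < d \<longrightarrow> norm (S t b) \<le> C * norm b)"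
proof -
  have "\<exists>t0 \<eta> C d. 0 \<le> t0 \<and> 0 < \<eta> \<and> t0 + \<eta> \<le> T \<and> 0 < C \<and> 0 < d \<and>
    (\<forall>t\<in>{t0..t0+\<eta>}. \<forall>a. norm a < d \<longrightarrow> norm (S t a) \<le> C * norm a ^ 1)"
    using linear_bound_at_time continuous_on_subset[OF continuous_coord]
    by (intro uniform_bound_on_subinterval[OF T r]) auto
  then obtain t0 \<eta> C d where *: "0 \<le> t0" "0 < \<eta>" "t0 + \<eta> \<le> T" "0 < C" "0 < d"
    and B: "\<And>t a. t \<in> {t0..t0+\<eta>} \<Longrightarrow> norm a < d \<Longrightarrow> norm (S t a) \<le> C * norm a"
    by auto
  obtain M e where M: "M > 0" "e > 0" and R: "\<And>b. norm b < e \<Longrightarrow> norm (S (-t0) b) \<le> M * norm b"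
     "\<And>b \<sigma>. norm b < e \<Longrightarrow> 0 \<le> \<sigma> \<Longrightarrow> t0 + \<sigma> \<le> T \<Longrightarrow> S (t0 + \<sigma>) (S (-t0) b) = S \<sigma> b"
    using retrace[of t0] * by auto
  have "norm (S t b) \<le> C * M * norm b" if t: "t \<in> {0..\<eta>}" and b: "norm b < min e (d / M)" for t b
  proof -
    have 1: "norm (S (-t0) b) \<le> M * norm b" using R(1) b by simp
    also have "\<dots> < d" using b M(1) by (simp add: field_simps)
    finally have "norm (S (t0 + t) (S (-t0) b)) \<le> C * norm (S (-t0) b)" using t by (intro B) auto
    also have "\<dots> \<le> C * (M * norm b)" using 1 \<open>0 < C\<close> by simp
    finally show ?thesis using R(2)[of b t] t b * by simp
  qed
  moreover have "min e (d / M) > 0" "C * M > 0" "\<eta> \<le> T" using * M by auto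
  ultimately show ?thesis using * by blast
qed

lemma coord_duhamel:
  assumes "norm a < r" "t \<in> {0..T}"
  shows "fourier s (S t a) n = cis (t * dispersion d1 d2 n) * (fourier s a n +
      (LBINT \<tau>=0..t. duhamel_integrand d1 d2 s (\<lambda>t. S t a) n \<tau>))"
    and "set_integrable lborel {0..t} (duhamel_integrand d1 d2 s (\<lambda>t. S t a) n)"
proof -
  show "fourier s (S t a) n = cis (t * dispersion d1 d2 n) * (fourier s a n +
      (LBINT \<tau>=0..t. duhamel_integrand d1 d2 s (\<lambda>t. S t a) n \<tau>))"
    using sol[OF assms(1)] assms(2) T unfolding solution_iff by simp
  show "set_integrable lborel {0..t} (duhamel_integrand d1 d2 s (\<lambda>t. S t a) n)"
    by (rule set_integrable_subset[OF solution_set_integrable[OF sol[OF assms(1)]]]) (use assms(2) T in auto)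
qed

lemma cmod_duhamel_integrand:
  "cmod (duhamel_integrand d1 d2 s u n \<tau>) = cmod (nonlinearity (fourier s (u \<tau>)) n)"
  by (simp add: duhamel_integrand_def norm_mult)

lemma coordinate_close_to_free:
  assumes s: "3 / 2 \<le> s" and \<eta>: "0 < \<eta>" "\<eta> \<le> T" and C: "0 < C" "0 < d"
    and lin: "\<And>t b. t \<in> {0..\<eta>} \<Longrightarrow> norm b < d \<Longrightarrow> norm (S t b) \<le> C * norm b"
  shows "\<exists>B>0. \<forall>t\<in>{0..\<eta>}. \<forall>b. norm b < min (min d r) (1 / C) \<longrightarrow>
     cmod (coord (S t b - U t b) n) \<le> B * norm b ^ 3"
proof -
  obtain K where K: "K > 0" "\<And>a. norm a \<le> 1 \<Longrightarrow> cmod (nonlinearity (fourier s a) n) \<le> K * norm a ^ 3"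
    using nonlinearity_cubic_bound[OF s, of n] by blast
  define B where "B = K * C^3 * \<eta> / weight s n"
  have "cmod (coord (S t b - U t b) n) \<le> B * norm b ^ 3"
    if t: "t \<in> {0..\<eta>}" and b: "norm b < min (min d r) (1 / C)" for t b
  proof -
    let ?I = "LBINT \<tau>=0..t. duhamel_integrand d1 d2 s (\<lambda>t. S t b) n \<tau>"
    have tT: "t \<in> {0..T}" and br: "norm b < r" using t \<eta> b by auto
    note D = coord_duhamel[OF br tT, of n]
    have "weight s n * coord (S t b - U t b) n = cis (t * dispersion d1 d2 n) * ?I"
      using D(1) by (simp add: fourier_weight coord_rep free.rep_eq algebra_simps)
    then have "weight s n * cmod (coord (S t b - U t b) n) = cmod ?I"
      by (metis norm_mult norm_cis mult_1 norm_of_real abs_of_pos weight_gt_0)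
    also have "\<dots> \<le> (K * (C * norm b)^3) * t"
    proof (rule norm_interval_integral_le[OF _ D(2)])
      fix \<tau> assume \<tau>: "\<tau> \<in> {0..t}"
      have 1: "norm (S \<tau> b) \<le> C * norm b" using \<tau> t b by (intro lin) auto
      also have "\<dots> \<le> 1" using b C by (simp add: field_simps)
      finally have "cmod (nonlinearity (fourier s (S \<tau> b)) n) \<le> K * norm (S \<tau> b) ^ 3" by (rule K(2))
      also have "\<dots> \<le> K * (C * norm b)^3" using 1 K(1) by (intro mult_left_mono power_mono) auto
      finally show "cmod (duhamel_integrand d1 d2 s (\<lambda>t. S t b) n \<tau>) \<le> K * (C * norm b)^3"
        by (simp add: cmod_duhamel_integrand)
    qed (use t in auto)
    also have "\<dots> \<le> (K * (C * norm b)^3) * \<eta>" using t K(1) C by (intro mult_left_mono) auto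
    also have "\<dots> = weight s n * (B * norm b ^ 3)" by (simp add: B_def power_mult_distrib less_imp_neq[OF weight_gt_0, symmetric])
    finally show ?thesis using weight_gt_0[of s n] by (simp only: mult_le_cancel_left_pos)
  qed
  moreover have "B > 0" using K(1) C \<eta> by (simp add: B_def)
  ultimately show ?thesis by blast
qed

text \<open>
  Each coordinate of \<open>S t b - U t b\<close> is cubic in \<open>b\<close>, but with a constant that may grow with
  the frequency.  Hence the 2-jet of \<open>S t\<close> at the origin is that of the free evolution, and the
  remainder in Taylor's formula for \<open>S t\<close> supplies one constant for all coordinates at once.
\<close>
lemma cubic_bound_at_time:
  assumes t: "t \<in> {-T..T}"
    and coordinates: "\<And>n. \<exists>B d. 0 < d \<and> (\<forall>b. norm b < d \<longrightarrow> cmod (coord (S t b - U t b) n) \<le> B * norm b ^ 3)"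
  shows "\<exists>C>0. \<exists>d>0. \<forall>b. norm b < d \<longrightarrow> norm (S t b - U t b) \<le> C * norm b ^ 3"
proof -
  obtain M d where "M > 0" "d > 0" and jets: "\<And>a w. norm a \<le> 1 \<Longrightarrow> norm w \<le> 1 \<Longrightarrow>
    \<exists>c. \<forall>x. 0 < x \<longrightarrow> x < d \<longrightarrow> \<bar>inner w (S t (x *\<^sub>R a)) - (\<Sum>k<3. c k * x ^ k)\<bar> \<le> M * x ^ 3"
    using C5_at_jets[OF C5[OF t], of 1] by force
  have "norm (S t b - U t b) \<le> M * norm b ^ 3" if b: "norm b < d" for b
  proof (cases "b = 0")
    case True
    then show ?thesis using zero_sol[OF t] norm_free[of d1 d2 t 0] by simp
  next
    case False
    define a where "a = (1 / norm b) *\<^sub>R b"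
    have na: "norm a = 1" and ba: "b = norm b *\<^sub>R a" using False by (auto simp: a_def)
    show ?thesis
    proof (rule norm_le_by_finite_duality)
      fix F :: "int set" and z assume F: "finite F" and w1: "norm (\<Sum>n\<in>F. single n (z n)) \<le> 1"
      define w where "w = (\<Sum>n\<in>F. single n (z n))"
      obtain c where c: "\<And>x. 0 < x \<Longrightarrow> x < d \<Longrightarrow> \<bar>inner w (S t (x *\<^sub>R a)) - (\<Sum>k<3. c k * x ^ k)\<bar> \<le> M * x ^ 3"
        using jets[of a w] na w1 by (auto simp: w_def)
      define c' where "c' k = (if k = 1 then inner w (U t a) else 0)" for k :: nat
      have c'_sum: "(\<Sum>k<3. c' k * x ^ k) = inner w (U t (x *\<^sub>R a))" for x :: real
        by (simp add: c'_def numeral_3_eq_3 free_scaleR)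
      obtain B e where e: "\<And>n. 0 < e n" and Be: "\<And>n b. norm b < e n \<Longrightarrow> cmod (coord (S t b - U t b) n) \<le> B n * norm b ^ 3"
        using coordinates by metis
      \<comment> \<open>The coordinate estimates have different ranges; only finitely many are used at once.\<close>
      define e' where "e' = Min (insert 1 (e ` F))"
      have "e' > 0" using e F by (simp add: e'_def)
      have close: "\<bar>inner w (S t (x *\<^sub>R a)) - (\<Sum>k<3. c' k * x ^ k) - 0 * x ^ 3\<bar> \<le> (\<Sum>n\<in>F. cmod (z n) * B n) * x ^ 3"
        if x: "0 < x" "x < e'" for x
      proof -
        have "\<bar>inner w (S t (x *\<^sub>R a) - U t (x *\<^sub>R a))\<bar> = \<bar>\<Sum>n\<in>F. inner (z n) (coord (S t (x *\<^sub>R a) - U t (x *\<^sub>R a)) n)\<bar>"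
          by (simp add: w_def inner_sum_left inner_single)
        also have "\<dots> \<le> (\<Sum>n\<in>F. cmod (z n) * (B n * x ^ 3))"
        proof (rule order_trans[OF sum_abs sum_mono])
          fix n assume "n \<in> F"
          then have "x < e n" using x(2) F by (simp add: e'_def)
          then have "cmod (coord (S t (x *\<^sub>R a) - U t (x *\<^sub>R a)) n) \<le> B n * x ^ 3"
            using Be[of "x *\<^sub>R a" n] x na by simp
          then show "\<bar>inner (z n) (coord (S t (x *\<^sub>R a) - U t (x *\<^sub>R a)) n)\<bar> \<le> cmod (z n) * (B n * x ^ 3)"
            by (meson Cauchy_Schwarz_ineq2 order_trans mult_left_mono norm_ge_zero)
        qed
        finally show ?thesis by (simp add: c'_sum inner_diff_right sum_distrib_right mult.assoc)
      qed
      have "c k = c' k" if "k < 3" for k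
        using jet_unique(1)[OF \<open>d > 0\<close> c \<open>e' > 0\<close> close that] by simp
      then have "(\<Sum>k<3. c k * norm b ^ k) = inner w (U t b)"
        using c'_sum[of "norm b"] ba by (metis (no_types, lifting) lessThan_iff sum.cong)
      then have "\<bar>inner w (S t b) - inner w (U t b)\<bar> \<le> M * norm b ^ 3"
        using c[of "norm b"] b False ba by simp
      then show "inner (\<Sum>n\<in>F. single n (z n)) (S t b - U t b) \<le> M * norm b ^ 3"
        by (simp add: inner_diff_right w_def)
    qed (use \<open>M > 0\<close> in simp)
  qed
  then show ?thesis using \<open>M > 0\<close> \<open>d > 0\<close> by blast
qed

text \<open>
  A second application of Baire makes the constant independent of time.  With \<open>a = S (-t0) b\<close> the
  difference \<open>S t b - U t b\<close> is composed of the differences at the nonnegative times \<open>t0 + t\<close> and \<open>t0\<close>,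
  both evaluated at \<open>a\<close>.
\<close>
lemma uniform_cubic_bound:
  assumes s: "3 / 2 \<le> s"
  shows "\<exists>\<eta> C d. 0 < \<eta> \<and> \<eta> \<le> T \<and> 0 < C \<and> 0 < d \<and>
    (\<forall>t\<in>{0..\<eta>}. \<forall>b. norm b < d \<longrightarrow> norm (S t b - U t b) \<le> C * norm b ^ 3)"
proof -
  obtain \<eta>0 C0 e0 where L: "0 < \<eta>0" "\<eta>0 \<le> T" "0 < C0" "0 < e0"
    and lin: "\<And>t b. t \<in> {0..\<eta>0} \<Longrightarrow> norm b < e0 \<Longrightarrow> norm (S t b) \<le> C0 * norm b"
    using uniform_linear_bound by blast
  have "\<exists>t0 \<eta> C d. 0 \<le> t0 \<and> 0 < \<eta> \<and> t0 + \<eta> \<le> \<eta>0 \<and> 0 < C \<and> 0 < d \<and>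
    (\<forall>t\<in>{t0..t0+\<eta>}. \<forall>a. norm a < d \<longrightarrow> norm (S t a - U t a) \<le> C * norm a ^ 3)"
  proof (rule uniform_bound_on_subinterval[OF L(1) r])
    show "continuous_on {0..\<eta>0} (\<lambda>t. coord (S t a - U t a) n)" if "norm a < r" for a n
    proof -
      have "continuous_on {0..\<eta>0} (\<lambda>t. coord (S t a) n)"
        by (rule continuous_on_subset[OF continuous_coord[OF that]]) (use L in auto)
      moreover have "continuous_on {0..\<eta>0} (\<lambda>t. cis (t * dispersion d1 d2 n) * coord a n)"
        by (intro continuous_intros)
      ultimately show ?thesis
        unfolding coord_rep free.rep_eq by (rule continuous_on_diff)
    qed
    show "\<exists>C>0. \<exists>d>0. \<forall>a. norm a < d \<longrightarrow> norm (S t a - U t a) \<le> C * norm a ^ 3" if t: "t \<in> {0..\<eta>0}" for t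
    proof (rule cubic_bound_at_time)
      show "\<exists>B d. 0 < d \<and> (\<forall>b. norm b < d \<longrightarrow> cmod (coord (S t b - U t b) n) \<le> B * norm b ^ 3)" for n
      proof -
        obtain B where "\<And>b. norm b < min (min e0 r) (1 / C0) \<Longrightarrow> cmod (coord (S t b - U t b) n) \<le> B * norm b ^ 3"
          using coordinate_close_to_free[OF s L lin, of n] t by blast
        moreover have "0 < min (min e0 r) (1 / C0)" using r L by simp
        ultimately show ?thesis by blast
      qed
    qed (use t L in auto)
  qed
  then obtain t0 \<eta> C d where *: "0 \<le> t0" "0 < \<eta>" "t0 + \<eta> \<le> \<eta>0" "0 < C" "0 < d"
    and B: "\<And>t a. t \<in> {t0..t0+\<eta>} \<Longrightarrow> norm a < d \<Longrightarrow> norm (S t a - U t a) \<le> C * norm a ^ 3"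
    by blast
  obtain M e where M: "M > 0" "e > 0" and R: "\<And>b. norm b < e \<Longrightarrow> norm (S (-t0) b) \<le> M * norm b"
     "\<And>b \<sigma>. norm b < e \<Longrightarrow> 0 \<le> \<sigma> \<Longrightarrow> t0 + \<sigma> \<le> T \<Longrightarrow> S (t0 + \<sigma>) (S (-t0) b) = S \<sigma> b"
     "\<And>b. norm b < e \<Longrightarrow> S t0 (S (-t0) b) = b"
    using retrace[of t0] * L by auto
  have "norm (S t b - U t b) \<le> (2 * C * M^3) * norm b ^ 3" if t: "t \<in> {0..\<eta>}" and b: "norm b < min e (d / M)" for t b
  proof -
    define a where "a = S (-t0) b"
    have 1: "norm a \<le> M * norm b" using R(1) b by (simp add: a_def)
    also have "\<dots> < d" using b M(1) by (simp add: field_simps)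
    finally have ad: "norm a < d" .
    have "S t b = S (t0 + t) a" "b = S t0 a"
      using R(2)[of b t] R(3)[of b] t b * L by (auto simp: a_def)
    then have "S t b - U t b = (S (t0 + t) a - U (t0 + t) a) - U t (S t0 a - U t0 a)"
      by (simp add: free_diff free_free add.commute)
    also have "norm \<dots> \<le> C * norm a ^ 3 + C * norm a ^ 3"
    proof -
      have "norm (S (t0 + t) a - U (t0 + t) a) \<le> C * norm a ^ 3" "norm (S t0 a - U t0 a) \<le> C * norm a ^ 3"
        using ad t * by (auto intro!: B)
      then show ?thesis
        using norm_triangle_ineq4[of "S (t0 + t) a - U (t0 + t) a" "U t (S t0 a - U t0 a)"]
        unfolding norm_free by linarith
    qed
    also have "\<dots> \<le> C * (M * norm b) ^ 3 + C * (M * norm b) ^ 3"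
      using 1 * by (intro add_mono mult_left_mono power_mono) auto
    finally show ?thesis by (simp add: power_mult_distrib)
  qed
  moreover have "min e (d / M) > 0" "2 * C * M^3 > 0" "\<eta> \<le> T" using * M L by auto
  ultimately show ?thesis using * by blast
qed

end

section \<open>Order of vanishing, uniformly in time\<close>

text \<open>
  \<open>f x t = O(x\<^sup>k)\<close> for \<open>x\<close> tending to \<open>0\<close> from above, uniformly for \<open>t\<close> in \<open>[0, \<eta>]\<close>: the form in which error terms
  can be multiplied and integrated over time.
\<close>
definition small_order :: "real \<Rightarrow> nat \<Rightarrow> (real \<Rightarrow> real \<Rightarrow> 'b::real_normed_vector) \<Rightarrow> bool" where
  "small_order \<eta> k f \<longleftrightarrow> (\<exists>K \<delta>. 0 < \<delta> \<and> (\<forall>x t. 0 < x \<longrightarrow> x < \<delta> \<longrightarrow> t \<in> {0..\<eta>} \<longrightarrow> norm (f x t) \<le> K * x ^ k))"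

lemma small_orderI:
  "0 < \<delta> \<Longrightarrow> (\<And>x t. 0 < x \<Longrightarrow> x < \<delta> \<Longrightarrow> t \<in> {0..\<eta>} \<Longrightarrow> norm (f x t) \<le> K * x ^ k) \<Longrightarrow> small_order \<eta> k f"
  unfolding small_order_def by blast

lemma small_orderE:
  assumes "small_order \<eta> k f"
  obtains K \<delta> where "0 < K" "0 < \<delta>" "\<delta> \<le> 1"
    "\<And>x t. 0 < x \<Longrightarrow> x < \<delta> \<Longrightarrow> t \<in> {0..\<eta>} \<Longrightarrow> norm (f x t) \<le> K * x ^ k"
proof -
  obtain K \<delta> where *: "0 < \<delta>" "\<And>x t. 0 < x \<Longrightarrow> x < \<delta> \<Longrightarrow> t \<in> {0..\<eta>} \<Longrightarrow> norm (f x t) \<le> K * x ^ k"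
    using assms unfolding small_order_def by blast
  show thesis
  proof (rule that[of "max K 1" "min \<delta> 1"])
    fix x t :: real assume x: "0 < x" "x < min \<delta> 1" "t \<in> {0..\<eta>}"
    have "norm (f x t) \<le> K * x ^ k" using * x by simp
    also have "\<dots> \<le> max K 1 * x ^ k" using x by (intro mult_right_mono) auto
    finally show "norm (f x t) \<le> max K 1 * x ^ k" .
  qed (use * in auto)
qed

lemma small_order_add: "small_order \<eta> k f \<Longrightarrow> small_order \<eta> k g \<Longrightarrow> small_order \<eta> k (\<lambda>x t. f x t + g x t)"
proof -
  assume "small_order \<eta> k f" "small_order \<eta> k g"
  then obtain K1 d1 K2 d2 where "0 < d1" "0 < d2"
    and f: "\<And>x t. 0 < x \<Longrightarrow> x < d1 \<Longrightarrow> t \<in> {0..\<eta>} \<Longrightarrow> norm (f x t) \<le> K1 * x ^ k"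
    and g: "\<And>x t. 0 < x \<Longrightarrow> x < d2 \<Longrightarrow> t \<in> {0..\<eta>} \<Longrightarrow> norm (g x t) \<le> K2 * x ^ k"
    unfolding small_order_def by blast
  then show ?thesis
    by (intro small_orderI[of "min d1 d2" _ _ "K1 + K2"])
       (auto simp: distrib_right intro!: order_trans[OF norm_triangle_ineq] add_mono)
qed

lemma small_order_mono: "small_order \<eta> k f \<Longrightarrow> j \<le> k \<Longrightarrow> small_order \<eta> j f"
proof -
  assume f: "small_order \<eta> k f" and jk: "j \<le> k"
  obtain K \<delta> where *: "0 < K" "0 < \<delta>" "\<delta> \<le> 1"
    "\<And>x t. 0 < x \<Longrightarrow> x < \<delta> \<Longrightarrow> t \<in> {0..\<eta>} \<Longrightarrow> norm (f x t) \<le> K * x ^ k"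
    using f by (rule small_orderE) auto
  show ?thesis
  proof (rule small_orderI[OF *(2), where K = K])
    fix x t assume x: "0 < x" "x < \<delta>" "t \<in> {0..\<eta>}"
    have "x ^ k \<le> x ^ j" using x * jk by (intro power_decreasing) auto
    then have "K * x ^ k \<le> K * x ^ j" using * by simp
    then show "norm (f x t) \<le> K * x ^ j" using *(4)[OF x] by linarith
  qed
qed

lemma small_order_mult:
  fixes f g :: "real \<Rightarrow> real \<Rightarrow> 'b::real_normed_algebra"
  assumes "small_order \<eta> i f" "small_order \<eta> j g"
  shows "small_order \<eta> (i + j) (\<lambda>x t. f x t * g x t)"
proof -
  obtain K1 d1 where 1: "0 < K1" "0 < d1" "\<And>x t. 0 < x \<Longrightarrow> x < d1 \<Longrightarrow> t \<in> {0..\<eta>} \<Longrightarrow> norm (f x t) \<le> K1 * x ^ i"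
    using assms(1) by (rule small_orderE) auto
  obtain K2 d2 where 2: "0 < K2" "0 < d2" "\<And>x t. 0 < x \<Longrightarrow> x < d2 \<Longrightarrow> t \<in> {0..\<eta>} \<Longrightarrow> norm (g x t) \<le> K2 * x ^ j"
    using assms(2) by (rule small_orderE) auto
  show ?thesis
  proof (rule small_orderI[of "min d1 d2" _ _ "K1 * K2"])
    fix x t assume x: "0 < x" "x < min d1 d2" "t \<in> {0..\<eta>}"
    have "norm (f x t * g x t) \<le> (K1 * x ^ i) * (K2 * x ^ j)"
      using 1 2 x by (intro order_trans[OF norm_mult_ineq] mult_mono) auto
    then show "norm (f x t * g x t) \<le> K1 * K2 * x ^ (i + j)" by (simp add: power_add mult_ac)
  qed (use 1 2 in auto)
qed

lemma small_order_bounded: "(\<And>x t. t \<in> {0..\<eta>} \<Longrightarrow> norm (c x t) \<le> B) \<Longrightarrow> small_order \<eta> 0 c"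
  by (rule small_orderI[of 1 _ _ B]) auto

lemma small_order_bounded_mult:
  fixes f :: "real \<Rightarrow> real \<Rightarrow> 'b::real_normed_algebra"
  assumes "\<And>x t. t \<in> {0..\<eta>} \<Longrightarrow> norm (c x t) \<le> B" "small_order \<eta> k f"
  shows "small_order \<eta> k (\<lambda>x t. c x t * f x t)"
  using small_order_mult[OF small_order_bounded[of \<eta> c B] assms(2)] assms(1) by simp

lemma small_order_power: "small_order \<eta> k (\<lambda>x t. (complex_of_real x) ^ k)"
  by (rule small_orderI[of 1 _ _ 1]) (auto simp: norm_power)

lemma small_order_norm:
  fixes f :: "real \<Rightarrow> real \<Rightarrow> 'b::real_normed_vector" and g :: "real \<Rightarrow> real \<Rightarrow> 'c::real_normed_vector"
  shows "small_order \<eta> k f \<Longrightarrow> (\<And>x t. norm (g x t) \<le> norm (f x t)) \<Longrightarrow> small_order \<eta> k g"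
  unfolding small_order_def by (meson order_trans)

lemma small_order_trilinear:
  assumes s: "3 / 2 \<le> s" and "small_order \<eta> i f" "small_order \<eta> j g" "small_order \<eta> k h"
  shows "small_order \<eta> (i + j + k) (\<lambda>x t. trilinear s n (f x t) (g x t) (h x t))"
proof -
  obtain C where C: "C > 0" "\<And>a b c. cmod (trilinear s n a b c) \<le> C * (norm a * norm b * norm c)"
    using trilinear_bounded[OF s] by blast
  have nrm: "small_order \<eta> m (\<lambda>x t. norm (q x t))" if "small_order \<eta> m q" for m and q :: "real \<Rightarrow> real \<Rightarrow> ell2"
    using that by (simp add: small_order_def)
  have B: "small_order \<eta> (0 + (i + j + k)) (\<lambda>x t. C * (norm (f x t) * norm (g x t) * norm (h x t)))"
    by (intro small_order_mult nrm assms small_order_bounded[of _ _ C]) (use C in auto)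
  show ?thesis
    by (rule small_order_norm[OF B[unfolded add_0_left]]) (use C in \<open>simp add: abs_mult\<close>)
qed

lemma small_order_quintilinear:
  assumes s: "3 / 2 \<le> s" and "small_order \<eta> i1 f1" "small_order \<eta> i2 f2" "small_order \<eta> i3 f3" "small_order \<eta> i4 f4" "small_order \<eta> i5 f5"
  shows "small_order \<eta> (i1 + i2 + i3 + i4 + i5) (\<lambda>x t. quintilinear s n (f1 x t) (f2 x t) (f3 x t) (f4 x t) (f5 x t))"
proof -
  obtain C where C: "C > 0" "\<And>a b c d e. cmod (quintilinear s n a b c d e) \<le> C * (norm a * norm b * norm c * norm d * norm e)"
    using quintilinear_bounded[OF s] by blast
  have nrm: "small_order \<eta> m (\<lambda>x t. norm (q x t))" if "small_order \<eta> m q" for m and q :: "real \<Rightarrow> real \<Rightarrow> ell2"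
    using that by (simp add: small_order_def)
  have B: "small_order \<eta> (0 + (i1 + i2 + i3 + i4 + i5)) (\<lambda>x t. C * (norm (f1 x t) * norm (f2 x t) * norm (f3 x t) * norm (f4 x t) * norm (f5 x t)))"
    by (intro small_order_mult nrm assms small_order_bounded[of _ _ C]) (use C in auto)
  show ?thesis
    by (rule small_order_norm[OF B[unfolded add_0_left]]) (use C in \<open>simp add: abs_mult\<close>)
qed

lemma small_order_fourier:
  assumes "0 \<le> s" "small_order \<eta> k f"
  shows "small_order \<eta> k (\<lambda>x t. fourier s (f x t) n)"
proof (rule small_order_norm[OF assms(2)])
  show "norm (fourier s (f x t) n) \<le> norm (f x t)" for x t
    unfolding norm_fourier_eq
    using mult_mono[OF weight_le_1[OF assms(1), of n] cmod_coord_le[of "f x t" n]] by simp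
qed

lemma small_order_integral:
  fixes f :: "real \<Rightarrow> real \<Rightarrow> complex"
  assumes "0 < \<eta>" "small_order \<eta> k f" "0 < e" and int: "\<And>x. 0 < x \<Longrightarrow> x < e \<Longrightarrow> set_integrable lborel {0..\<eta>} (f x)"
  shows "small_order \<eta> k (\<lambda>x t. LBINT \<tau>=0..t. f x \<tau>)"
proof -
  obtain K \<delta> where *: "0 < K" "0 < \<delta>" "\<And>x t. 0 < x \<Longrightarrow> x < \<delta> \<Longrightarrow> t \<in> {0..\<eta>} \<Longrightarrow> norm (f x t) \<le> K * x ^ k"
    using assms(2) by (rule small_orderE) auto
  show ?thesis
  proof (rule small_orderI[of "min \<delta> e" _ _ "K * \<eta>"])
    fix x t assume x: "0 < x" "x < min \<delta> e" "t \<in> {0..\<eta>}"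
    have "cmod (LBINT \<tau>=0..t. f x \<tau>) \<le> (K * x ^ k) * t"
      by (rule norm_interval_integral_le) (use * x in \<open>auto intro!: set_integrable_subset[OF int[of x]]\<close>)
    also have "\<dots> \<le> (K * x ^ k) * \<eta>" using * x by (intro mult_left_mono) auto
    finally show "norm (LBINT \<tau>=0..t. f x \<tau>) \<le> K * \<eta> * x ^ k" by (simp add: mult_ac)
  qed (use * assms in auto)
qed

lemma has_vector_derivative_cis:
  "((\<lambda>x. cis (\<Psi> * x)) has_vector_derivative \<Psi> *\<^sub>R (\<i> * cis (\<Psi> * x))) (at x within A)"
  using exp_scaleR_has_vector_derivative_right[of "\<i> * \<Psi>" x A]
  by (simp add: cis_conv_exp scaleR_conv_of_real mult_ac)

lemma integral_cis:
  assumes "\<Psi> \<noteq> 0"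
  shows "(LBINT \<tau>=0..t. cis (\<Psi> * \<tau>)) = (cis (\<Psi> * t) - 1) / (\<i> * \<Psi>)"
proof -
  have "(LBINT \<tau>=ereal 0..ereal t. cis (\<Psi> * \<tau>)) = cis (\<Psi> * t) / (\<i> * \<Psi>) - cis (\<Psi> * 0) / (\<i> * \<Psi>)"
  proof (rule interval_integral_FTC_finite)
    show "continuous_on {min 0 t..max 0 t} (\<lambda>\<tau>. cis (\<Psi> * \<tau>))" by (intro continuous_intros)
    show "((\<lambda>x. cis (\<Psi> * x) / (\<i> * \<Psi>)) has_vector_derivative cis (\<Psi> * x)) (at x within {min 0 t..max 0 t})" for x
      using has_vector_derivative_divide[OF has_vector_derivative_cis[of \<Psi> x], of "\<i> * \<Psi>"] assms
      by (simp add: scaleR_conv_of_real field_simps)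
  qed
  then show ?thesis by (simp add: zero_ereal_def diff_divide_distrib)
qed

lemma trilinear_finite:
  assumes "finite X" "X \<subseteq> N3 n"
    and supp: "\<And>p q k. (p, q, k) \<in> N3 n \<Longrightarrow> fourier s a p \<noteq> 0 \<Longrightarrow> fourier s b q \<noteq> 0 \<Longrightarrow> fourier s c k \<noteq> 0 \<Longrightarrow> (p, q, k) \<in> X"
  shows "trilinear s n a b c = (\<Sum>y\<in>X. cubic_term s cubic_multiplier a b c y)"
proof -
  have "cubic_term s cubic_multiplier a b c y = 0" if "y \<in> N3 n - X" for y
    using that supp by (cases y) (auto simp: cubic_term_def)
  then have "trilinear s n a b c = infsum (cubic_term s cubic_multiplier a b c) X"
    unfolding trilinear_def by (intro infsum_cong_neutral) (use assms in auto)
  then show ?thesis using assms(1) by simp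
qed

section \<open>The resonant fifth order interaction\<close>

text \<open>
  The datum \<open>x * seed\<close> consists of the low modes \<open>1\<close>, \<open>-3\<close> and one high mode \<open>N\<close>.  As
  \<open>1 + 1 + 1 - 3 = 0\<close>, the mode \<open>N\<close> interacts with itself at fifth order through four low
  frequencies; no other choice of four low frequencies has sum \<open>0\<close>.  The sums \<open>1 + 1\<close> and \<open>1 - 3\<close> do not vanish,
  which is why two successive cubic interactions can realize it, whereas the quintic sum excludes it.
\<close>
locale probe = smooth_flow +
  fixes N :: int and \<eta> C d :: real
  assumes s: "3 / 2 \<le> s" and N: "10 \<le> N"
    and \<eta>: "0 < \<eta>" "\<eta> \<le> T" and C: "0 < C" and d: "0 < d"
    and close: "\<And>t b. t \<in> {0..\<eta>} \<Longrightarrow> norm b < d \<Longrightarrow> norm (S t b - free d1 d2 t b) \<le> C * norm b ^ 3"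
begin

abbreviation "L \<equiv> dispersion d1 d2"
abbreviation "w \<equiv> weight s"

definition seed :: ell2 where "seed = single 1 1 + single (-3) 1 + single N 1"
definition F :: "real \<Rightarrow> real \<Rightarrow> ell2" where "F x t = U t (x *\<^sub>R seed)"
definition R :: "real \<Rightarrow> real \<Rightarrow> ell2" where "R x t = S t (x *\<^sub>R seed) - F x t"

lemma norm_seed: "norm seed \<le> 3"
  using norm_triangle_ineq[of "single 1 1 + single (-3) 1" "single N 1"] norm_triangle_ineq[of "single 1 1" "single (-3) 1"]
  by (simp add: seed_def)

lemma norm_x_seed: "0 < x \<Longrightarrow> norm (x *\<^sub>R seed) \<le> 3 * x"
  using norm_seed by simp

lemma coord_seed: "coord seed k = (if k = 1 \<or> k = -3 \<or> k = N then 1 else 0)"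
  using N by (auto simp: seed_def coord_rep single.rep_eq)

lemma fourier_F: "fourier s (F x t) k = (if k = 1 \<or> k = -3 \<or> k = N then x * w k * cis (t * L k) else 0)"
  by (simp add: F_def fourier_weight free.rep_eq coord_rep coord_seed scaleR_conv_of_real)

lemma S_eq: "S t (x *\<^sub>R seed) = F x t + R x t"
  by (simp add: R_def)

lemma small_order_F: "small_order \<eta> 1 F"
  by (rule small_orderI[of 1 _ _ 3]) (use norm_x_seed in \<open>auto simp: F_def\<close>)

lemma norm_R:
  assumes "0 < x" "x < d / 3" "t \<in> {0..\<eta>}"
  shows "norm (R x t) \<le> 27 * C * x ^ 3"
proof -
  note 1 = norm_x_seed[OF assms(1)]
  then have "norm (x *\<^sub>R seed) < d" using assms(2) by linarith
  then have "norm (R x t) \<le> C * norm (x *\<^sub>R seed) ^ 3"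
    unfolding R_def F_def using assms(3) by (intro close)
  also have "\<dots> \<le> C * (3 * x) ^ 3" using 1 C by (intro mult_left_mono power_mono) auto
  finally show ?thesis by (simp add: power_mult_distrib)
qed

lemma small_order_R: "small_order \<eta> 3 R"
  by (rule small_orderI[of "d / 3" _ _ "27 * C", OF _ norm_R]) (use d in auto)

lemma small_order_u: "small_order \<eta> 1 (\<lambda>x t. F x t + R x t)"
  by (intro small_order_add small_order_F small_order_mono[OF small_order_R]) auto

lemma N3_iff: "(p, q, k) \<in> N3 n \<longleftrightarrow> p + q + k = n \<and> p + q \<noteq> 0 \<and> p + k \<noteq> 0 \<and> q + k \<noteq> 0"
  by (auto simp: N3_def)

lemma fourier_F_nonzero: "fourier s (F x t) k \<noteq> 0 \<Longrightarrow> k = 1 \<or> k = -3 \<or> k = N"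
  by (auto simp: fourier_F split: if_splits)

text \<open>
  By \<open>10 \<le> N\<close> a sum of three frequencies of the datum is close to \<open>N\<close> only if exactly one of them equals \<open>N\<close>.
  The other two would have to add up to \<open>0\<close> or \<open>6\<close>, which the frequencies \<open>1\<close> and \<open>-3\<close> cannot.
\<close>
lemma trilinear_FFF_zero: "n = N \<or> n = N + 6 \<Longrightarrow> trilinear s n (F x t) (F x t) (F x t) = 0"
proof -
  assume n: "n = N \<or> n = N + 6"
  have "trilinear s n (F x t) (F x t) (F x t) = (\<Sum>y\<in>{}. cubic_term s cubic_multiplier (F x t) (F x t) (F x t) y)"
  proof (rule trilinear_finite)
    fix p q k assume "(p, q, k) \<in> N3 n" and nz: "fourier s (F x t) p \<noteq> 0" "fourier s (F x t) q \<noteq> 0" "fourier s (F x t) k \<noteq> 0"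
    then show "(p, q, k) \<in> {}"
      using fourier_F_nonzero[OF nz(1)] fourier_F_nonzero[OF nz(2)] fourier_F_nonzero[OF nz(3)] N n
      unfolding N3_iff insert_iff empty_iff prod.inject by smt
  qed (use N in \<open>auto simp: N3_iff\<close>)
  then show ?thesis by simp
qed

lemma trilinear_FFF_plus:
  "trilinear s (N + 2) (F x t) (F x t) (F x t) =
     x ^ 3 * ((N\<^sup>2 + 2 * N + 3) * (w 1)\<^sup>2 * w N) * cis (t * (2 * L 1 + L N))"
proof -
  have "trilinear s (N + 2) (F x t) (F x t) (F x t) =
    (\<Sum>y\<in>{(1, 1, N), (1, N, 1), (N, 1, 1)}. cubic_term s cubic_multiplier (F x t) (F x t) (F x t) y)"
  proof (rule trilinear_finite)
    fix p q k assume "(p, q, k) \<in> N3 (N + 2)" and nz: "fourier s (F x t) p \<noteq> 0" "fourier s (F x t) q \<noteq> 0" "fourier s (F x t) k \<noteq> 0"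
    then show "(p, q, k) \<in> {(1, 1, N), (1, N, 1), (N, 1, 1)}"
      using fourier_F_nonzero[OF nz(1)] fourier_F_nonzero[OF nz(2)] fourier_F_nonzero[OF nz(3)] N
      unfolding N3_iff insert_iff empty_iff prod.inject by smt
  qed (use N in \<open>auto simp: N3_iff\<close>)
  also have "\<dots> = (N\<^sup>2 + 2 * N + 3) * (fourier s (F x t) 1)\<^sup>2 * fourier s (F x t) N"
    using N by (simp add: cubic_term_def cubic_multiplier_def power2_eq_square algebra_simps)
  also have "\<dots> = x ^ 3 * ((N\<^sup>2 + 2 * N + 3) * (w 1)\<^sup>2 * w N) * cis (t * (2 * L 1 + L N))"
  proof -
    have "cis (t * (2 * L 1 + L N)) = cis (t * L 1) * cis (t * L 1) * cis (t * L N)"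
      by (simp add: cis_mult algebra_simps)
    then show ?thesis by (simp add: fourier_F power2_eq_square power3_eq_cube)
  qed
  finally show ?thesis .
qed

lemma trilinear_FFF_minus:
  "trilinear s (N - 2) (F x t) (F x t) (F x t) =
     x ^ 3 * (2 * (N\<^sup>2 - 2 * N + 7) * w 1 * w (-3) * w N) * cis (t * (L 1 + L (-3) + L N))"
proof -
  have "trilinear s (N - 2) (F x t) (F x t) (F x t) =
    (\<Sum>y\<in>{(1, -3, N), (1, N, -3), (-3, 1, N), (-3, N, 1), (N, 1, -3), (N, -3, 1)}.
       cubic_term s cubic_multiplier (F x t) (F x t) (F x t) y)"
  proof (rule trilinear_finite)
    fix p q k assume "(p, q, k) \<in> N3 (N - 2)" and nz: "fourier s (F x t) p \<noteq> 0" "fourier s (F x t) q \<noteq> 0" "fourier s (F x t) k \<noteq> 0"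
    then show "(p, q, k) \<in> {(1, -3, N), (1, N, -3), (-3, 1, N), (-3, N, 1), (N, 1, -3), (N, -3, 1)}"
      using fourier_F_nonzero[OF nz(1)] fourier_F_nonzero[OF nz(2)] fourier_F_nonzero[OF nz(3)] N
      unfolding N3_iff insert_iff empty_iff prod.inject by smt
  qed (use N in \<open>auto simp: N3_iff\<close>)
  also have "\<dots> = 2 * (N\<^sup>2 - 2 * N + 7) * fourier s (F x t) 1 * fourier s (F x t) (-3) * fourier s (F x t) N"
    using N by (simp add: cubic_term_def cubic_multiplier_def power2_eq_square algebra_simps)
  also have "\<dots> = x ^ 3 * (2 * (N\<^sup>2 - 2 * N + 7) * w 1 * w (-3) * w N) * cis (t * (L 1 + L (-3) + L N))"
  proof -
    have "cis (t * (L 1 + L (-3) + L N)) = cis (t * L 1) * cis (t * L (-3)) * cis (t * L N)"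
      by (simp add: cis_mult algebra_simps)
    then show ?thesis by (simp add: fourier_F power3_eq_cube)
  qed
  finally show ?thesis .
qed

text \<open>
  With \<open>N\<close> in one of the two slots occupied by the datum, the remaining two frequencies would add up to \<open>0\<close>,
  which the nonresonance condition forbids.  So only low modes scatter \<open>G\<close> into \<open>N\<close>.
\<close>
lemma trilinear_linearized:
  "trilinear s N (F x t) (F x t) G + trilinear s N (F x t) G (F x t) + trilinear s N G (F x t) (F x t) =
     (fourier s (F x t) 1)\<^sup>2 * (N\<^sup>2 - 2 * N + 3) * fourier s G (N - 2)
   + 2 * fourier s (F x t) 1 * fourier s (F x t) (-3) * (N\<^sup>2 + 2 * N + 7) * fourier s G (N + 2)
   + (fourier s (F x t) (-3))\<^sup>2 * (N\<^sup>2 + 6 * N + 27) * fourier s G (N + 6)"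
proof -
  have 1: "trilinear s N (F x t) (F x t) G =
    (\<Sum>y\<in>{(1, 1, N - 2), (1, -3, N + 2), (-3, 1, N + 2), (-3, -3, N + 6)}.
       cubic_term s cubic_multiplier (F x t) (F x t) G y)"
  proof (rule trilinear_finite)
    fix p q k assume "(p, q, k) \<in> N3 N" and nz: "fourier s (F x t) p \<noteq> 0" "fourier s (F x t) q \<noteq> 0" "fourier s G k \<noteq> 0"
    then show "(p, q, k) \<in> {(1, 1, N - 2), (1, -3, N + 2), (-3, 1, N + 2), (-3, -3, N + 6)}"
      using fourier_F_nonzero[OF nz(1)] fourier_F_nonzero[OF nz(2)] N
      unfolding N3_iff insert_iff empty_iff prod.inject by smt
  qed (use N in \<open>auto simp: N3_iff\<close>)
  have 2: "trilinear s N (F x t) G (F x t) =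
    (\<Sum>y\<in>{(1, N - 2, 1), (1, N + 2, -3), (-3, N + 2, 1), (-3, N + 6, -3)}.
       cubic_term s cubic_multiplier (F x t) G (F x t) y)"
  proof (rule trilinear_finite)
    fix p q k assume "(p, q, k) \<in> N3 N" and nz: "fourier s (F x t) p \<noteq> 0" "fourier s G q \<noteq> 0" "fourier s (F x t) k \<noteq> 0"
    then show "(p, q, k) \<in> {(1, N - 2, 1), (1, N + 2, -3), (-3, N + 2, 1), (-3, N + 6, -3)}"
      using fourier_F_nonzero[OF nz(1)] fourier_F_nonzero[OF nz(3)] N
      unfolding N3_iff insert_iff empty_iff prod.inject by smt
  qed (use N in \<open>auto simp: N3_iff\<close>)
  have 3: "trilinear s N G (F x t) (F x t) =
    (\<Sum>y\<in>{(N - 2, 1, 1), (N + 2, 1, -3), (N + 2, -3, 1), (N + 6, -3, -3)}.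
       cubic_term s cubic_multiplier G (F x t) (F x t) y)"
  proof (rule trilinear_finite)
    fix p q k assume "(p, q, k) \<in> N3 N" and nz: "fourier s G p \<noteq> 0" "fourier s (F x t) q \<noteq> 0" "fourier s (F x t) k \<noteq> 0"
    then show "(p, q, k) \<in> {(N - 2, 1, 1), (N + 2, 1, -3), (N + 2, -3, 1), (N + 6, -3, -3)}"
      using fourier_F_nonzero[OF nz(2)] fourier_F_nonzero[OF nz(3)] N
      unfolding N3_iff insert_iff empty_iff prod.inject by smt
  qed (use N in \<open>auto simp: N3_iff\<close>)
  show ?thesis
    unfolding 1 2 3
    by (simp add: cubic_term_def cubic_multiplier_def power2_eq_square algebra_simps)
qed

text \<open>
  Exactly one of the five frequencies is \<open>N\<close>, and then the other four have sum \<open>0\<close>.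
\<close>
lemma quintilinear_F_zero: "quintilinear s N (F x t) (F x t) (F x t) (F x t) (F x t) = 0"
proof -
  have z: "quintic_term s (F x t) (F x t) (F x t) (F x t) (F x t) y = 0" if y: "y \<in> N5 N" for y
  proof (rule ccontr)
    assume nz: "quintic_term s (F x t) (F x t) (F x t) (F x t) (F x t) y \<noteq> 0"
    obtain n1 n2 n3 n4 n5 where y': "y = (n1, n2, n3, n4, n5)" by (cases y)
    have alt: "k = N \<or> (-3 \<le> k \<and> k \<le> 1)" if "fourier s (F x t) k \<noteq> 0" for k
      using that by (auto simp: fourier_F split: if_splits)
    have "n1 = N \<or> (-3 \<le> n1 \<and> n1 \<le> 1)" "n2 = N \<or> (-3 \<le> n2 \<and> n2 \<le> 1)" "n3 = N \<or> (-3 \<le> n3 \<and> n3 \<le> 1)"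
      "n4 = N \<or> (-3 \<le> n4 \<and> n4 \<le> 1)" "n5 = N \<or> (-3 \<le> n5 \<and> n5 \<le> 1)"
      using nz alt by (auto simp: y' quintic_term_def)
    moreover have "n1 + n2 + n3 + n4 + n5 = N" "n1 + n2 + n3 + n4 \<noteq> 0" "n1 + n2 + n3 + n5 \<noteq> 0"
      "n1 + n2 + n4 + n5 \<noteq> 0" "n1 + n3 + n4 + n5 \<noteq> 0" "n2 + n3 + n4 + n5 \<noteq> 0"
      using y by (auto simp: y' N5_def)
    ultimately show False using N by smt
  qed
  show ?thesis unfolding quintilinear_def by (rule infsum_0) (rule z)
qed

lemma small_order_resonant:
  assumes "small_order \<eta> k f"
  shows "small_order \<eta> (k + k + k) (\<lambda>x t. of_real ((cmod (f x t))\<^sup>2) * f x t)"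
proof -
  have n: "small_order \<eta> k (\<lambda>x t. complex_of_real (cmod (f x t)))"
    by (rule small_order_norm[OF assms]) simp
  show ?thesis
    using small_order_mult[OF small_order_mult[OF n n] assms] by (simp add: power2_eq_square)
qed

abbreviation J :: "real \<Rightarrow> real \<Rightarrow> complex" where "J \<Psi> t \<equiv> (LBINT \<tau>=0..t. cis (\<Psi> * \<tau>))"

lemma integrable_cis [simp]: "set_integrable lborel {0..t} (\<lambda>\<tau>. c * cis (\<Psi> * \<tau>))"
  by (rule borel_integrable_atLeastAtMost') (intro continuous_intros)

lemma seed_small:
  assumes "0 < x" "x < r / 3"
  shows "norm (x *\<^sub>R seed) < r"
  using norm_x_seed[OF assms(1)] assms(2) by linarith

lemma interval_integral_diff:
  fixes f g :: "real \<Rightarrow> complex"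
  assumes "0 \<le> t" "set_integrable lborel {0..t} f" "set_integrable lborel {0..t} g"
  shows "(LBINT \<tau>=0..t. f \<tau> - g \<tau>) = (LBINT \<tau>=0..t. f \<tau>) - (LBINT \<tau>=0..t. g \<tau>)"
  using assms by (simp add: zero_ereal_def interval_integral_Icc set_integral_diff)

text \<open>
  A mode that is absent from the datum is generated at third order by the cubic interaction of the free
  evolution; its amplitude is an oscillating integral with the resonance function \<open>\<Phi> - L n\<close>.
\<close>
lemma third_order_mode:
  fixes \<kappa> \<Phi> :: real
  assumes n: "n \<noteq> 1" "n \<noteq> -3" "n \<noteq> N"
    and tri: "\<And>x t. trilinear s n (F x t) (F x t) (F x t) = of_real (x ^ 3 * \<kappa>) * cis (t * \<Phi>)"
  shows "small_order \<eta> 5 (\<lambda>x t. fourier s (R x t) n - x ^ 3 * (10 * \<i> * n * \<kappa> * cis (t * L n) * J (\<Phi> - L n) t))"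
proof -
  let ?u = "\<lambda>x t. F x t + R x t"
  let ?duh = "\<lambda>x. duhamel_integrand d1 d2 s (\<lambda>t. S t (x *\<^sub>R seed)) n"
  let ?main = "\<lambda>x \<tau>. (x ^ 3 * (10 * \<i> * n * \<kappa>)) * cis ((\<Phi> - L n) * \<tau>)"
  have s0: "0 \<le> s" using s by simp
  have un: "fourier s (?u x t) n = fourier s (R x t) n" for x t
    using n by (simp add: fourier_add[OF s] fourier_F)
  have tri_diff: "trilinear s n (?u x t) (?u x t) (?u x t) - trilinear s n (F x t) (F x t) (F x t) =
     trilinear s n (R x t) (?u x t) (?u x t) + trilinear s n (F x t) (R x t) (?u x t) + trilinear s n (F x t) (F x t) (R x t)" for x t
    by (simp add: trilinear_add[OF s] algebra_simps)
  have b_tri: "small_order \<eta> 5 (\<lambda>x t. trilinear s n (?u x t) (?u x t) (?u x t) - trilinear s n (F x t) (F x t) (F x t))"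
    unfolding tri_diff
    using small_order_trilinear[OF s small_order_R small_order_u small_order_u, of n] small_order_trilinear[OF s small_order_F small_order_R small_order_u, of n]
      small_order_trilinear[OF s small_order_F small_order_F small_order_R, of n]
    by (intro small_order_add) simp_all
  have b_quint: "small_order \<eta> 5 (\<lambda>x t. quintilinear s n (?u x t) (?u x t) (?u x t) (?u x t) (?u x t))"
    by (rule small_order_mono[OF small_order_quintilinear[OF s small_order_u small_order_u small_order_u small_order_u small_order_u]]) simp
  have b_res: "small_order \<eta> 5 (\<lambda>x t. of_real ((cmod (fourier s (R x t) n))\<^sup>2) * fourier s (R x t) n)"
    by (rule small_order_mono[OF small_order_resonant[OF small_order_fourier[OF s0 small_order_R]]]) simp
  have err_eq: "?duh x t - ?main x t =
     cis (- t * L n) * ((- 20 * \<i> * of_int n ^ 3) * (of_real ((cmod (fourier s (R x t) n))\<^sup>2) * fourier s (R x t) n)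
       + (10 * \<i> * of_int n) * (trilinear s n (?u x t) (?u x t) (?u x t) - trilinear s n (F x t) (F x t) (F x t))
       + (6 * \<i> * of_int n) * quintilinear s n (?u x t) (?u x t) (?u x t) (?u x t) (?u x t))" for x t
  proof -
    have cis_eq: "cis ((\<Phi> - L n) * t) = cis (- t * L n) * cis (t * \<Phi>)" by (simp add: cis_mult algebra_simps)
    have main': "?main x t = cis (- t * L n) * ((10 * \<i> * of_int n) * trilinear s n (F x t) (F x t) (F x t))"
      unfolding tri cis_eq by (simp only: of_real_mult of_real_power of_real_of_int_eq mult_ac)
    show ?thesis
      unfolding main' duhamel_integrand_def S_eq nonlinearity_multilinear[OF s] un by (simp add: algebra_simps)
  qed
  have b_err: "small_order \<eta> 5 (\<lambda>x t. ?duh x t - ?main x t)"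
    unfolding err_eq
    by (rule small_order_bounded_mult[of _ _ 1], simp, intro small_order_add small_order_bounded_mult[OF order_refl] b_tri b_quint b_res)
  have duh_int: "set_integrable lborel {0..t} (?duh x)" if "0 < x" "x < r / 3" "t \<in> {0..\<eta>}" for x t
    using coord_duhamel(2)[OF seed_small[OF that(1,2)], of t n] that(3) \<eta> by auto
  have b_int: "small_order \<eta> 5 (\<lambda>x t. LBINT \<tau>=0..t. ?duh x \<tau> - ?main x \<tau>)"
    by (rule small_order_integral[OF \<eta>(1) b_err, of "r / 3"]) (use r duh_int \<eta> in \<open>auto intro!: set_integral_diff\<close>)
  have eq: "fourier s (R x t) n - x ^ 3 * (10 * \<i> * n * \<kappa> * cis (t * L n) * J (\<Phi> - L n) t) =
     cis (t * L n) * (LBINT \<tau>=0..t. ?duh x \<tau> - ?main x \<tau>)" if x: "0 < x" "x < r / 3" and t: "t \<in> {0..\<eta>}" for x t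
  proof -
    have "fourier s (x *\<^sub>R seed) n = 0" using n by (simp add: fourier_weight coord_rep coord_seed)
    then have e1: "fourier s (R x t) n = cis (t * L n) * (LBINT \<tau>=0..t. ?duh x \<tau>)"
      using coord_duhamel(1)[OF seed_small[OF x], of t n] t \<eta> un[of x t] unfolding S_eq by simp
    have e2: "(LBINT \<tau>=0..t. ?duh x \<tau> - ?main x \<tau>) = (LBINT \<tau>=0..t. ?duh x \<tau>) - (x ^ 3 * (10 * \<i> * n * \<kappa>)) * J (\<Phi> - L n) t"
      using t duh_int[OF x t] by (subst interval_integral_diff) auto
    show ?thesis unfolding e1 e2 by (simp only: right_diff_distrib mult_ac of_real_power)
  qed
  have "small_order \<eta> 5 (\<lambda>x t. cis (t * L n) * (LBINT \<tau>=0..t. ?duh x \<tau> - ?main x \<tau>))"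
    by (rule small_order_bounded_mult[OF _ b_int, of _ 1]) simp
  then obtain K \<delta> where K: "0 < \<delta>" "\<And>x t. 0 < x \<Longrightarrow> x < \<delta> \<Longrightarrow> t \<in> {0..\<eta>} \<Longrightarrow>
      norm (cis (t * L n) * (LBINT \<tau>=0..t. ?duh x \<tau> - ?main x \<tau>)) \<le> K * x ^ 5"
    unfolding small_order_def by blast
  show ?thesis
    by (rule small_orderI[of "min \<delta> (r / 3)" _ _ K]) (use K r in \<open>auto simp: eq\<close>)
qed

end

lemma resonant_difference:
  fixes y z :: complex
  assumes "cmod y \<le> m" "cmod z \<le> m"
  shows "cmod (of_real ((cmod y)\<^sup>2) * y - of_real ((cmod z)\<^sup>2) * z) \<le> 3 * m\<^sup>2 * cmod (y - z)"
proof -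
  have m: "0 \<le> m" using assms(1) norm_ge_zero order_trans by blast
  have sq: "of_real ((cmod v)\<^sup>2) = v * cnj v" for v by (rule complex_norm_square)
  have "of_real ((cmod y)\<^sup>2) * y - of_real ((cmod z)\<^sup>2) * z =
      (y - z) * (y * cnj y) + z * (y * cnj (y - z)) + z * cnj z * (y - z)"
    unfolding sq by (simp add: algebra_simps)
  also have "cmod \<dots> \<le> cmod ((y - z) * (y * cnj y)) + cmod (z * (y * cnj (y - z))) + cmod (z * cnj z * (y - z))"
    by (intro norm_triangle_mono order_refl)
  also have "\<dots> \<le> cmod (y - z) * (m * m) + m * (m * cmod (y - z)) + m * m * cmod (y - z)"
    unfolding norm_mult complex_mod_cnj using assms m
    by (intro add_mono mult_mono mult_nonneg_nonneg) auto
  finally show ?thesis by (simp add: power2_eq_square)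
qed

context probe
begin

definition \<Psi>p :: real where "\<Psi>p = 2 * L 1 + L N - L (N + 2)"
definition \<Psi>m :: real where "\<Psi>m = L 1 + L (-3) + L N - L (N - 2)"
text \<open>
  The phase that is left over when \<open>N\<close> has returned to itself.  It does not depend on \<open>N\<close>, so the
  time integral of its exponential does not decay for large \<open>N\<close>.
\<close>
definition \<Omega> :: real where "\<Omega> = 3 * L 1 + L (-3)"

definition \<kappa>p :: real where "\<kappa>p = (N\<^sup>2 + 2 * N + 3) * (w 1)\<^sup>2 * w N"
definition \<kappa>m :: real where "\<kappa>m = 2 * (N\<^sup>2 - 2 * N + 7) * w 1 * w (-3) * w N"

definition qp :: "real \<Rightarrow> complex" where "qp t = 10 * \<i> * of_int (N + 2) * \<kappa>p * cis (t * L (N + 2)) * J \<Psi>p t"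
definition qm :: "real \<Rightarrow> complex" where "qm t = 10 * \<i> * of_int (N - 2) * \<kappa>m * cis (t * L (N - 2)) * J \<Psi>m t"
definition cp :: "real \<Rightarrow> complex" where
  "cp t = 2 * of_real (w 1) * of_real (w (-3)) * of_int (N\<^sup>2 + 2 * N + 7) * (cis (t * L 1) * cis (t * L (-3)))"
definition cm :: "real \<Rightarrow> complex" where
  "cm t = (of_real (w 1))\<^sup>2 * of_int (N\<^sup>2 - 2 * N + 3) * (cis (t * L 1) * cis (t * L 1))"
definition c6 :: "real \<Rightarrow> complex" where
  "c6 t = (of_real (w (-3)))\<^sup>2 * of_int (N\<^sup>2 + 6 * N + 27) * (cis (t * L (-3)) * cis (t * L (-3)))"
definition H :: "real \<Rightarrow> complex" where "H t = cm t * qm t + cp t * qp t"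

lemma mode_plus: "small_order \<eta> 5 (\<lambda>x t. fourier s (R x t) (N + 2) - x ^ 3 * qp t)"
  using third_order_mode[of "N + 2" \<kappa>p "2 * L 1 + L N"] N trilinear_FFF_plus
  by (simp add: qp_def \<Psi>p_def \<kappa>p_def)

lemma mode_minus: "small_order \<eta> 5 (\<lambda>x t. fourier s (R x t) (N - 2) - x ^ 3 * qm t)"
  using third_order_mode[of "N - 2" \<kappa>m "L 1 + L (-3) + L N"] N trilinear_FFF_minus
  by (simp add: qm_def \<Psi>m_def \<kappa>m_def)

text \<open>
  The pair \<open>-3, -3\<close> would return from \<open>N + 6\<close>, but no pair of low modes leads there.
\<close>
lemma mode_six: "small_order \<eta> 5 (\<lambda>x t. fourier s (R x t) (N + 6))"
  using third_order_mode[of "N + 6" 0 0] N trilinear_FFF_zero[of "N + 6"] by simp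

text \<open>
  Inserting the third order modes into the linearized interaction gives the fifth order part: the
  mode \<open>N\<close> goes to \<open>N + 2\<close> by \<open>1, 1\<close> and returns by \<open>1, -3\<close>, or it goes to \<open>N - 2\<close> by \<open>1, -3\<close> and returns by \<open>1, 1\<close>.
\<close>
lemma trilinear_fifth_order:
  "small_order \<eta> 7 (\<lambda>x t. trilinear s N (F x t + R x t) (F x t + R x t) (F x t + R x t) - complex_of_real (x ^ 5) * H t)"
proof -
  have eq: "trilinear s N (F x t + R x t) (F x t + R x t) (F x t + R x t) - complex_of_real (x ^ 5) * H t =
     complex_of_real x ^ 2 * (cm t * (fourier s (R x t) (N - 2) - complex_of_real (x ^ 3) * qm t) + cp t * (fourier s (R x t) (N + 2) - complex_of_real (x ^ 3) * qp t)
        + c6 t * fourier s (R x t) (N + 6))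
     + (trilinear s N (F x t) (R x t) (R x t) + trilinear s N (R x t) (F x t) (R x t) + trilinear s N (R x t) (R x t) (F x t)
        + trilinear s N (R x t) (R x t) (R x t))" (is "?l = ?r") for x t
  proof -
    have "trilinear s N (F x t + R x t) (F x t + R x t) (F x t + R x t) =
      (trilinear s N (F x t) (F x t) (R x t) + trilinear s N (F x t) (R x t) (F x t) + trilinear s N (R x t) (F x t) (F x t))
     + (trilinear s N (F x t) (R x t) (R x t) + trilinear s N (R x t) (F x t) (R x t) + trilinear s N (R x t) (R x t) (F x t)
        + trilinear s N (R x t) (R x t) (R x t))"
      unfolding trilinear_add[OF s] using trilinear_FFF_zero[of N x t] by (simp add: algebra_simps)
    moreover have "trilinear s N (F x t) (F x t) (R x t) + trilinear s N (F x t) (R x t) (F x t) + trilinear s N (R x t) (F x t) (F x t)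
      = complex_of_real x ^ 2 * (cm t * fourier s (R x t) (N - 2) + cp t * fourier s (R x t) (N + 2) + c6 t * fourier s (R x t) (N + 6))"
      unfolding trilinear_linearized by (simp add: fourier_F cm_def cp_def c6_def power2_eq_square distrib_left mult_ac)
    moreover have "complex_of_real x ^ 5 = complex_of_real x ^ 2 * complex_of_real x ^ 3" by (simp flip: power_add)
    ultimately show ?thesis
      by (simp add: H_def distrib_left right_diff_distrib mult_ac)
  qed
  have bounded: "cmod (cm t) \<le> cmod (cm 0)" "cmod (cp t) \<le> cmod (cp 0)" "cmod (c6 t) \<le> cmod (c6 0)" for t
    by (simp_all add: cm_def cp_def c6_def norm_mult)
  have 1: "small_order \<eta> 5 (\<lambda>x t. cm t * (fourier s (R x t) (N - 2) - complex_of_real (x ^ 3) * qm t) + cp t * (fourier s (R x t) (N + 2) - complex_of_real (x ^ 3) * qp t)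
        + c6 t * fourier s (R x t) (N + 6))"
    by (intro small_order_add small_order_bounded_mult[OF bounded(1)] small_order_bounded_mult[OF bounded(2)] small_order_bounded_mult[OF bounded(3)]
        mode_plus mode_minus mode_six)
  have 2: "small_order \<eta> 7 (\<lambda>x t. complex_of_real x ^ 2 * (cm t * (fourier s (R x t) (N - 2) - complex_of_real (x ^ 3) * qm t) + cp t * (fourier s (R x t) (N + 2) - complex_of_real (x ^ 3) * qp t)
        + c6 t * fourier s (R x t) (N + 6)))"
    by (rule small_order_mono[OF small_order_mult[OF small_order_power 1]]) simp
  have 3: "small_order \<eta> 7 (\<lambda>x t. trilinear s N (F x t) (R x t) (R x t) + trilinear s N (R x t) (F x t) (R x t) + trilinear s N (R x t) (R x t) (F x t)
        + trilinear s N (R x t) (R x t) (R x t))"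
    by (intro small_order_add small_order_mono[OF small_order_trilinear[OF s small_order_F small_order_R small_order_R]] small_order_mono[OF small_order_trilinear[OF s small_order_R small_order_F small_order_R]]
      small_order_mono[OF small_order_trilinear[OF s small_order_R small_order_R small_order_F]] small_order_mono[OF small_order_trilinear[OF s small_order_R small_order_R small_order_R]]) simp_all
  show ?thesis
    unfolding eq by (intro small_order_add 2 3)
qed

lemma quintilinear_fifth_order:
  "small_order \<eta> 7 (\<lambda>x t. quintilinear s N (F x t + R x t) (F x t + R x t) (F x t + R x t) (F x t + R x t) (F x t + R x t))"
proof -
  have eq: "quintilinear s N (F x t + R x t) (F x t + R x t) (F x t + R x t) (F x t + R x t) (F x t + R x t) =
     quintilinear s N (R x t) (F x t + R x t) (F x t + R x t) (F x t + R x t) (F x t + R x t)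
   + quintilinear s N (F x t) (R x t) (F x t + R x t) (F x t + R x t) (F x t + R x t)
   + quintilinear s N (F x t) (F x t) (R x t) (F x t + R x t) (F x t + R x t)
   + quintilinear s N (F x t) (F x t) (F x t) (R x t) (F x t + R x t)
   + quintilinear s N (F x t) (F x t) (F x t) (F x t) (R x t)" for x t
    using quintilinear_F_zero[of x t]
      quintilinear_add(1)[OF s, of N "F x t" "R x t" "F x t + R x t" "F x t + R x t" "F x t + R x t" "F x t + R x t"]
      quintilinear_add(2)[OF s, of N "F x t" "F x t" "R x t" "F x t + R x t" "F x t + R x t" "F x t + R x t"]
      quintilinear_add(3)[OF s, of N "F x t" "F x t" "F x t" "R x t" "F x t + R x t" "F x t + R x t"]
      quintilinear_add(4)[OF s, of N "F x t" "F x t" "F x t" "F x t" "R x t" "F x t + R x t"]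
      quintilinear_add(5)[OF s, of N "F x t" "F x t" "F x t" "F x t" "F x t" "R x t"]
    by simp
  show ?thesis
    unfolding eq
    by (intro small_order_add
      small_order_mono[OF small_order_quintilinear[OF s small_order_R small_order_u small_order_u small_order_u small_order_u]]
      small_order_mono[OF small_order_quintilinear[OF s small_order_F small_order_R small_order_u small_order_u small_order_u]]
      small_order_mono[OF small_order_quintilinear[OF s small_order_F small_order_F small_order_R small_order_u small_order_u]]
      small_order_mono[OF small_order_quintilinear[OF s small_order_F small_order_F small_order_F small_order_R small_order_u]]
      small_order_mono[OF small_order_quintilinear[OF s small_order_F small_order_F small_order_F small_order_F small_order_R]]) simp_all
qed

definition Ap :: real where "Ap = - 200 * N * (N + 2) * (N\<^sup>2 + 2 * N + 3) * (N\<^sup>2 + 2 * N + 7)"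
definition Am :: real where "Am = - 200 * N * (N - 2) * (N\<^sup>2 - 2 * N + 3) * (N\<^sup>2 - 2 * N + 7)"
definition W :: real where "W = (w 1) ^ 3 * w (-3)"
definition G :: "real \<Rightarrow> complex" where "G t = 10 * \<i> * of_int N * cis (- t * L N) * H t"

text \<open>
  Integrating the oscillation of the intermediate mode divides by \<open>\<Psi>p\<close> or \<open>\<Psi>m\<close>, of size \<open>N\<^sup>4\<close>, while
  each numerator \<open>Ap\<close>, \<open>Am\<close> has size \<open>N\<^sup>6\<close>.
\<close>
lemma G_eq:
  assumes "\<Psi>p \<noteq> 0" "\<Psi>m \<noteq> 0"
  shows "G t = of_real (w N * W) * (of_real Ap / (\<i> * \<Psi>p) * (cis (\<Omega> * t) - cis ((\<Omega> - \<Psi>p) * t))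
     + of_real Am / (\<i> * \<Psi>m) * (cis (\<Omega> * t) - cis ((\<Omega> - \<Psi>m) * t)))"
proof -
  have p1: "cis (\<Omega> * t) = cis (- t * L N) * (cis (t * L 1) * cis (t * L (-3))) * cis (t * L (N + 2)) * cis (\<Psi>p * t)"
    by (simp add: cis_mult \<Omega>_def \<Psi>p_def algebra_simps)
  have p2: "cis ((\<Omega> - \<Psi>p) * t) = cis (- t * L N) * (cis (t * L 1) * cis (t * L (-3))) * cis (t * L (N + 2))"
    by (simp add: cis_mult \<Omega>_def \<Psi>p_def algebra_simps)
  have m1: "cis (\<Omega> * t) = cis (- t * L N) * (cis (t * L 1) * cis (t * L 1)) * cis (t * L (N - 2)) * cis (\<Psi>m * t)"
    by (simp add: cis_mult \<Omega>_def \<Psi>m_def algebra_simps)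
  have m2: "cis ((\<Omega> - \<Psi>m) * t) = cis (- t * L N) * (cis (t * L 1) * cis (t * L 1)) * cis (t * L (N - 2))"
    by (simp add: cis_mult \<Omega>_def \<Psi>m_def algebra_simps)
  have P: "10 * \<i> * of_int N * cis (- t * L N) * (cp t * qp t) =
     of_real (w N * W) * (of_real Ap / (\<i> * \<Psi>p) * (cis (\<Omega> * t) - cis ((\<Omega> - \<Psi>p) * t)))"
  proof -
    define X where "X = cis (- t * L N) * (cis (t * L 1) * cis (t * L (-3))) * cis (t * L (N + 2))"
    have "10 * \<i> * of_int N * cis (- t * L N) * (cp t * qp t) =
       (10 * \<i> * of_int N * (2 * of_real (w 1) * of_real (w (-3)) * of_int (N\<^sup>2 + 2 * N + 7)) * (10 * \<i> * of_int (N + 2) * \<kappa>p)) * (X * J \<Psi>p t)"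
      by (simp only: cp_def qp_def X_def mult_ac)
    also have "10 * \<i> * of_int N * (2 * of_real (w 1) * of_real (w (-3)) * of_int (N\<^sup>2 + 2 * N + 7)) * (10 * \<i> * of_int (N + 2) * \<kappa>p) = of_real (w N * W) * of_real Ap"
      by (simp add: \<kappa>p_def W_def Ap_def power2_eq_square power3_eq_cube algebra_simps)
    also have "X * J \<Psi>p t = (cis (\<Omega> * t) - cis ((\<Omega> - \<Psi>p) * t)) / (\<i> * \<Psi>p)"
      unfolding integral_cis[OF assms(1)] p1 p2 X_def[symmetric] by (simp add: right_diff_distrib)
    finally show ?thesis by simp
  qed
  have M: "10 * \<i> * of_int N * cis (- t * L N) * (cm t * qm t) =
     of_real (w N * W) * (of_real Am / (\<i> * \<Psi>m) * (cis (\<Omega> * t) - cis ((\<Omega> - \<Psi>m) * t)))"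
  proof -
    define X where "X = cis (- t * L N) * (cis (t * L 1) * cis (t * L 1)) * cis (t * L (N - 2))"
    have "10 * \<i> * of_int N * cis (- t * L N) * (cm t * qm t) =
       (10 * \<i> * of_int N * ((of_real (w 1))\<^sup>2 * of_int (N\<^sup>2 - 2 * N + 3)) * (10 * \<i> * of_int (N - 2) * \<kappa>m)) * (X * J \<Psi>m t)"
      by (simp only: cm_def qm_def X_def mult_ac)
    also have "10 * \<i> * of_int N * ((of_real (w 1))\<^sup>2 * of_int (N\<^sup>2 - 2 * N + 3)) * (10 * \<i> * of_int (N - 2) * \<kappa>m) = of_real (w N * W) * of_real Am"
      by (simp add: \<kappa>m_def W_def Am_def power2_eq_square power3_eq_cube algebra_simps)
    also have "X * J \<Psi>m t = (cis (\<Omega> * t) - cis ((\<Omega> - \<Psi>m) * t)) / (\<i> * \<Psi>m)"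
      unfolding integral_cis[OF assms(2)] m1 m2 X_def[symmetric] by (simp add: right_diff_distrib)
    finally show ?thesis by simp
  qed
  show ?thesis
    unfolding G_def H_def distrib_left P M by (simp add: add.commute)
qed

text \<open>
  The reason why the term \<open>n\<^sup>3 |v n|\<^sup>2 v n\<close> is harmless here: three derivatives are compensated by two of the weights.
\<close>
lemma weight_N: "of_int N ^ 3 * (w N)\<^sup>2 \<le> 1"
proof -
  have b: "of_int N \<le> bracket N" "1 \<le> bracket N" using bracket_ge[of N] N by auto
  have "(w N)\<^sup>2 \<le> (1 / (bracket N * sqrt (bracket N)))\<^sup>2"
    by (intro power_mono weight_le_bracket[OF s]) simp
  also have "\<dots> = 1 / bracket N ^ 3"
    using b by (simp add: power_divide power_mult_distrib power3_eq_cube power2_eq_square)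
  finally have "of_int N ^ 3 * (w N)\<^sup>2 \<le> bracket N ^ 3 * (1 / bracket N ^ 3)"
    using b N by (intro mult_mono power_mono) auto
  then show ?thesis using b by simp
qed

end

lemma inner_cis_mult: "inner (cis \<theta> * p) q = inner p (cis (- \<theta>) * q)"
  by (simp add: inner_complex_def cis.ctr algebra_simps)

context probe
begin

definition \<Gamma> :: "real \<Rightarrow> complex" where "\<Gamma> t = (LBINT \<tau>=0..t. G \<tau>) / of_real (w N)"

lemma G_integrable:
  assumes "\<Psi>p \<noteq> 0" "\<Psi>m \<noteq> 0"
  shows "set_integrable lborel {0..t} G"
proof (rule borel_integrable_atLeastAtMost')
  have "G = (\<lambda>t. of_real (w N * W) * (of_real Ap / (\<i> * \<Psi>p) * (cis (\<Omega> * t) - cis ((\<Omega> - \<Psi>p) * t))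
     + of_real Am / (\<i> * \<Psi>m) * (cis (\<Omega> * t) - cis ((\<Omega> - \<Psi>m) * t))))"
    using G_eq[OF assms] by blast
  then show "continuous_on {0..t} G"
    by (simp only:) (intro continuous_intros; use assms in simp)
qed

text \<open>
  At fifth order two things happen to the mode \<open>N\<close>: the resonant term \<open>|v n|\<^sup>2 v n\<close> acts on its own third order
  effect, which by \<open>weight_N\<close> costs a constant independent of \<open>N\<close> and is put into the error, and the
  two cubic interactions contribute \<open>\<Gamma>\<close>.  The range \<open>e\<close> of the expansion depends on \<open>N\<close>.
\<close>
lemma fifth_order_expansion:
  assumes \<Psi>: "\<Psi>p \<noteq> 0" "\<Psi>m \<noteq> 0" and t: "t \<in> {0..\<eta>}"
  shows "\<exists>\<beta> e. 0 < e \<and> (\<forall>x. 0 < x \<longrightarrow> x < e \<longrightarrow>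
    cmod (cis (- t * L N) * coord (S t (x *\<^sub>R seed)) N - of_real x - \<beta> * of_real (x ^ 3) - \<Gamma> t * of_real (x ^ 5))
      \<le> (6480 * C * T + 1) * x ^ 5)"
proof -
  let ?u = "\<lambda>x t. F x t + R x t"
  let ?duh = "\<lambda>x. duhamel_integrand d1 d2 s (\<lambda>t. S t (x *\<^sub>R seed)) N"
  define wN where "wN = w N"
  have wN: "0 < wN" "wN \<le> 1" using weight_le_1[of s N] s by (auto simp: wN_def)
  define c3 where "c3 = - 20 * \<i> * of_int N ^ 3 * of_real (wN ^ 3)"
  define rest where "rest x \<tau> = (10 * \<i> * of_int N) * (trilinear s N (?u x \<tau>) (?u x \<tau>) (?u x \<tau>) - of_real (x ^ 5) * H \<tau>)
     + (6 * \<i> * of_int N) * quintilinear s N (?u x \<tau>) (?u x \<tau>) (?u x \<tau>) (?u x \<tau>) (?u x \<tau>)" for x \<tau>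
  have "small_order \<eta> 7 rest"
    unfolding rest_def[abs_def]
    by (intro small_order_add small_order_bounded_mult[OF order_refl] trilinear_fifth_order quintilinear_fifth_order)
  then obtain K \<delta> where K: "0 < K" "0 < \<delta>"
    and rest: "\<And>x \<tau>. 0 < x \<Longrightarrow> x < \<delta> \<Longrightarrow> \<tau> \<in> {0..\<eta>} \<Longrightarrow> norm (rest x \<tau>) \<le> K * x ^ 7"
    by (rule small_orderE) auto
  define err where "err x \<tau> = ?duh x \<tau> - (c3 * of_real (x ^ 3) + of_real (x ^ 5) * G \<tau>)" for x \<tau>
  \<comment> \<open>The last two entries make \<open>27 C x\<^sup>3 \<le> x\<close> and absorb the seventh order error, which is not uniform in \<open>N\<close>.\<close>
  define e where "e = min (min (min (d / 3) (r / 3)) (min \<delta> 1)) (min (1 / (27 * C)) (wN / (K * T)))"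
  have e: "0 < e" using d r K C wN T by (simp add: e_def)
  have err_bound: "cmod (err x \<tau>) \<le> (6480 * C * (of_int N ^ 3 * wN ^ 3) + K * x\<^sup>2) * x ^ 5"
    if x: "0 < x" "x < e" and \<tau>: "\<tau> \<in> {0..\<eta>}" for x \<tau>
  proof -
    define y where "y = fourier s (?u x \<tau>) N"
    define z where "z = of_real (x * wN) * cis (\<tau> * L N)"
    have yz: "y - z = fourier s (R x \<tau>) N"
      by (simp add: y_def z_def fourier_add[OF s] fourier_F wN_def)
    have xs: "x < d / 3" "x < \<delta>" "x < 1" "x < 1 / (27 * C)" using x by (auto simp: e_def)
    have dyz: "cmod (y - z) \<le> wN * (27 * C * x ^ 3)"
      unfolding yz norm_fourier_eq wN_def
      using norm_R[OF x(1) xs(1) \<tau>] cmod_coord_le[of "R x \<tau>" N] by (intro mult_left_mono) auto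
    have "27 * C * x ^ 3 \<le> x"
    proof -
      have "x ^ 3 = x * x * x" by (simp add: power3_eq_cube)
      also have "\<dots> \<le> x * x * 1" using xs x by (intro mult_left_mono) auto
      finally have "27 * C * x ^ 3 \<le> x * (27 * C * x)" using C by (simp add: mult_ac)
      also have "\<dots> \<le> x * 1" using xs x C by (intro mult_left_mono) (auto simp: field_simps)
      finally show ?thesis by simp
    qed
    then have "cmod (y - z) \<le> wN * x" using dyz wN by (meson mult_left_mono less_imp_le order_trans)
    moreover have cz: "cmod z = x * wN" using x wN by (simp add: z_def norm_mult)
    moreover have "cmod y \<le> cmod (y - z) + cmod z" using norm_triangle_ineq[of "y - z" z] by simp
    ultimately have m: "cmod y \<le> 2 * (x * wN)" "cmod z \<le> 2 * (x * wN)" using x wN by (auto simp: mult_ac)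
    \<comment> \<open>\<open>324 = 3 * 2\<^sup>2 * 27\<close>, and \<open>6480 = 20 * 324\<close> below.\<close>
    have res: "cmod (of_real ((cmod y)\<^sup>2) * y - of_real ((cmod z)\<^sup>2) * z) \<le> 324 * C * wN ^ 3 * x ^ 5"
    proof -
      have "cmod (of_real ((cmod y)\<^sup>2) * y - of_real ((cmod z)\<^sup>2) * z) \<le> 3 * (2 * (x * wN))\<^sup>2 * (wN * (27 * C * x ^ 3))"
        using resonant_difference[OF m] dyz by (meson mult_left_mono order_trans mult_nonneg_nonneg zero_le_power2 zero_le_numeral)
      then show ?thesis by (simp add: power2_eq_square power_numeral_reduce mult_ac)
    qed
    have zz: "cis (- \<tau> * L N) * (of_real ((cmod z)\<^sup>2) * z) = of_real (wN ^ 3) * of_real (x ^ 3)"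
    proof -
      have "cis (- \<tau> * L N) * cis (\<tau> * L N) = 1" by (simp add: cis_mult)
      then show ?thesis unfolding cz by (simp add: z_def power_mult_distrib power3_eq_cube power2_eq_square mult_ac)
    qed
    have "err x \<tau> = cis (- \<tau> * L N) * ((- 20 * \<i> * of_int N ^ 3) * (of_real ((cmod y)\<^sup>2) * y - of_real ((cmod z)\<^sup>2) * z) + rest x \<tau>)"
    proof -
      have 1: "?duh x \<tau> = cis (- \<tau> * L N) * ((- 20 * \<i> * of_int N ^ 3) * (of_real ((cmod y)\<^sup>2) * y)
          + rest x \<tau> + (10 * \<i> * of_int N) * (of_real (x ^ 5) * H \<tau>))"
        unfolding duhamel_integrand_def S_eq nonlinearity_multilinear[OF s] y_def[symmetric] rest_def
        by (simp add: algebra_simps)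
      have 2: "c3 * of_real (x ^ 3) = (- 20 * \<i> * of_int N ^ 3) * (cis (- \<tau> * L N) * (of_real ((cmod z)\<^sup>2) * z))"
        unfolding zz c3_def by (simp only: mult_ac)
      have 3: "of_real (x ^ 5) * G \<tau> = cis (- \<tau> * L N) * ((10 * \<i> * of_int N) * (of_real (x ^ 5) * H \<tau>))"
        unfolding G_def by (simp only: mult_ac)
      show ?thesis unfolding err_def 1 2 3 by (simp add: algebra_simps)
    qed
    then have "cmod (err x \<tau>) = cmod ((- 20 * \<i> * of_int N ^ 3) * (of_real ((cmod y)\<^sup>2) * y - of_real ((cmod z)\<^sup>2) * z) + rest x \<tau>)"
      by (simp only: norm_mult norm_cis mult_1)
    also have "\<dots> \<le> cmod ((- 20 * \<i> * of_int N ^ 3) * (of_real ((cmod y)\<^sup>2) * y - of_real ((cmod z)\<^sup>2) * z)) + cmod (rest x \<tau>)"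
      by (rule norm_triangle_ineq)
    also have "cmod ((- 20 * \<i> * of_int N ^ 3) * q) = 20 * of_int N ^ 3 * cmod q" for q
      using N by (simp add: norm_mult norm_power)
    also have "20 * of_int N ^ 3 * cmod (of_real ((cmod y)\<^sup>2) * y - of_real ((cmod z)\<^sup>2) * z) + cmod (rest x \<tau>)
        \<le> 20 * of_int N ^ 3 * (324 * C * wN ^ 3 * x ^ 5) + K * x ^ 7"
      using N by (intro add_mono mult_left_mono res rest[OF x(1) xs(2) \<tau>]) auto
    also have "\<dots> = (6480 * C * (of_int N ^ 3 * wN ^ 3) + K * x\<^sup>2) * x ^ 5"
      by (simp add: power_numeral_reduce algebra_simps)
    finally show ?thesis .
  qed
  have t0: "0 \<le> t" and tT: "t \<in> {0..T}" using t \<eta> by auto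
  have "cmod (cis (- t * L N) * coord (S t (x *\<^sub>R seed)) N - of_real x - (c3 * t / wN) * of_real (x ^ 3) - \<Gamma> t * of_real (x ^ 5))
      \<le> (6480 * C * T + 1) * x ^ 5" if x: "0 < x" "x < e" for x
  proof -
    have xr: "norm (x *\<^sub>R seed) < r" using x by (intro seed_small) (auto simp: e_def)
    note D = coord_duhamel[OF xr tT, of N]
    have Ic: "set_integrable lborel {0..t} (\<lambda>\<tau>. c3 * of_real (x ^ 3) + of_real (x ^ 5) * G \<tau>)"
      using G_integrable[OF \<Psi>] by (intro set_integral_add) (auto intro!: borel_integrable_atLeastAtMost')
    have Ierr: "set_integrable lborel {0..t} (err x)"
      unfolding err_def[abs_def] using D(2) Ic by (rule set_integral_diff(1))
    have "(LBINT \<tau>=0..t. ?duh x \<tau>) = (LBINT \<tau>=0..t. c3 * of_real (x ^ 3) + of_real (x ^ 5) * G \<tau>) + (LBINT \<tau>=0..t. err x \<tau>)"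
      using interval_integral_diff[OF t0 D(2) Ic] by (simp add: err_def)
    also have "(LBINT \<tau>=0..t. c3 * of_real (x ^ 3) + of_real (x ^ 5) * G \<tau>) = c3 * of_real (x ^ 3) * t + of_real (x ^ 5) * (LBINT \<tau>=0..t. G \<tau>)"
    proof -
      have "interval_lebesgue_integrable lborel 0 t G" "interval_lebesgue_integrable lborel 0 t (\<lambda>\<tau>. c3 * of_real (x ^ 3))"
        using t0 set_integrable_subset[OF G_integrable[OF \<Psi>, of t], of "{0<..<t}"]
          interval_integrable_isCont[of 0 t "\<lambda>\<tau>. c3 * of_real (x ^ 3)"]
        by (auto simp: interval_lebesgue_integrable_def zero_ereal_def greaterThanLessThan_subseteq_atLeastAtMost_iff)
      moreover have "(LBINT \<tau>=0..t. k) = k * of_real t" for k :: complex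
        using interval_integral_eq_integral[of 0 t "\<lambda>_. k"] t0
        by (simp add: zero_ereal_def scaleR_conv_of_real mult.commute borel_integrable_atLeastAtMost')
      ultimately show ?thesis
        by (subst interval_lebesgue_integral_add(2)) auto
    qed
    finally have I: "(LBINT \<tau>=0..t. ?duh x \<tau>) = c3 * of_real (x ^ 3) * t + of_real (x ^ 5) * (LBINT \<tau>=0..t. G \<tau>) + (LBINT \<tau>=0..t. err x \<tau>)" .
    have D': "of_real wN * coord (S t (x *\<^sub>R seed)) N = cis (t * L N) * (of_real (wN * x) + (LBINT \<tau>=0..t. ?duh x \<tau>))"
      using D(1) by (simp add: fourier_weight coord_rep coord_seed wN_def scaleR_conv_of_real)
    have cancel: "cis (- t * L N) * (cis (t * L N) * v) = v" for v by (simp add: mult.assoc[symmetric] cis_mult)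
    have V: "of_real wN * (cis (- t * L N) * coord (S t (x *\<^sub>R seed)) N) = of_real (wN * x) + (LBINT \<tau>=0..t. ?duh x \<tau>)"
      unfolding mult.left_commute[of "of_real wN"] D' by (rule cancel)
    have E0: "of_real wN * (cis (- t * L N) * coord (S t (x *\<^sub>R seed)) N - of_real x - (c3 * t / wN) * of_real (x ^ 3) - \<Gamma> t * of_real (x ^ 5))
      = (LBINT \<tau>=0..t. err x \<tau>)"
      unfolding right_diff_distrib V I using wN by (simp add: \<Gamma>_def wN_def)
    have "wN * cmod (cis (- t * L N) * coord (S t (x *\<^sub>R seed)) N - of_real x - (c3 * t / wN) * of_real (x ^ 3) - \<Gamma> t * of_real (x ^ 5))
      = cmod (LBINT \<tau>=0..t. err x \<tau>)"
      unfolding E0[symmetric] norm_mult norm_of_real using wN by simp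
    also have "\<dots> \<le> ((6480 * C * (of_int N ^ 3 * wN ^ 3) + K * x\<^sup>2) * x ^ 5) * t"
      by (rule norm_interval_integral_le[OF t0 Ierr]) (use err_bound[OF x] t in auto)
    also have "\<dots> \<le> ((6480 * C * (of_int N ^ 3 * wN ^ 3) + K * x\<^sup>2) * x ^ 5) * T"
      using tT x C K wN N by (intro mult_left_mono mult_nonneg_nonneg add_nonneg_nonneg) auto
    also have "\<dots> \<le> wN * ((6480 * C * T + 1) * x ^ 5)"
    proof -
      have "of_int N ^ 3 * wN ^ 3 \<le> wN * 1"
        using weight_N mult_left_mono[of "of_int N ^ 3 * wN\<^sup>2" 1 wN] wN
        by (simp add: wN_def power3_eq_cube power2_eq_square mult_ac)
      then have 1: "6480 * C * T * (of_int N ^ 3 * wN ^ 3) \<le> 6480 * C * T * wN" using C T by simp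
      have "x < 1" "x < wN / (K * T)" using x by (auto simp: e_def)
      then have "x\<^sup>2 * (K * T) \<le> x * (K * T)" "x * (K * T) < wN"
        using x K T by (auto simp: power2_eq_square pos_less_divide_eq)
      then have "6480 * C * T * (of_int N ^ 3 * wN ^ 3) + K * T * x\<^sup>2 \<le> wN * (6480 * C * T + 1)"
        using 1 by (simp add: algebra_simps)
      then have "(6480 * C * T * (of_int N ^ 3 * wN ^ 3) + K * T * x\<^sup>2) * x ^ 5 \<le> (wN * (6480 * C * T + 1)) * x ^ 5"
        using x by (intro mult_right_mono) auto
      then show ?thesis by (simp add: algebra_simps)
    qed
    finally show ?thesis using wN(1) by (simp only: mult_le_cancel_left_pos)
  qed
  then show ?thesis using e by blast
qed

text \<open>
  Testing against \<open>sgn \<Gamma>\<close>, with the free phase removed, extracts \<open>|\<Gamma>|\<close> from the Taylor expansion of the flow map.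
  The bound is the same for all \<open>N\<close>.
\<close>
lemma fifth_order_coefficient_bound:
  assumes \<Psi>: "\<Psi>p \<noteq> 0" "\<Psi>m \<noteq> 0" and t: "t \<in> {0..\<eta>}" and "0 < dd"
    and jets: "\<And>a v. norm a \<le> 3 \<Longrightarrow> norm v \<le> 1 \<Longrightarrow>
      \<exists>c. \<forall>x. 0 < x \<longrightarrow> x < dd \<longrightarrow> \<bar>inner v (S t (x *\<^sub>R a)) - (\<Sum>k<5. c k * x ^ k)\<bar> \<le> M * x ^ 5"
  shows "cmod (\<Gamma> t) \<le> M + (6480 * C * T + 1)"
proof -
  define v where "v = single N (cis (t * L N) * sgn (\<Gamma> t))"
  have "norm v \<le> 1" by (simp add: v_def norm_mult norm_sgn)
  then obtain c where c: "\<And>x. 0 < x \<Longrightarrow> x < dd \<Longrightarrow> \<bar>inner v (S t (x *\<^sub>R seed)) - (\<Sum>k<5. c k * x ^ k)\<bar> \<le> M * x ^ 5"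
    using jets norm_seed by blast
  obtain \<beta> e where e: "0 < e" and E: "\<And>x. 0 < x \<Longrightarrow> x < e \<Longrightarrow>
    cmod (cis (- t * L N) * coord (S t (x *\<^sub>R seed)) N - of_real x - \<beta> * of_real (x ^ 3) - \<Gamma> t * of_real (x ^ 5))
      \<le> (6480 * C * T + 1) * x ^ 5"
    using fifth_order_expansion[OF \<Psi> t] by blast
  define c' where "c' k = (if k = 1 then inner (sgn (\<Gamma> t)) 1 else if k = 3 then inner (sgn (\<Gamma> t)) \<beta> else 0)" for k :: nat
  have "\<bar>cmod (\<Gamma> t)\<bar> \<le> M + (6480 * C * T + 1)"
  proof (rule jet_unique(2)[OF \<open>0 < dd\<close> c e])
    fix x assume x: "0 < x" "x < e"
    define V where "V = cis (- t * L N) * coord (S t (x *\<^sub>R seed)) N"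
    have sg: "inner (sgn (\<Gamma> t)) (\<Gamma> t) = cmod (\<Gamma> t)"
      by (cases "\<Gamma> t = 0") (auto simp: sgn_div_norm power2_norm_eq_inner[symmetric] power2_eq_square)
    have "inner v (S t (x *\<^sub>R seed)) = inner (sgn (\<Gamma> t)) V"
      by (simp add: v_def V_def inner_single inner_cis_mult)
    moreover have "(\<Sum>k<5. c' k * x ^ k) = inner (sgn (\<Gamma> t)) (of_real x) + inner (sgn (\<Gamma> t)) (\<beta> * of_real (x ^ 3))"
    proof -
      have "of_real x = x *\<^sub>R (1 :: complex)" "\<beta> * of_real (x ^ 3) = (x ^ 3) *\<^sub>R \<beta>"
        by (simp_all add: scaleR_conv_of_real)
      then have "inner (sgn (\<Gamma> t)) (of_real x) = x * inner (sgn (\<Gamma> t)) 1" "inner (sgn (\<Gamma> t)) (\<beta> * of_real (x ^ 3)) = x ^ 3 * inner (sgn (\<Gamma> t)) \<beta>"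
        by (simp_all only: inner_scaleR_right)
      moreover have "{..<5::nat} = {0, 1, 2, 3, 4}" by auto
      ultimately show ?thesis by (simp add: c'_def)
    qed
    moreover have "cmod (\<Gamma> t) * x ^ 5 = inner (sgn (\<Gamma> t)) (\<Gamma> t * of_real (x ^ 5))"
    proof -
      have "\<Gamma> t * of_real (x ^ 5) = (x ^ 5) *\<^sub>R \<Gamma> t" by (simp add: scaleR_conv_of_real)
      then show ?thesis by (simp only: inner_scaleR_right sg mult.commute)
    qed
    ultimately have "inner v (S t (x *\<^sub>R seed)) - (\<Sum>k<5. c' k * x ^ k) - cmod (\<Gamma> t) * x ^ 5 =
      inner (sgn (\<Gamma> t)) (V - of_real x - \<beta> * of_real (x ^ 3) - \<Gamma> t * of_real (x ^ 5))"
      by (simp only: inner_diff_right)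
    also have "\<bar>\<dots>\<bar> \<le> cmod (sgn (\<Gamma> t)) * cmod (V - of_real x - \<beta> * of_real (x ^ 3) - \<Gamma> t * of_real (x ^ 5))"
      by (rule Cauchy_Schwarz_ineq2)
    also have "\<dots> \<le> 1 * cmod (V - of_real x - \<beta> * of_real (x ^ 3) - \<Gamma> t * of_real (x ^ 5))"
      by (intro mult_right_mono) (auto simp: norm_sgn)
    also have "\<dots> \<le> (6480 * C * T + 1) * x ^ 5"
      using E[OF x] by (simp add: V_def)
    finally show "\<bar>inner v (S t (x *\<^sub>R seed)) - (\<Sum>k<5. c' k * x ^ k) - cmod (\<Gamma> t) * x ^ 5\<bar> \<le> (6480 * C * T + 1) * x ^ 5" .
  qed
  then show ?thesis by simp
qed

text \<open>
  The exponentials with phases \<open>\<Omega> - \<Psi>p\<close> and \<open>\<Omega> - \<Psi>m\<close> oscillate fast and nearly integrate to \<open>0\<close>.  The phase \<open>\<Omega>\<close> is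
  common to both paths, so their contributions add up.
\<close>
lemma fifth_order_coefficient_lower_bound:
  assumes \<Psi>: "\<Psi>p \<noteq> 0" "\<Psi>m \<noteq> 0" "\<Omega> - \<Psi>p \<noteq> 0" "\<Omega> - \<Psi>m \<noteq> 0"
  shows "W * (\<bar>Ap / \<Psi>p + Am / \<Psi>m\<bar> * cmod (J \<Omega> t) - 2 * \<bar>Ap / \<Psi>p / (\<Omega> - \<Psi>p)\<bar> - 2 * \<bar>Am / \<Psi>m / (\<Omega> - \<Psi>m)\<bar>) \<le> cmod (\<Gamma> t)"
proof -
  have W: "W > 0" by (simp add: W_def)
  have intc: "interval_lebesgue_integrable lborel 0 t (\<lambda>\<tau>. cis (\<Psi> * \<tau>))" for \<Psi>
    unfolding zero_ereal_def by (rule interval_integrable_isCont) (rule has_vector_derivative_continuous[OF has_vector_derivative_cis])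
  have "(LBINT \<tau>=0..t. G \<tau>) = of_real (w N * W) * (of_real Ap / (\<i> * \<Psi>p) * (J \<Omega> t - J (\<Omega> - \<Psi>p) t)
     + of_real Am / (\<i> * \<Psi>m) * (J \<Omega> t - J (\<Omega> - \<Psi>m) t))"
    unfolding G_eq[OF \<Psi>(1,2)] by (simp add: intc del: times_divide_eq_left)
  then have "\<Gamma> t = of_real W * (of_real Ap / (\<i> * \<Psi>p) * (J \<Omega> t - J (\<Omega> - \<Psi>p) t)
     + of_real Am / (\<i> * \<Psi>m) * (J \<Omega> t - J (\<Omega> - \<Psi>m) t))"
    using weight_gt_0[of s N] by (simp add: \<Gamma>_def)
  also have "\<dots> = of_real W * (- \<i>) * (of_real (Ap / \<Psi>p + Am / \<Psi>m) * J \<Omega> t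
     - of_real (Ap / \<Psi>p) * J (\<Omega> - \<Psi>p) t - of_real (Am / \<Psi>m) * J (\<Omega> - \<Psi>m) t)"
    using \<Psi> by (simp add: field_simps)
  finally have "cmod (\<Gamma> t) = W * cmod (of_real (Ap / \<Psi>p + Am / \<Psi>m) * J \<Omega> t
     - of_real (Ap / \<Psi>p) * J (\<Omega> - \<Psi>p) t - of_real (Am / \<Psi>m) * J (\<Omega> - \<Psi>m) t)"
    using W by (simp add: norm_mult)
  moreover have "cmod (of_real (Ap / \<Psi>p + Am / \<Psi>m) * J \<Omega> t) - cmod (of_real (Ap / \<Psi>p) * J (\<Omega> - \<Psi>p) t) - cmod (of_real (Am / \<Psi>m) * J (\<Omega> - \<Psi>m) t)
    \<le> cmod (of_real (Ap / \<Psi>p + Am / \<Psi>m) * J \<Omega> t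
     - of_real (Ap / \<Psi>p) * J (\<Omega> - \<Psi>p) t - of_real (Am / \<Psi>m) * J (\<Omega> - \<Psi>m) t)"
    by (smt (verit) norm_triangle_ineq2)
  moreover have small: "cmod (of_real a * J \<Psi> t) \<le> 2 * \<bar>a / \<Psi>\<bar>" if "\<Psi> \<noteq> 0" for a \<Psi>
  proof -
    have "cmod (cis (\<Psi> * t) - 1) \<le> 2" using norm_triangle_ineq4[of "cis (\<Psi> * t)" 1] by simp
    then have "cmod (J \<Psi> t) \<le> 2 / \<bar>\<Psi>\<bar>"
      unfolding integral_cis[OF that] using that by (simp add: norm_divide norm_mult divide_right_mono)
    then have "\<bar>a\<bar> * cmod (J \<Psi> t) \<le> \<bar>a\<bar> * (2 / \<bar>\<Psi>\<bar>)" by (rule mult_left_mono) simp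
    then show ?thesis by (simp add: norm_mult abs_divide mult.commute[of "\<bar>a\<bar>" 2])
  qed
  moreover have "cmod (of_real (Ap / \<Psi>p + Am / \<Psi>m) * J \<Omega> t) = \<bar>Ap / \<Psi>p + Am / \<Psi>m\<bar> * cmod (J \<Omega> t)"
    unfolding norm_mult norm_of_real ..
  ultimately show ?thesis
    using small[OF \<Psi>(3), of "Ap / \<Psi>p"] small[OF \<Psi>(4), of "Am / \<Psi>m"] W by (simp add: mult_left_mono)
qed

end

text \<open>
  \<open>Bp/Pp\<close> and \<open>Bm/Pm\<close> are of order \<open>20 y\<^sup>2\<close> with opposite signs.  The leading terms cancel, but their sum
  still grows like \<open>80 y\<close>.
\<close>
lemma fifth_order_coefficient_asymptotics:
  fixes a b c e :: real
  defines "Pp \<equiv> \<lambda>y::real. - (10*y^4 + 40*y^3 + (80 + 6*a)*y^2 + (80 + 12*a)*y + b)"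
    and "Pm \<equiv> \<lambda>y::real. 10*y^4 - 40*y^3 + (80 + 6*a)*y^2 - (80 + 12*a)*y + c"
    and "Bp \<equiv> \<lambda>y::real. - 200 * y * (y + 2) * (y^2 + 2*y + 3) * (y^2 + 2*y + 7)"
    and "Bm \<equiv> \<lambda>y::real. - 200 * y * (y - 2) * (y^2 - 2*y + 3) * (y^2 - 2*y + 7)"
  shows "filterlim (\<lambda>y. \<bar>Bp y / Pp y + Bm y / Pm y\<bar>) at_top at_top"
    and "((\<lambda>y. Bp y / Pp y / (e - Pp y)) \<longlongrightarrow> 0) at_top"
    and "((\<lambda>y. Bm y / Pm y / (e - Pm y)) \<longlongrightarrow> 0) at_top"
    and "filterlim Pp at_bot at_top" and "filterlim Pm at_top at_top"
  unfolding Pp_def Pm_def Bp_def Bm_def by real_asymp+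

text \<open>
  The coefficients \<open>\<Gamma>\<close> grow like \<open>N\<close> although they share one bound.  The time \<open>t\<close> is chosen so small that \<open>cis (\<Omega> t) \<noteq> 1\<close>; here \<open>\<Omega> = - (240 + 24 d\<^sub>1)\<close>.
\<close>
lemma (in smooth_flow) exponent_less_three_halves:
  assumes "d1 \<ge> 0"
  shows "s < 3 / 2"
proof (rule ccontr)
  assume "\<not> s < 3 / 2"
  then have s: "3 / 2 \<le> s" by simp
  obtain \<eta> C d where \<eta>: "0 < \<eta>" "\<eta> \<le> T" and Cd: "0 < C" "0 < d"
    and close: "\<And>t b. t \<in> {0..\<eta>} \<Longrightarrow> norm b < d \<Longrightarrow> norm (S t b - U t b) \<le> C * norm b ^ 3"
    using uniform_cubic_bound[OF s] by blast
  define om where "om = 3 * dispersion d1 d2 1 + dispersion d1 d2 (-3)"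
  have om: "om = - (240 + 24 * d1)" by (simp add: om_def dispersion_def)
  then have om0: "om < 0" using assms by simp
  define t where "t = min \<eta> (1 / \<bar>om\<bar>)"
  have t0: "0 < t" "t \<le> \<eta>" "t \<le> 1 / \<bar>om\<bar>" using \<eta> om0 by (auto simp: t_def)
  then have t: "t \<in> {0..\<eta>}" "t \<in> {-T..T}" using \<eta> by auto
  have omt: "0 < \<bar>om\<bar> * t" "\<bar>om\<bar> * t \<le> 1"
    using t0 om0 mult_left_mono[OF t0(3), of "\<bar>om\<bar>"] by (auto simp: mult_neg_pos)
  define c0 where "c0 = cmod (LBINT \<tau>=0..t. cis (om * \<tau>))"
  have "c0 > 0"
  proof -
    have "0 < sin (\<bar>om\<bar> * t)" using omt pi_gt3 by (intro sin_gt_zero) auto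
    then have "sin (om * t) \<noteq> 0" using om0 by simp
    then have "cis (om * t) \<noteq> 1" by (auto simp: complex_eq_iff)
    then show ?thesis unfolding c0_def using om0 by (simp add: integral_cis)
  qed
  obtain M dd where "0 < dd" and all_jets: "\<forall>a v p. norm a \<le> 3 \<longrightarrow> norm v \<le> 1 \<longrightarrow> p \<in> {1, 3, 5} \<longrightarrow>
      (\<exists>c. \<forall>x. 0 < x \<longrightarrow> x < dd \<longrightarrow> \<bar>inner v (S t (x *\<^sub>R a)) - (\<Sum>k<p. c k * x ^ k)\<bar> \<le> M * x ^ p)"
    using C5_at_jets[OF C5[OF t(2)], of 3] by auto
  have jets: "\<exists>c. \<forall>x. 0 < x \<longrightarrow> x < dd \<longrightarrow> \<bar>inner v (S t (x *\<^sub>R a)) - (\<Sum>k<5. c k * x ^ k)\<bar> \<le> M * x ^ 5"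
    if "norm a \<le> 3" "norm v \<le> 1" for a v
    by (rule all_jets[rule_format, OF that]) simp
  define B where "B = M + (6480 * C * T + 1)"
  define W0 where "W0 = weight s 1 ^ 3 * weight s (-3)"
  have W0: "W0 > 0" by (simp add: W0_def)
  define Pp where "Pp y = - (10*y^4 + 40*y^3 + (80 + 6*d1)*y^2 + (80 + 12*d1)*y + (30 + 6*d1))" for y :: real
  define Pm where "Pm y = 10*y^4 - 40*y^3 + (80 + 6*d1)*y^2 - (80 + 12*d1)*y + (- 210 - 18*d1)" for y :: real
  define Bp where "Bp y = - 200 * y * (y + 2) * (y^2 + 2*y + 3) * (y^2 + 2*y + 7)" for y :: real
  define Bm where "Bm y = - 200 * y * (y - 2) * (y^2 - 2*y + 3) * (y^2 - 2*y + 7)" for y :: real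
  have bound: "W0 * (\<bar>Bp y / Pp y + Bm y / Pm y\<bar> * c0 - 2 * \<bar>Bp y / Pp y / (om - Pp y)\<bar> - 2 * \<bar>Bm y / Pm y / (om - Pm y)\<bar>) \<le> B"
    if n: "n \<ge> 10" and y: "y = real n" and nz: "Pp y \<noteq> 0" "Pm y \<noteq> 0" "om - Pp y \<noteq> 0" "om - Pm y \<noteq> 0" for n y
  proof -
    interpret P: probe d1 d2 s T r S "int n" \<eta> C d
      by unfold_locales (use s n \<eta> Cd close in auto)
    have e: "P.\<Psi>p = Pp y" "P.\<Psi>m = Pm y" "P.\<Omega> = om" "P.Ap = Bp y" "P.Am = Bm y" "P.W = W0"
      unfolding P.\<Psi>p_def P.\<Psi>m_def P.\<Omega>_def P.Ap_def P.Am_def P.W_def Pp_def Pm_def om_def Bp_def Bm_def W0_def dispersion_def y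
      by (simp_all add: power_numeral_reduce algebra_simps)
    have "cmod (P.\<Gamma> t) \<le> B"
      unfolding B_def using P.fifth_order_coefficient_bound[OF _ _ t(1) \<open>0 < dd\<close> jets] nz by (simp add: e)
    then show ?thesis
      using P.fifth_order_coefficient_lower_bound[of t] nz unfolding e c0_def by linarith
  qed
  note fc = fifth_order_coefficient_asymptotics[where a = d1]
  note asym = fc(1)[where b = "30 + 6*d1" and c = "- 210 - 18*d1", folded Pp_def Pm_def Bp_def Bm_def]
    fc(2)[where b = "30 + 6*d1" and e = om, folded Pp_def Bp_def]
    fc(3)[where c = "- 210 - 18*d1" and e = om, folded Pm_def Bm_def]
    fc(4)[where b = "30 + 6*d1", folded Pp_def] fc(5)[where c = "- 210 - 18*d1", folded Pm_def]
  have lim: "filterlim real at_top sequentially" by (rule filterlim_real_sequentially)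
  have "\<forall>\<^sub>F y in at_top. \<bar>Bp y / Pp y + Bm y / Pm y\<bar> > (B / W0 + 4) / c0"
    using asym(1) by (simp add: filterlim_at_top_dense)
  moreover have "\<forall>\<^sub>F y in at_top. \<bar>Bp y / Pp y / (om - Pp y)\<bar> < 1"
    using tendstoD[OF asym(2), of 1] by (simp add: dist_real_def)
  moreover have "\<forall>\<^sub>F y in at_top. \<bar>Bm y / Pm y / (om - Pm y)\<bar> < 1"
    using tendstoD[OF asym(3), of 1] by (simp add: dist_real_def)
  moreover have "\<forall>\<^sub>F y in at_top. Pp y < om"
    using asym(4) by (simp add: filterlim_at_bot_dense)
  moreover have "\<forall>\<^sub>F y in at_top. Pm y > 0"
    using asym(5) by (simp add: filterlim_at_top_dense)
  ultimately have "\<forall>\<^sub>F y in at_top. \<bar>Bp y / Pp y + Bm y / Pm y\<bar> > (B / W0 + 4) / c0 \<and> \<bar>Bp y / Pp y / (om - Pp y)\<bar> < 1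
     \<and> \<bar>Bm y / Pm y / (om - Pm y)\<bar> < 1 \<and> Pp y < om \<and> Pm y > 0"
    by eventually_elim auto
  then have "\<forall>\<^sub>F n in sequentially. \<bar>Bp (real n) / Pp (real n) + Bm (real n) / Pm (real n)\<bar> > (B / W0 + 4) / c0
     \<and> \<bar>Bp (real n) / Pp (real n) / (om - Pp (real n))\<bar> < 1 \<and> \<bar>Bm (real n) / Pm (real n) / (om - Pm (real n))\<bar> < 1
     \<and> Pp (real n) < om \<and> Pm (real n) > 0"
    using lim by (rule eventually_compose_filterlim)
  then have "\<forall>\<^sub>F n in sequentially. n \<ge> 10 \<and> \<bar>Bp (real n) / Pp (real n) + Bm (real n) / Pm (real n)\<bar> > (B / W0 + 4) / c0
     \<and> \<bar>Bp (real n) / Pp (real n) / (om - Pp (real n))\<bar> < 1 \<and> \<bar>Bm (real n) / Pm (real n) / (om - Pm (real n))\<bar> < 1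
     \<and> Pp (real n) < om \<and> Pm (real n) > 0"
    by (rule eventually_conj[OF eventually_ge_at_top])
  then obtain n :: nat where n: "n \<ge> 10" "\<bar>Bp (real n) / Pp (real n) + Bm (real n) / Pm (real n)\<bar> > (B / W0 + 4) / c0"
    "\<bar>Bp (real n) / Pp (real n) / (om - Pp (real n))\<bar> < 1" "\<bar>Bm (real n) / Pm (real n) / (om - Pm (real n))\<bar> < 1"
    "Pp (real n) < om" "Pm (real n) > 0"
    using eventually_happens' sequentially_bot by blast
  have "W0 * (\<bar>Bp (real n) / Pp (real n) + Bm (real n) / Pm (real n)\<bar> * c0
      - 2 * \<bar>Bp (real n) / Pp (real n) / (om - Pp (real n))\<bar> - 2 * \<bar>Bm (real n) / Pm (real n) / (om - Pm (real n))\<bar>) \<le> B"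
    by (rule bound[OF n(1) refl]) (use n(5,6) om0 in auto)
  then have "\<bar>Bp (real n) / Pp (real n) + Bm (real n) / Pm (real n)\<bar> * c0
      - 2 * \<bar>Bp (real n) / Pp (real n) / (om - Pp (real n))\<bar> - 2 * \<bar>Bm (real n) / Pm (real n) / (om - Pm (real n))\<bar> \<le> B / W0"
    using W0 by (simp add: pos_le_divide_eq mult.commute)
  moreover have "\<bar>Bp (real n) / Pp (real n) + Bm (real n) / Pm (real n)\<bar> * c0 > B / W0 + 4"
    using n(2) \<open>c0 > 0\<close> by (simp add: pos_divide_less_eq)
  ultimately show False using n(3,4) by linarith
qed

section \<open>Travelling waves with positive frequencies\<close>

definition triples :: "nat \<Rightarrow> (nat \<times> nat \<times> nat) set" where
  "triples m = {(i, j, k). 1 \<le> i \<and> 1 \<le> j \<and> 1 \<le> k \<and> i + j + k = m}"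

definition quintuples :: "nat \<Rightarrow> (nat \<times> nat \<times> nat \<times> nat \<times> nat) set" where
  "quintuples m = {(i, j, k, l, p). 1 \<le> i \<and> 1 \<le> j \<and> 1 \<le> k \<and> 1 \<le> l \<and> 1 \<le> p \<and> i + j + k + l + p = m}"

lemma finite_triples: "finite (triples m)" and card_triples: "card (triples m) \<le> m ^ 2"
proof -
  let ?f = "\<lambda>(i, j, k::nat). (i::nat, j::nat)"
  have inj: "inj_on ?f (triples m)" by (auto simp: inj_on_def triples_def)
  have sub: "?f ` triples m \<subseteq> {1..m} \<times> {1..m}" by (auto simp: triples_def)
  show "finite (triples m)"
    using finite_imageD[OF finite_subset[OF sub] inj] by simp
  show "card (triples m) \<le> m ^ 2"
    using card_mono[OF _ sub] card_image[OF inj] by (simp add: power2_eq_square)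
qed

lemma finite_quintuples: "finite (quintuples m)" and card_quintuples: "card (quintuples m) \<le> m ^ 4"
proof -
  let ?f = "\<lambda>(i, j, k, l, p::nat). (i::nat, j::nat, k::nat, l::nat)"
  have inj: "inj_on ?f (quintuples m)" by (auto simp: inj_on_def quintuples_def)
  have sub: "?f ` quintuples m \<subseteq> {1..m} \<times> {1..m} \<times> {1..m} \<times> {1..m}" by (auto simp: quintuples_def)
  show "finite (quintuples m)"
    using finite_imageD[OF finite_subset[OF sub] inj] by simp
  show "card (quintuples m) \<le> m ^ 4"
    using card_mono[OF _ sub] card_image[OF inj] by (simp add: power4_eq_xxxx mult.assoc)
qed

text \<open>
  The nonlinearity without its resonant term and without a factor \<open>\<i>\<close>, at the frequency \<open>m N\<close>, for a real amplitude \<open>c i\<close> at each frequency \<open>i N\<close>,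
  \<open>i \<ge> 1\<close>.  Only positive frequencies occur, so the sums are finite, and \<open>forcing N c m\<close> only involves the amplitudes below \<open>m\<close>.
\<close>
definition forcing :: "nat \<Rightarrow> (nat \<Rightarrow> real) \<Rightarrow> nat \<Rightarrow> real" where
  "forcing N c m =
     10 * (m * N) * (\<Sum>(i, j, k)\<in>triples m. (real (k * N) ^ 2 + real (j * N) * real (k * N)) * (c i * c j * c k))
     + 6 * (m * N) * (\<Sum>(i, j, k, l, p)\<in>quintuples m. c i * c j * c k * c l * c p)"

lemma forcing_cong: "(\<And>i. i < m \<Longrightarrow> c i = c' i) \<Longrightarrow> forcing N c m = forcing N c' m"
proof -
  assume eq: "\<And>i. i < m \<Longrightarrow> c i = c' i"
  have "(\<Sum>(i, j, k)\<in>triples m. (real (k * N) ^ 2 + real (j * N) * real (k * N)) * (c i * c j * c k))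
      = (\<Sum>(i, j, k)\<in>triples m. (real (k * N) ^ 2 + real (j * N) * real (k * N)) * (c' i * c' j * c' k))"
    by (rule sum.cong[OF refl]) (auto simp: triples_def eq)
  moreover have "(\<Sum>(i, j, k, l, p)\<in>quintuples m. c i * c j * c k * c l * c p)
      = (\<Sum>(i, j, k, l, p)\<in>quintuples m. c' i * c' j * c' k * c' l * c' p)"
    by (rule sum.cong[OF refl]) (auto simp: quintuples_def eq)
  ultimately show ?thesis by (simp add: forcing_def)
qed

lemma forcing_small: "m \<le> 2 \<Longrightarrow> forcing N c m = 0"
proof -
  assume "m \<le> 2"
  then have "triples m = {}" "quintuples m = {}" by (auto simp: triples_def quintuples_def)
  then show ?thesis by (simp add: forcing_def)
qed

lemma forcing_bound:
  assumes X: "0 < X" and N: "1 \<le> N" and c: "\<And>i. i < m \<Longrightarrow> \<bar>c i\<bar> \<le> X ^ i"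
  shows "\<bar>forcing N c m\<bar> \<le> 16 * real N ^ 3 * real m ^ 5 * X ^ m"
proof -
  have 1: "\<bar>\<Sum>(i, j, k)\<in>triples m. (real (k * N) ^ 2 + real (j * N) * real (k * N)) * (c i * c j * c k)\<bar>
      \<le> real (card (triples m)) * (real m ^ 2 * real N ^ 2 * X ^ m)"
  proof (rule order_trans[OF sum_abs], rule sum_bounded_above, clarify)
    fix i j k assume "(i, j, k) \<in> triples m"
    then have t: "1 \<le> i" "1 \<le> j" "1 \<le> k" "i + j + k = m" by (auto simp: triples_def)
    have "\<bar>c i * c j * c k\<bar> \<le> X ^ i * X ^ j * X ^ k"
      unfolding abs_mult using t X by (intro mult_mono c) auto
    also have "\<dots> = X ^ m" using t by (simp flip: power_add)
    finally have 1: "\<bar>c i * c j * c k\<bar> \<le> X ^ m" .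
    have "k * (k + j) \<le> m * m" using t by (intro mult_mono) auto
    then have "real (k * (k + j)) \<le> real (m * m)" by (rule of_nat_mono)
    then have "real (k * (k + j)) * (real N)\<^sup>2 \<le> real (m * m) * (real N)\<^sup>2" by (rule mult_right_mono) simp
    then have 2: "real (k * N) ^ 2 + real (j * N) * real (k * N) \<le> real m ^ 2 * real N ^ 2"
      by (simp add: power2_eq_square algebra_simps)
    show "\<bar>(real (k * N) ^ 2 + real (j * N) * real (k * N)) * (c i * c j * c k)\<bar> \<le> real m ^ 2 * real N ^ 2 * X ^ m"
      unfolding abs_mult[of "real (k * N) ^ 2 + real (j * N) * real (k * N)"] using 1 2 by (intro mult_mono) auto
  qed
  have 2: "\<bar>\<Sum>(i, j, k, l, p)\<in>quintuples m. c i * c j * c k * c l * c p\<bar> \<le> real (card (quintuples m)) * X ^ m"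
  proof (rule order_trans[OF sum_abs], rule sum_bounded_above, clarify)
    fix i j k l p assume "(i, j, k, l, p) \<in> quintuples m"
    then have t: "1 \<le> i" "1 \<le> j" "1 \<le> k" "1 \<le> l" "1 \<le> p" "i + j + k + l + p = m" by (auto simp: quintuples_def)
    have "\<bar>c i * c j * c k * c l * c p\<bar> \<le> X ^ i * X ^ j * X ^ k * X ^ l * X ^ p"
      unfolding abs_mult using t X by (intro mult_mono c) auto
    also have "\<dots> = X ^ m" using t by (simp flip: power_add)
    finally show "\<bar>c i * c j * c k * c l * c p\<bar> \<le> X ^ m" .
  qed
  have c3: "real (card (triples m)) \<le> real m ^ 2" using card_triples[of m] by (metis of_nat_le_iff of_nat_power)
  have c5: "real (card (quintuples m)) \<le> real m ^ 4" using card_quintuples[of m] by (metis of_nat_le_iff of_nat_power)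
  have N3: "real N \<le> real N ^ 3" using N by (intro self_le_power) auto
  have "\<bar>forcing N c m\<bar> \<le> 10 * (real m * real N) * (real m ^ 2 * (real m ^ 2 * real N ^ 2 * X ^ m)) + 6 * (real m * real N) * (real m ^ 4 * X ^ m)"
    unfolding forcing_def
    apply (rule order_trans[OF abs_triangle_ineq])
    apply (rule add_mono)
     apply (subst abs_mult, rule mult_mono, simp, rule order_trans[OF 1], intro mult_right_mono c3, use X in simp, simp, simp)
    apply (subst abs_mult, rule mult_mono, simp, rule order_trans[OF 2], intro mult_right_mono c5, use X in simp, simp, simp)
    done
  also have "\<dots> = 10 * real N ^ 3 * (real m ^ 5 * X ^ m) + 6 * real N * (real m ^ 5 * X ^ m)"
    by (simp add: power_numeral_reduce algebra_simps)
  also have "\<dots> \<le> 10 * real N ^ 3 * (real m ^ 5 * X ^ m) + 6 * real N ^ 3 * (real m ^ 5 * X ^ m)"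
    using N3 X by (intro add_mono mult_right_mono mult_left_mono) auto
  finally show ?thesis by (simp add: mult_ac)
qed

text \<open>
  The diagonal term makes the equation for a single amplitude cubic.  For small \<open>q\<close> the linear part
  dominates on \<open>[-b, b]\<close> with \<open>b = 2 |q| / (N\<^sup>5 m\<^sup>5)\<close>, and the intermediate value theorem applies.
\<close>
lemma amplitude_exists:
  fixes D q :: real
  assumes m: "2 \<le> m" and N: "8 \<le> N" and D: "real N ^ 5 * (real m ^ 5 - real m) \<le> D"
    and q: "\<bar>q\<bar> \<le> real N ^ 5 * real m ^ 5 / 2"
  shows "\<exists>y. \<bar>y\<bar> \<le> 2 * \<bar>q\<bar> / (real N ^ 5 * real m ^ 5) \<and> D * y - 20 * real (m * N) ^ 3 * y ^ 3 = q"
proof -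
  define K where "K = real N ^ 5 * real m ^ 5"
  define b where "b = 2 * \<bar>q\<bar> / K"
  have K: "K > 0" using m N by (simp add: K_def)
  have b: "0 \<le> b" "b \<le> 1" using K q by (auto simp: b_def K_def)
  define h where "h y = D * y - 20 * real (m * N) ^ 3 * y ^ 3" for y
  have "2 ^ 4 \<le> real m ^ 4" using m by (intro power_mono) auto
  then have m5: "16 * real m \<le> real m ^ 5" using mult_right_mono[of 16 "real m ^ 4" "real m"] by (simp add: power_numeral_reduce)
  have mN: "256 \<le> (real m * real N)\<^sup>2"
  proof -
    have "(2 * 8)\<^sup>2 \<le> (real m * real N)\<^sup>2" using m N by (intro power_mono mult_mono) auto
    then show ?thesis by simp
  qed
  have "real N ^ 5 * (15 / 16 * real m ^ 5) \<le> real N ^ 5 * (real m ^ 5 - real m)"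
    using m5 by (intro mult_left_mono) auto
  \<comment> \<open>\<open>m\<^sup>5 - m \<ge> 15/16 m\<^sup>5\<close> because of \<open>m \<ge> 2\<close>.\<close>
  then have D': "15 / 16 * K \<le> D" using D by (simp add: K_def)
  have "256 * real (m * N) ^ 3 \<le> (real m * real N)\<^sup>2 * real (m * N) ^ 3"
    using mN by (intro mult_right_mono) auto
  also have "\<dots> = K" by (simp add: K_def power_mult_distrib power_numeral_reduce)
  finally have n3: "20 * real (m * N) ^ 3 \<le> 5 / 64 * K" by simp
  have hb: "\<bar>q\<bar> \<le> h b"
  proof -
    have b3: "b ^ 3 \<le> b" using b power_decreasing[of 1 3 b] by simp
    have "20 * real (m * N) ^ 3 * b ^ 3 \<le> 5 / 64 * K * b"
      by (rule mult_mono[OF n3 b3]) (use K b in auto)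
    moreover have "15 / 16 * K * b \<le> D * b" using D' b by (intro mult_right_mono)
    moreover have "K * b = 2 * \<bar>q\<bar>" using K by (simp add: b_def)
    ultimately show ?thesis unfolding h_def by linarith
  qed
  have "h (- b) = - h b" by (simp add: h_def power3_eq_cube)
  then have "\<exists>y\<ge>-b. y \<le> b \<and> h y = q"
    using hb b by (intro IVT') (auto simp: h_def intro!: continuous_intros)
  then obtain y where "-b \<le> y" "y \<le> b" "h y = q" by blast
  then have "\<bar>y\<bar> \<le> b" by linarith
  with \<open>h y = q\<close> show ?thesis by (auto simp: h_def b_def K_def)
qed

text \<open>
  A travelling wave \<open>\<Sum>m. c\<^sub>m cis (m (N \<theta> + \<omega> t))\<close> with positive frequencies.  Its first amplitude is \<open>X\<close>, and
  \<open>\<omega>\<close> is the frequency of the mode \<open>N\<close>, corrected by the resonant term.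
\<close>
locale wave =
  fixes d1 d2 s x :: real and N :: nat
  assumes d1: "0 \<le> d1" and s: "0 < s" and x: "0 < x" "x \<le> 1 / 2" and N: "8 \<le> N"
begin

abbreviation "L \<equiv> dispersion d1 d2"

definition X :: real where "X = x * weight s (int N)"
definition \<omega> :: real where "\<omega> = L (int N) - 20 * real N ^ 3 * X\<^sup>2"

lemma X: "0 < X" "X \<le> x" "X \<le> 1"
proof -
  show "0 < X" using x by (simp add: X_def)
  show "X \<le> x" using x weight_le_1[of s "int N"] s by (simp add: X_def mult_left_le)
  then show "X \<le> 1" using x by simp
qed

text \<open>
  All multiples of the fundamental mode are far from resonance: the detuning is of fifth order in \<open>m N\<close> for \<open>m \<ge> 2\<close>.
\<close>
lemma detuning: "L (int (m * N)) - m * \<omega> = real N ^ 5 * (real m ^ 5 - real m) + (d1 * real N ^ 3 * (real m ^ 3 - real m) + 20 * m * real N ^ 3 * X\<^sup>2)"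
  by (simp add: dispersion_def \<omega>_def power_mult_distrib algebra_simps)

text \<open>
  The amplitudes are determined one after the other.  The forcing loses three powers of \<open>N\<close>, division by the detuning
  gains five, so for \<open>N \<ge> 8\<close> the bounds \<open>|c m| \<le> X\<^sup>m\<close> reproduce themselves.
\<close>
lemma amplitudes_exist:
  "\<exists>c. c 0 = 0 \<and> c 1 = X \<and> c 2 = 0 \<and> (\<forall>m. \<bar>c m\<bar> \<le> X ^ m) \<and>
     (\<forall>m. (L (int (m * N)) - m * \<omega>) * c m - 20 * real (m * N) ^ 3 * c m ^ 3 = - forcing N c m)"
proof -
  define P where "P c m y \<longleftrightarrow> (m = 0 \<longrightarrow> y = 0) \<and> (m = 1 \<longrightarrow> y = X) \<and> (m = 2 \<longrightarrow> y = 0) \<and> \<bar>y\<bar> \<le> X ^ m \<and>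
     (L (int (m * N)) - m * \<omega>) * y - 20 * real (m * N) ^ 3 * y ^ 3 = - forcing N c m" for c m y
  have "\<exists>c. \<forall>m. P c m (c m)"
  proof (rule dependent_wf_choice[OF wf_less])
    fix f g :: "nat \<Rightarrow> real" and m y
    assume "\<And>z. (z, m) \<in> {(x, y). x < y} \<Longrightarrow> f z = g z"
    then have "forcing N f m = forcing N g m" by (intro forcing_cong) auto
    then show "P f m y = P g m y" by (simp add: P_def)
  next
    fix m and c :: "nat \<Rightarrow> real"
    assume "\<And>y. (y, m) \<in> {(x, y). x < y} \<Longrightarrow> P c y (c y)"
    then have c: "\<And>i. i < m \<Longrightarrow> \<bar>c i\<bar> \<le> X ^ i" by (auto simp: P_def)
    consider "m = 0" | "m = 1" | "2 \<le> m" by linarith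
    then show "\<exists>y. P c m y"
    proof cases
      case 1
      then show ?thesis by (auto simp: P_def forcing_small)
    next
      case 2
      then have "P c m X" using X by (simp add: P_def forcing_small \<omega>_def power3_eq_cube power2_eq_square)
      then show ?thesis by blast
    next
      case 3
      have "real m \<le> real m ^ 3" using 3 by (intro self_le_power) auto
      then have D: "real N ^ 5 * (real m ^ 5 - real m) \<le> L (int (m * N)) - m * \<omega>"
        unfolding detuning using d1 by simp
      have fb: "\<bar>- forcing N c m\<bar> \<le> 16 * real N ^ 3 * real m ^ 5 * X ^ m"
        using forcing_bound[OF X(1) _ c] N by simp
      have "8 ^ 2 \<le> real N ^ 2" using N by (intro power_mono) auto
      then have "real N ^ 3 * 64 \<le> real N ^ 3 * real N ^ 2" by (intro mult_left_mono) auto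
      then have N35: "64 * real N ^ 3 \<le> real N ^ 5" by (simp flip: power_add)
      have Xm: "0 \<le> X ^ m" "X ^ m \<le> 1" using X by (auto intro: power_le_one)
      have "16 * real N ^ 3 * real m ^ 5 * X ^ m \<le> (real N ^ 5 / 4) * real m ^ 5 * X ^ m"
        using N35 Xm by (intro mult_right_mono) auto
      then have fb': "\<bar>- forcing N c m\<bar> \<le> (real N ^ 5 * real m ^ 5) * (X ^ m / 4)" using fb by simp
      also have "\<dots> \<le> (real N ^ 5 * real m ^ 5) * (1 / 2)" using Xm by (intro mult_left_mono) auto
      finally have "\<bar>- forcing N c m\<bar> \<le> real N ^ 5 * real m ^ 5 / 2" by simp
      from amplitude_exists[OF 3 N D this] obtain y where y: "\<bar>y\<bar> \<le> 2 * \<bar>- forcing N c m\<bar> / (real N ^ 5 * real m ^ 5)"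
        and eq: "(L (int (m * N)) - m * \<omega>) * y - 20 * real (m * N) ^ 3 * y ^ 3 = - forcing N c m" by blast
      have "real N ^ 5 * real m ^ 5 > 0" using 3 N by simp
      then have "2 * \<bar>- forcing N c m\<bar> / (real N ^ 5 * real m ^ 5) \<le> X ^ m"
        using fb' Xm by (subst pos_divide_le_eq) (auto simp: mult.commute intro: order_trans)
      then have "\<bar>y\<bar> \<le> X ^ m" using y by linarith
      moreover have "m = 2 \<Longrightarrow> y = 0" using y by (simp add: forcing_small)
      ultimately have "P c m y" using 3 eq by (simp add: P_def)
      then show ?thesis by blast
    qed
  qed
  then obtain c where c: "\<And>m. P c m (c m)" by blast
  show ?thesis
    by (rule exI[of _ c]) (use c in \<open>auto simp: P_def\<close>)
qed

end

lemma geometric_decay_summable: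
  "summable (\<lambda>m. ((1/2) ^ m * real m powr s) ^ 2)"
  "summable (\<lambda>m. ((1/2) ^ m * real m powr s * real m) ^ 2)"
proof -
  have g: "summable (\<lambda>m. norm ((1/2 :: real) ^ m))" by simp
  have "(\<lambda>m. ((1/2) ^ m * real m powr s) ^ 2) \<in> O(\<lambda>m. (1/2) ^ m)" by real_asymp
  then show "summable (\<lambda>m. ((1/2) ^ m * real m powr s) ^ 2)" by (rule summable_comparison_test_bigo[OF g])
  have "(\<lambda>m. ((1/2) ^ m * real m powr s * real m) ^ 2) \<in> O(\<lambda>m. (1/2) ^ m)" by real_asymp
  then show "summable (\<lambda>m. ((1/2) ^ m * real m powr s * real m) ^ 2)" by (rule summable_comparison_test_bigo[OF g])
qed

lemma cmod_cis_diff_le: "cmod (cis a - cis b) \<le> \<bar>a - b\<bar>"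
proof -
  have "cis a - cis b = cis b * (cis (a - b) - 1)" by (simp add: right_diff_distrib cis_mult)
  then have "cmod (cis a - cis b) = cmod (cis (a - b) - 1)" by (simp add: norm_mult)
  moreover have "(cmod (cis u - 1))\<^sup>2 \<le> u\<^sup>2" for u :: real
  proof -
    have "(cmod (cis u - 1))\<^sup>2 = (cos u - 1)\<^sup>2 + (sin u)\<^sup>2" by (simp add: cmod_power2)
    also have "\<dots> = 2 - 2 * cos u" using sin_cos_squared_add[of u] by (simp add: power2_diff)
    also have "\<dots> = 4 * (sin (u / 2))\<^sup>2" using cos_double_sin[of "u / 2"] by simp
    also have "\<dots> \<le> 4 * \<bar>u / 2\<bar>\<^sup>2" using abs_sin_x_le_abs_x[of "u / 2"] by (simp only: power2_abs[symmetric, of "sin (u / 2)"]) (intro mult_left_mono power_mono, auto)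
    finally show ?thesis by (simp add: power_divide)
  qed
  then have "cmod (cis u - 1) \<le> \<bar>u\<bar>" for u :: real
    by (metis abs_ge_zero power2_abs power2_le_imp_le)
  ultimately show ?thesis by metis
qed

locale wave_solution = wave +
  fixes c :: "nat \<Rightarrow> real"
  assumes c0: "c 0 = 0" and c1: "c 1 = X" and c2: "c 2 = 0" and cX: "\<And>m. \<bar>c m\<bar> \<le> X ^ m"
    and amplitude_eq: "\<And>m. (L (int (m * N)) - m * \<omega>) * c m - 20 * real (m * N) ^ 3 * c m ^ 3 = - forcing N c m"
begin

definition \<psi> :: "nat \<Rightarrow> int" where "\<psi> m = int (m * N)"

lemma N0: "N > 0" using N by simp

lemma inj_\<psi>: "inj \<psi>"
  using N0 by (auto simp: inj_def \<psi>_def)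

definition profile :: "real \<Rightarrow> int \<Rightarrow> complex" where
  "profile t k = (if k \<in> range \<psi> then of_real (c (inv \<psi> k)) * cis (real (inv \<psi> k) * \<omega> * t) else 0)"

lemma profile_\<psi>: "profile t (\<psi> m) = of_real (c m) * cis (real m * \<omega> * t)"
  by (simp add: profile_def inv_f_f[OF inj_\<psi>])

lemma profile_off: "k \<notin> range \<psi> \<Longrightarrow> profile t k = 0"
  by (simp add: profile_def)

lemma profile_nonzero:
  assumes "profile t k \<noteq> 0"
  obtains m where "1 \<le> m" "k = \<psi> m"
proof -
  obtain m where m: "k = \<psi> m" using assms profile_off by blast
  then have "c m \<noteq> 0" using assms by (auto simp: profile_\<psi>)
  then have "m \<noteq> 0" using c0 by metis
  then show thesis by (intro that[OF _ m]) simp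
qed

lemma weight_dilation: "1 \<le> m \<Longrightarrow> weight s (int N) \<le> real m powr s * weight s (\<psi> m)"
proof -
  assume m: "1 \<le> m"
  have "(1::real) \<le> (real m)\<^sup>2" using m by simp
  then have le: "1 + (real_of_int (\<psi> m))\<^sup>2 \<le> (real m)\<^sup>2 * (1 + (real_of_int (int N))\<^sup>2)"
    by (simp add: \<psi>_def power_mult_distrib distrib_left)
  have "(real m)\<^sup>2 powr (- s / 2) * weight s (int N) \<le> weight s (\<psi> m)"
    unfolding weight_def powr_mult[symmetric]
    by (rule powr_mono2') (use s le weight_pos[of "\<psi> m"] in auto)
  moreover have "(real m)\<^sup>2 powr (- s / 2) = real m powr (- s)"
    using m by (simp add: powr_powr flip: powr_numeral)
  ultimately have "real m powr s * (real m powr (- s) * weight s (int N)) \<le> real m powr s * weight s (\<psi> m)"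
    by (intro mult_left_mono) auto
  then show ?thesis using m by (simp add: mult.assoc[symmetric] flip: powr_add)
qed

lemma amplitude_decay: "\<bar>c m\<bar> \<le> x ^ m * real m powr s * weight s (\<psi> m)"
proof (cases "m = 0")
  case True then show ?thesis by (simp add: c0)
next
  case False
  then have m: "1 \<le> m" by simp
  have "weight s (int N) ^ m \<le> weight s (int N) ^ 1"
    using m weight_le_1[of s "int N"] s by (intro power_decreasing) auto
  then have "x ^ m * weight s (int N) ^ m \<le> x ^ m * (real m powr s * weight s (\<psi> m))"
    using weight_dilation[OF m] x by (intro mult_left_mono) auto
  then show ?thesis using cX[of m] by (simp add: X_def power_mult_distrib mult.assoc)
qed

lemma range_sum_bound:
  assumes off: "\<And>k. k \<notin> range \<psi> \<Longrightarrow> g k = 0" and on: "\<And>m. cmod (g (\<psi> m)) \<le> b m"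
    and b: "summable (\<lambda>m. (b m)\<^sup>2)" and F: "finite F"
  shows "(\<Sum>k\<in>F. (cmod (g k))\<^sup>2) \<le> (\<Sum>m. (b m)\<^sup>2)"
proof -
  have "(\<Sum>k\<in>F. (cmod (g k))\<^sup>2) = (\<Sum>k\<in>F \<inter> range \<psi>. (cmod (g k))\<^sup>2)"
    using F off by (intro sum.mono_neutral_right) auto
  also have "F \<inter> range \<psi> = \<psi> ` (\<psi> -` F)" by auto
  also have "(\<Sum>k\<in>\<psi> ` (\<psi> -` F). (cmod (g k))\<^sup>2) = (\<Sum>m\<in>\<psi> -` F. (cmod (g (\<psi> m)))\<^sup>2)"
    by (subst sum.reindex) (auto intro: inj_on_subset[OF inj_\<psi>])
  also have "\<dots> \<le> (\<Sum>m\<in>\<psi> -` F. (b m)\<^sup>2)"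
    by (intro sum_mono power_mono on) auto
  also have "\<dots> \<le> (\<Sum>m. (b m)\<^sup>2)"
    using finite_vimageI[OF F inj_\<psi>] by (intro sum_le_suminf b) auto
  finally show ?thesis .
qed

definition orbit :: "real \<Rightarrow> ell2" where
  "orbit t = Abs_ell2 (\<lambda>k. profile t k / of_real (weight s k))"

definition Q :: real where "Q = (\<Sum>m. ((1/2) ^ m * real m powr s)\<^sup>2)"
definition Q' :: real where "Q' = (\<Sum>m. ((1/2) ^ m * real m powr s * real m)\<^sup>2)"

lemma Q_nonneg: "0 \<le> Q" "0 \<le> Q'"
  unfolding Q_def Q'_def by (intro suminf_nonneg geometric_decay_summable; simp)+

lemma coefficient_bound: "\<bar>c m\<bar> / weight s (\<psi> m) \<le> x ^ m * real m powr s"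
  using amplitude_decay[of m] by (simp add: pos_divide_le_eq)

lemma power_x: "x ^ m \<le> (1/2) ^ m"
  using x by (intro power_mono) auto

lemma cmod_profile: "cmod (profile t (\<psi> m) / of_real (weight s (\<psi> m))) = \<bar>c m\<bar> / weight s (\<psi> m)"
  by (simp add: profile_\<psi> norm_mult norm_divide)

lemma coord_orbit: "coord (orbit t) k = profile t k / of_real (weight s k)"
proof -
  let ?g = "\<lambda>k. profile t k / of_real (weight s k)"
  have "(\<Sum>k\<in>F. (cmod (?g k))\<^sup>2) \<le> Q" if "finite F" for F
    unfolding Q_def
  proof (rule range_sum_bound[OF _ _ geometric_decay_summable(1) that])
    show "cmod (?g (\<psi> m)) \<le> (1/2) ^ m * real m powr s" for m
      unfolding cmod_profile using coefficient_bound[of m] mult_right_mono[OF power_x[of m], of "real m powr s"] by simp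
  qed (simp add: profile_off)
  then have "(\<lambda>k. (cmod (?g k))\<^sup>2) summable_on UNIV"
    by (intro nonneg_bounded_partial_sums_imp_summable_on[where C = Q])
       (auto intro!: eventually_finite_subsets_at_top_weakI)
  then show ?thesis
    by (simp add: orbit_def Abs_ell2_inverse)
qed

lemma fourier_orbit: "fourier s (orbit t) = profile t"
  by (rule ext) (simp add: fourier_weight coord_orbit)

lemma continuous_orbit: "continuous_on A orbit"
proof -
  have lip: "norm (orbit t - orbit t') \<le> (\<bar>\<omega>\<bar> * sqrt Q') * \<bar>t - t'\<bar>" for t t'
  proof (rule norm_le_if_partial_sums_le)
    fix F :: "int set" assume F: "finite F"
    define u where "u = \<bar>\<omega>\<bar> * \<bar>t - t'\<bar>"
    have "(\<Sum>k\<in>F. (cmod (coord (orbit t - orbit t') k))\<^sup>2) \<le> (\<Sum>m. (u * ((1/2) ^ m * real m powr s * real m))\<^sup>2)"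
    proof (rule range_sum_bound[OF _ _ _ F])
      fix m
      have "coord (orbit t - orbit t') (\<psi> m) = of_real (c m / weight s (\<psi> m)) * (cis (real m * \<omega> * t) - cis (real m * \<omega> * t'))"
        by (simp add: coord_rep coord_orbit profile_\<psi> field_simps)
      then have "cmod (coord (orbit t - orbit t') (\<psi> m)) = \<bar>c m\<bar> / weight s (\<psi> m) * cmod (cis (real m * \<omega> * t) - cis (real m * \<omega> * t'))"
        by (simp add: norm_mult norm_divide)
      also have "\<dots> \<le> (x ^ m * real m powr s) * \<bar>real m * \<omega> * t - real m * \<omega> * t'\<bar>"
        using x by (intro mult_mono coefficient_bound cmod_cis_diff_le) auto
      also have "\<dots> = (x ^ m * real m powr s) * (real m * u)"
        by (simp add: u_def abs_mult flip: right_diff_distrib)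
      also have "\<dots> \<le> ((1/2) ^ m * real m powr s) * (real m * u)"
        using power_x[of m] by (intro mult_right_mono) (auto simp: u_def)
      finally show "cmod (coord (orbit t - orbit t') (\<psi> m)) \<le> u * ((1/2) ^ m * real m powr s * real m)"
        by (simp add: mult_ac)
    qed (use summable_mult[OF geometric_decay_summable(2), of "u\<^sup>2" s] in \<open>simp_all add: power_mult_distrib coord_rep coord_orbit profile_off\<close>)
    also have "\<dots> = u\<^sup>2 * Q'"
      unfolding Q'_def power_mult_distrib[of u] by (rule suminf_mult[OF geometric_decay_summable(2)])
    finally show "(\<Sum>k\<in>F. (cmod (coord (orbit t - orbit t') k))\<^sup>2) \<le> ((\<bar>\<omega>\<bar> * sqrt Q') * \<bar>t - t'\<bar>)\<^sup>2"
      using Q_nonneg by (simp add: u_def power_mult_distrib mult_ac)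
  qed (use Q_nonneg in auto)
  have "(\<bar>\<omega>\<bar> * sqrt Q')-lipschitz_on A orbit"
    by (rule lipschitz_onI) (use lip Q_nonneg in \<open>auto simp: dist_ell2_def dist_real_def\<close>)
  then show ?thesis by (rule lipschitz_on_continuous_on)
qed

text \<open>
  The wave starts at \<open>x\<close> times a basis vector, up to third order in \<open>x\<close>; for this, \<open>c 2 = 0\<close> matters.  The constant does not depend on \<open>N\<close>.
\<close>
lemma orbit_near_single: "norm (orbit 0 - x *\<^sub>R single (int N) 1) \<le> 8 * sqrt Q * x ^ 3"
proof (rule norm_le_if_partial_sums_le)
  fix F :: "int set" assume F: "finite F"
  have Nr: "int N = \<psi> 1" by (simp add: \<psi>_def)
  have "(\<Sum>k\<in>F. (cmod (coord (orbit 0 - x *\<^sub>R single (int N) 1) k))\<^sup>2) \<le> (\<Sum>m. (8 * x ^ 3 * ((1/2) ^ m * real m powr s))\<^sup>2)"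
  proof (rule range_sum_bound[OF _ _ _ F])
    fix m
    have co: "coord (orbit 0 - x *\<^sub>R single (int N) 1) (\<psi> m) = of_real (c m / weight s (\<psi> m)) - (if m = 1 then of_real x else 0)"
      unfolding Nr by (simp add: coord_rep coord_orbit profile_\<psi> single.rep_eq inj_eq[OF inj_\<psi>] scaleR_conv_of_real)
    consider "m = 0" | "m = 1" | "m = 2" | "3 \<le> m" by linarith
    then show "cmod (coord (orbit 0 - x *\<^sub>R single (int N) 1) (\<psi> m)) \<le> 8 * x ^ 3 * ((1/2) ^ m * real m powr s)"
    proof cases
      case 4
      have "x ^ m = x ^ 3 * x ^ (m - 3)" using 4 by (simp flip: power_add)
      also have "\<dots> \<le> x ^ 3 * (1/2) ^ (m - 3)" using x power_x[of "m - 3"] by (intro mult_left_mono) auto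
      also have "(1/2 :: real) ^ (m - 3) = 8 * (1/2) ^ m" using 4 by (simp add: power_diff power_numeral_reduce)
      finally have "x ^ m * real m powr s \<le> (8 * x ^ 3 * (1/2) ^ m) * real m powr s" by (intro mult_right_mono) auto
      moreover have "cmod (coord (orbit 0 - x *\<^sub>R single (int N) 1) (\<psi> m)) = \<bar>c m\<bar> / weight s (\<psi> m)"
        unfolding co using 4 by (simp add: norm_divide)
      ultimately show ?thesis using coefficient_bound[of m] by (simp add: mult_ac)
    next
      case 2
      have "c 1 / weight s (\<psi> 1) = x" unfolding c1 X_def Nr[symmetric] by simp
      then have "coord (orbit 0 - x *\<^sub>R single (int N) 1) (\<psi> m) = 0"
        unfolding co using 2 by (simp del: of_real_divide)
      then show ?thesis using x by simp
    next
      case 1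
      have "coord (orbit 0 - x *\<^sub>R single (int N) 1) (\<psi> m) = 0"
        unfolding co using 1 by (simp add: c0)
      then show ?thesis using x by simp
    next
      case 3
      have "coord (orbit 0 - x *\<^sub>R single (int N) 1) (\<psi> m) = 0"
        unfolding co using 3 by (simp add: c2)
      then show ?thesis using x by simp
    qed
  next
    show "coord (orbit 0 - x *\<^sub>R single (int N) 1) k = 0" if "k \<notin> range \<psi>" for k
      using that unfolding Nr by (auto simp: coord_rep coord_orbit profile_off single.rep_eq)
    show "summable (\<lambda>m. (8 * x ^ 3 * ((1/2) ^ m * real m powr s))\<^sup>2)"
      unfolding power_mult_distrib[of "8 * x ^ 3"] by (rule summable_mult[OF geometric_decay_summable(1)])
  qed
  also have "\<dots> = (8 * x ^ 3)\<^sup>2 * Q"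
    unfolding Q_def power_mult_distrib[of "8 * x ^ 3"] by (rule suminf_mult[OF geometric_decay_summable(1)])
  finally show "(\<Sum>k\<in>F. (cmod (coord (orbit 0 - x *\<^sub>R single (int N) 1) k))\<^sup>2) \<le> (8 * sqrt Q * x ^ 3)\<^sup>2"
    using Q_nonneg by (simp add: power_mult_distrib mult_ac)
qed (use Q_nonneg x in auto)

text \<open>
  Sums of positive multiples of \<open>N\<close> do not vanish and so satisfy the conditions in \<open>N3 n\<close> and \<open>N5 n\<close>.  Therefore
  the infinite sums reduce to those over \<open>triples\<close> and \<open>quintuples\<close>, which are the index sets \<open>I\<close> in the applications.
\<close>
lemma infsum_over_multiples:
  fixes f :: "'b \<Rightarrow> complex" and A :: "int \<Rightarrow> 'b set"
  assumes fin: "\<And>m. finite (I m)" and inj: "\<And>m. inj_on \<phi> (I m)" and sub: "\<And>m. \<phi> ` I m \<subseteq> A (\<psi> m)"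
    and supp: "\<And>n y. y \<in> A n \<Longrightarrow> f y \<noteq> 0 \<Longrightarrow> \<exists>m. n = \<psi> m \<and> y \<in> \<phi> ` I m"
  shows "f summable_on A n" and "n \<notin> range \<psi> \<Longrightarrow> infsum f (A n) = 0"
    and "infsum f (A (\<psi> m)) = (\<Sum>x\<in>I m. f (\<phi> x))"
proof -
  have in_image: "y \<in> \<phi> ` I m" if "y \<in> A (\<psi> m)" "f y \<noteq> 0" for y m
    using supp[OF that] inj_eq[OF inj_\<psi>] by auto
  have "infsum f (A (\<psi> m)) = infsum f (\<phi> ` I m)"
    by (rule infsum_cong_neutral) (use in_image sub in blast)+
  also have "\<dots> = (\<Sum>x\<in>I m. f (\<phi> x))"
    using fin by (simp add: sum.reindex[OF inj])
  finally show "infsum f (A (\<psi> m)) = (\<Sum>x\<in>I m. f (\<phi> x))" .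
  show "infsum f (A n) = 0" if "n \<notin> range \<psi>"
    by (rule infsum_0) (use supp that in blast)
  have "finite {y \<in> A n. f y \<noteq> 0}"
  proof (cases "n \<in> range \<psi>")
    case True
    then obtain m where m: "n = \<psi> m" by blast
    have "{y \<in> A n. f y \<noteq> 0} \<subseteq> \<phi> ` I m" using in_image m by blast
    then show ?thesis using fin finite_subset by blast
  next
    case False
    then have "{y \<in> A n. f y \<noteq> 0} = {}" using supp by blast
    then show ?thesis by (simp only: finite.emptyI)
  qed
  then have "f summable_on {y \<in> A n. f y \<noteq> 0}" by simp
  then show "f summable_on A n" by (rule summable_on_cong_neutral[THEN iffD1, rotated -1]) auto
qed

lemma infsum_triples:
  assumes f: "\<And>p q k. f (p, q, k) \<noteq> (0::complex) \<Longrightarrow> profile t p \<noteq> 0 \<and> profile t q \<noteq> 0 \<and> profile t k \<noteq> 0"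
  shows "f summable_on N3 n" and "n \<notin> range \<psi> \<Longrightarrow> infsum f (N3 n) = 0"
    and "infsum f (N3 (\<psi> m)) = (\<Sum>(i, j, k)\<in>triples m. f (\<psi> i, \<psi> j, \<psi> k))"
proof -
  let ?\<phi> = "\<lambda>(i, j, k). (\<psi> i, \<psi> j, \<psi> k)"
  have supp: "\<exists>m. n = \<psi> m \<and> y \<in> ?\<phi> ` triples m" if y: "y \<in> N3 n" "f y \<noteq> 0" for y n
  proof -
    obtain p q k where y': "y = (p, q, k)" by (cases y)
    have nz: "profile t p \<noteq> 0" "profile t q \<noteq> 0" "profile t k \<noteq> 0" using y f[of p q k] by (auto simp: y')
    obtain i where i: "1 \<le> i" "p = \<psi> i" using profile_nonzero[OF nz(1)] by blast
    obtain j where j: "1 \<le> j" "q = \<psi> j" using profile_nonzero[OF nz(2)] by blast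
    obtain l where l: "1 \<le> l" "k = \<psi> l" using profile_nonzero[OF nz(3)] by blast
    have "n = p + q + k" using y by (auto simp: y' N3_def)
    then have "n = \<psi> (i + j + l)" by (simp add: i j l \<psi>_def algebra_simps)
    moreover have "(i, j, l) \<in> triples (i + j + l)" using i j l by (simp add: triples_def)
    then have "y \<in> ?\<phi> ` triples (i + j + l)" unfolding y' i j l by (rule image_eqI[rotated]) simp
    ultimately show ?thesis by blast
  qed
  have sub: "?\<phi> ` triples m \<subseteq> N3 (\<psi> m)" for m
  proof clarify
    fix i j k assume "(i, j, k) \<in> triples m"
    then have "0 < \<psi> i" "0 < \<psi> j" "0 < \<psi> k" "\<psi> i + \<psi> j + \<psi> k = \<psi> m"
      using N0 by (auto simp: triples_def \<psi>_def distrib_right)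
    then show "(\<psi> i, \<psi> j, \<psi> k) \<in> N3 (\<psi> m)" by (auto simp: N3_def)
  qed
  have inj: "inj_on ?\<phi> (triples m)" for m
    by (auto simp: inj_on_def inj_eq[OF inj_\<psi>])
  note sums = infsum_over_multiples[where \<phi> = ?\<phi> and I = triples and A = N3 and f = f, OF finite_triples inj sub]
  show "f summable_on N3 n" by (rule sums(1), rule supp)
  show "infsum f (N3 n) = 0" if "n \<notin> range \<psi>" by (rule sums(2)[OF _ that], rule supp)
  have "infsum f (N3 (\<psi> m)) = (\<Sum>x\<in>triples m. f (?\<phi> x))" by (rule sums(3), rule supp)
  then show "infsum f (N3 (\<psi> m)) = (\<Sum>(i, j, k)\<in>triples m. f (\<psi> i, \<psi> j, \<psi> k))" by (simp add: case_prod_unfold)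
qed

lemma infsum_quintuples:
  assumes f: "\<And>p q k l z. f (p, q, k, l, z) \<noteq> (0::complex) \<Longrightarrow>
      profile t p \<noteq> 0 \<and> profile t q \<noteq> 0 \<and> profile t k \<noteq> 0 \<and> profile t l \<noteq> 0 \<and> profile t z \<noteq> 0"
  shows "f summable_on N5 n" and "n \<notin> range \<psi> \<Longrightarrow> infsum f (N5 n) = 0"
    and "infsum f (N5 (\<psi> m)) = (\<Sum>(i, j, k, l, p)\<in>quintuples m. f (\<psi> i, \<psi> j, \<psi> k, \<psi> l, \<psi> p))"
proof -
  let ?\<phi> = "\<lambda>(i, j, k, l, p). (\<psi> i, \<psi> j, \<psi> k, \<psi> l, \<psi> p)"
  have supp: "\<exists>m. n = \<psi> m \<and> y \<in> ?\<phi> ` quintuples m" if y: "y \<in> N5 n" "f y \<noteq> 0" for y n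
  proof -
    obtain p1 p2 p3 p4 p5 where y': "y = (p1, p2, p3, p4, p5)" by (cases y)
    have nz: "profile t p1 \<noteq> 0" "profile t p2 \<noteq> 0" "profile t p3 \<noteq> 0" "profile t p4 \<noteq> 0" "profile t p5 \<noteq> 0"
      using y f[of p1 p2 p3 p4 p5] by (auto simp: y')
    obtain i1 where i1: "1 \<le> i1" "p1 = \<psi> i1" using profile_nonzero[OF nz(1)] by blast
    obtain i2 where i2: "1 \<le> i2" "p2 = \<psi> i2" using profile_nonzero[OF nz(2)] by blast
    obtain i3 where i3: "1 \<le> i3" "p3 = \<psi> i3" using profile_nonzero[OF nz(3)] by blast
    obtain i4 where i4: "1 \<le> i4" "p4 = \<psi> i4" using profile_nonzero[OF nz(4)] by blast
    obtain i5 where i5: "1 \<le> i5" "p5 = \<psi> i5" using profile_nonzero[OF nz(5)] by blast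
    have "n = p1 + p2 + p3 + p4 + p5" using y by (auto simp: y' N5_def)
    then have "n = \<psi> (i1 + i2 + i3 + i4 + i5)" by (simp add: i1 i2 i3 i4 i5 \<psi>_def algebra_simps)
    moreover have "(i1, i2, i3, i4, i5) \<in> quintuples (i1 + i2 + i3 + i4 + i5)"
      using i1 i2 i3 i4 i5 by (simp add: quintuples_def)
    then have "y \<in> ?\<phi> ` quintuples (i1 + i2 + i3 + i4 + i5)"
      unfolding y' i1 i2 i3 i4 i5 by (rule image_eqI[rotated]) simp
    ultimately show ?thesis by blast
  qed
  have sub: "?\<phi> ` quintuples m \<subseteq> N5 (\<psi> m)" for m
  proof clarify
    fix i j k l p assume "(i, j, k, l, p) \<in> quintuples m"
    then have "0 < \<psi> i" "0 < \<psi> j" "0 < \<psi> k" "0 < \<psi> l" "0 < \<psi> p" "\<psi> i + \<psi> j + \<psi> k + \<psi> l + \<psi> p = \<psi> m"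
      using N0 by (auto simp: quintuples_def \<psi>_def distrib_right)
    then show "(\<psi> i, \<psi> j, \<psi> k, \<psi> l, \<psi> p) \<in> N5 (\<psi> m)" by (auto simp: N5_def)
  qed
  have inj: "inj_on ?\<phi> (quintuples m)" for m
    by (auto simp: inj_on_def inj_eq[OF inj_\<psi>])
  note sums = infsum_over_multiples[where \<phi> = ?\<phi> and I = quintuples and A = N5 and f = f, OF finite_quintuples inj sub]
  show "f summable_on N5 n" by (rule sums(1), rule supp)
  show "infsum f (N5 n) = 0" if "n \<notin> range \<psi>" by (rule sums(2)[OF _ that], rule supp)
  have "infsum f (N5 (\<psi> m)) = (\<Sum>x\<in>quintuples m. f (?\<phi> x))" by (rule sums(3), rule supp)
  then show "infsum f (N5 (\<psi> m)) = (\<Sum>(i, j, k, l, p)\<in>quintuples m. f (\<psi> i, \<psi> j, \<psi> k, \<psi> l, \<psi> p))" by (simp add: case_prod_unfold)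
qed

end

context wave_solution
begin

lemma of_int_\<psi>: "of_int (\<psi> m) = (of_real (real (m * N)) :: complex)"
  by (simp add: \<psi>_def)

lemma cubicA_sum:
  "infsum (cubicA (profile t)) (N3 (\<psi> m)) =
     of_real (\<Sum>(i, j, k)\<in>triples m. real (k * N) ^ 2 * (c i * c j * c k)) * cis (real m * \<omega> * t)"
proof -
  have "infsum (cubicA (profile t)) (N3 (\<psi> m)) = (\<Sum>(i, j, k)\<in>triples m. cubicA (profile t) (\<psi> i, \<psi> j, \<psi> k))"
    by (rule infsum_triples(3)) (auto simp: cubicA_def)
  also have "\<dots> = (\<Sum>(i, j, k)\<in>triples m. of_real (real (k * N) ^ 2 * (c i * c j * c k)) * cis (real m * \<omega> * t))"
  proof (rule sum.cong[OF refl], clarify)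
    fix i j k assume "(i, j, k) \<in> triples m"
    then have m: "real m = real i + real j + real k" by (auto simp: triples_def)
    have "cis (real m * \<omega> * t) = cis (real i * \<omega> * t) * cis (real j * \<omega> * t) * cis (real k * \<omega> * t)"
      unfolding m by (simp add: cis_mult distrib_right)
    then show "cubicA (profile t) (\<psi> i, \<psi> j, \<psi> k) = of_real (real (k * N) ^ 2 * (c i * c j * c k)) * cis (real m * \<omega> * t)"
      unfolding cubicA_def prod.case profile_\<psi> of_int_\<psi> by (simp only: of_real_mult of_real_power mult_ac)
  qed
  finally show ?thesis by (simp add: sum_distrib_right case_prod_unfold)
qed

lemma cubicB_sum:
  "infsum (cubicB (profile t)) (N3 (\<psi> m)) =
     of_real (\<Sum>(i, j, k)\<in>triples m. real (j * N) * real (k * N) * (c i * c j * c k)) * cis (real m * \<omega> * t)"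
proof -
  have "infsum (cubicB (profile t)) (N3 (\<psi> m)) = (\<Sum>(i, j, k)\<in>triples m. cubicB (profile t) (\<psi> i, \<psi> j, \<psi> k))"
    by (rule infsum_triples(3)) (auto simp: cubicB_def)
  also have "\<dots> = (\<Sum>(i, j, k)\<in>triples m. of_real (real (j * N) * real (k * N) * (c i * c j * c k)) * cis (real m * \<omega> * t))"
  proof (rule sum.cong[OF refl], clarify)
    fix i j k assume "(i, j, k) \<in> triples m"
    then have m: "real m = real i + real j + real k" by (auto simp: triples_def)
    have "cis (real m * \<omega> * t) = cis (real i * \<omega> * t) * cis (real j * \<omega> * t) * cis (real k * \<omega> * t)"
      unfolding m by (simp add: cis_mult distrib_right)
    then show "cubicB (profile t) (\<psi> i, \<psi> j, \<psi> k) = of_real (real (j * N) * real (k * N) * (c i * c j * c k)) * cis (real m * \<omega> * t)"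
      unfolding cubicB_def prod.case profile_\<psi> of_int_\<psi> by (simp only: of_real_mult of_real_power mult_ac)
  qed
  finally show ?thesis by (simp add: sum_distrib_right case_prod_unfold)
qed

lemma quintic_sum:
  "infsum (quintic (profile t)) (N5 (\<psi> m)) =
     of_real (\<Sum>(i, j, k, l, p)\<in>quintuples m. c i * c j * c k * c l * c p) * cis (real m * \<omega> * t)"
proof -
  have "infsum (quintic (profile t)) (N5 (\<psi> m)) = (\<Sum>(i, j, k, l, p)\<in>quintuples m. quintic (profile t) (\<psi> i, \<psi> j, \<psi> k, \<psi> l, \<psi> p))"
    by (rule infsum_quintuples(3)) (auto simp: quintic_def)
  also have "\<dots> = (\<Sum>(i, j, k, l, p)\<in>quintuples m. of_real (c i * c j * c k * c l * c p) * cis (real m * \<omega> * t))"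
  proof (rule sum.cong[OF refl], clarify)
    fix i j k l p assume "(i, j, k, l, p) \<in> quintuples m"
    then have m: "real m = real i + real j + real k + real l + real p" by (auto simp: quintuples_def)
    have "cis (real m * \<omega> * t) = cis (real i * \<omega> * t) * cis (real j * \<omega> * t) * cis (real k * \<omega> * t) * cis (real l * \<omega> * t) * cis (real p * \<omega> * t)"
      unfolding m by (simp add: cis_mult distrib_right)
    then show "quintic (profile t) (\<psi> i, \<psi> j, \<psi> k, \<psi> l, \<psi> p) = of_real (c i * c j * c k * c l * c p) * cis (real m * \<omega> * t)"
      unfolding quintic_def prod.case profile_\<psi> by (simp only: of_real_mult mult_ac)
  qed
  finally show ?thesis by (simp add: sum_distrib_right case_prod_unfold)
qed

lemma nonlinearity_profile:
  "nonlinearity (profile t) (\<psi> m) = \<i> * of_real ((real m * \<omega> - L (\<psi> m)) * c m) * cis (real m * \<omega> * t)"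
proof -
  define E where "E = cis (real m * \<omega> * t)"
  define a where "a = (\<Sum>(i, j, k)\<in>triples m. real (k * N) ^ 2 * (c i * c j * c k))"
  define b where "b = (\<Sum>(i, j, k)\<in>triples m. real (j * N) * real (k * N) * (c i * c j * c k))"
  define q where "q = (\<Sum>(i, j, k, l, p)\<in>quintuples m. c i * c j * c k * c l * c p)"
  define M where "M = real (m * N)"
  have "a + b = (\<Sum>(i, j, k)\<in>triples m. (real (k * N) ^ 2 + real (j * N) * real (k * N)) * (c i * c j * c k))"
    unfolding a_def b_def by (simp add: sum.distrib[symmetric] case_prod_unfold distrib_right)
  then have "forcing N c m = 10 * M * (a + b) + 6 * M * q"
    by (simp add: forcing_def q_def M_def)
  then have eq: "- 20 * M ^ 3 * c m ^ 3 + 10 * M * a + 10 * M * b + 6 * M * q = (real m * \<omega> - L (\<psi> m)) * c m"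
    using amplitude_eq[of m] by (simp add: \<psi>_def M_def algebra_simps)
  have "(cmod (profile t (\<psi> m)))\<^sup>2 = (c m)\<^sup>2" by (simp add: profile_\<psi> norm_mult)
  then have "nonlinearity (profile t) (\<psi> m) = - 20 * \<i> * of_real M ^ 3 * of_real ((c m)\<^sup>2) * (of_real (c m) * E)
     + 10 * \<i> * of_real M * (of_real a * E) + 10 * \<i> * of_real M * (of_real b * E) + 6 * \<i> * of_real M * (of_real q * E)"
    unfolding nonlinearity_def cubicA_sum cubicB_sum quintic_sum of_int_\<psi> a_def b_def q_def M_def E_def profile_\<psi> by simp
  also have "\<dots> = \<i> * of_real (- 20 * M ^ 3 * c m ^ 3 + 10 * M * a + 10 * M * b + 6 * M * q) * E"
    by (simp add: power2_eq_square power3_eq_cube algebra_simps)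
  finally show ?thesis unfolding eq E_def .
qed

lemma nonlinearity_profile_off:
  assumes "n \<notin> range \<psi>"
  shows "nonlinearity (profile t) n = 0"
proof -
  have "infsum (cubicA (profile t)) (N3 n) = 0" "infsum (cubicB (profile t)) (N3 n) = 0"
    by (rule infsum_triples(2)[OF _ assms], auto simp: cubicA_def cubicB_def)+
  moreover have "infsum (quintic (profile t)) (N5 n) = 0"
    by (rule infsum_quintuples(2)[OF _ assms]) (auto simp: quintic_def)
  ultimately show ?thesis by (simp add: nonlinearity_def profile_off[OF assms])
qed

lemma converges_profile: "nonlinearity_converges (profile t) n"
proof -
  have "cubicA (profile t) summable_on N3 n" "cubicB (profile t) summable_on N3 n"
    by (rule infsum_triples(1), auto simp: cubicA_def cubicB_def)+
  moreover have "quintic (profile t) summable_on N5 n"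
    by (rule infsum_quintuples(1)) (auto simp: quintic_def)
  ultimately show ?thesis by (simp add: nonlinearity_converges_def)
qed

lemma solution_orbit: "solution d1 d2 s T (orbit 0) orbit"
proof -
  have main: "interval_lebesgue_integrable lborel 0 t (duhamel_integrand d1 d2 s orbit n) \<and>
      profile t n = cis (t * L n) * (profile 0 n + (LBINT \<tau>=0..t. duhamel_integrand d1 d2 s orbit n \<tau>))" for t n
  proof (cases "n \<in> range \<psi>")
    case False
    have "duhamel_integrand d1 d2 s orbit n = (\<lambda>_. 0)"
      by (rule ext) (simp add: duhamel_integrand_def fourier_orbit nonlinearity_profile_off[OF False])
    then show ?thesis
      by (simp add: profile_off[OF False] interval_lebesgue_integrable_def set_integrable_def)
  next
    case True
    then obtain m where n: "n = \<psi> m" by blast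
    define \<Delta> where "\<Delta> = real m * \<omega> - L n"
    have duh: "duhamel_integrand d1 d2 s orbit n = (\<lambda>\<tau>. of_real (c m) * (\<Delta> *\<^sub>R (\<i> * cis (\<Delta> * \<tau>))))"
    proof
      fix \<tau>
      have cis_\<Delta>: "cis (\<Delta> * \<tau>) = cis (- \<tau> * L n) * cis (real m * \<omega> * \<tau>)"
        by (simp add: cis_mult \<Delta>_def algebra_simps)
      show "duhamel_integrand d1 d2 s orbit n \<tau> = of_real (c m) * (\<Delta> *\<^sub>R (\<i> * cis (\<Delta> * \<tau>)))"
        unfolding duhamel_integrand_def fourier_orbit n nonlinearity_profile cis_\<Delta>[unfolded n] scaleR_conv_of_real
        by (simp only: \<Delta>_def n of_real_mult mult_ac)
    qed
    have deriv: "((\<lambda>\<tau>. of_real (c m) * cis (\<Delta> * \<tau>)) has_vector_derivative of_real (c m) * (\<Delta> *\<^sub>R (\<i> * cis (\<Delta> * \<tau>)))) (at \<tau> within A)" for \<tau> A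
      by (intro has_vector_derivative_mult_right has_vector_derivative_cis)
    have cont: "isCont (duhamel_integrand d1 d2 s orbit n) \<tau>" for \<tau>
      unfolding duh
      by (intro continuous_intros has_vector_derivative_continuous[OF has_vector_derivative_cis])
    have "(LBINT \<tau>=0..t. duhamel_integrand d1 d2 s orbit n \<tau>) = of_real (c m) * cis (\<Delta> * t) - of_real (c m) * cis (\<Delta> * 0)"
      unfolding zero_ereal_def
    proof (rule interval_integral_FTC_finite)
      show "continuous_on {min 0 t..max 0 t} (duhamel_integrand d1 d2 s orbit n)"
        using cont by (simp add: continuous_at_imp_continuous_on)
      show "((\<lambda>\<tau>. of_real (c m) * cis (\<Delta> * \<tau>)) has_vector_derivative duhamel_integrand d1 d2 s orbit n \<tau>)
          (at \<tau> within {min 0 t..max 0 t})" for \<tau>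
        unfolding duh by (rule deriv)
    qed
    moreover have "cis (t * L n) * cis (\<Delta> * t) = cis (real m * \<omega> * t)"
      by (simp add: cis_mult \<Delta>_def algebra_simps)
    ultimately have "profile t n = cis (t * L n) * (profile 0 n + (LBINT \<tau>=0..t. duhamel_integrand d1 d2 s orbit n \<tau>))"
      unfolding n profile_\<psi> by (simp add: mult.left_commute[of "cis _" "of_real (c m)"])
    moreover have "interval_lebesgue_integrable lborel 0 t (duhamel_integrand d1 d2 s orbit n)"
      unfolding zero_ereal_def by (rule interval_integrable_isCont, rule cont)
    ultimately show ?thesis by blast
  qed
  show ?thesis
    unfolding solution_iff fourier_orbit
  proof (intro conjI allI ballI)
    show "AE \<tau> in lborel. \<tau> \<in> {-T..T} \<longrightarrow> nonlinearity_converges (profile \<tau>) n" for n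
      using converges_profile by simp
  qed (use main continuous_orbit in blast)+
qed

lemma coord_orbit_N: "coord (orbit t) (int N) = of_real x * cis (\<omega> * t)"
proof -
  have "int N = \<psi> 1" by (simp add: \<psi>_def)
  moreover have "c 1 / weight s (\<psi> 1) = x" unfolding c1 X_def calculation[symmetric] by simp
  then have "of_real (c 1) / of_real (weight s (\<psi> 1)) = (of_real x :: complex)" by (metis of_real_divide)
  moreover have "of_real (c 1) * cis (real 1 * \<omega> * t) / of_real (weight s (\<psi> 1)) =
      of_real (c 1) / of_real (weight s (\<psi> 1)) * cis (\<omega> * t)" by simp
  ultimately show ?thesis by (simp only: coord_orbit profile_\<psi>)
qed

end

text \<open>
  By uniqueness the travelling wave is the orbit of the flow through its initial value, so the coordinate \<open>N\<close> of this orbit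
  rotates with the amplitude dependent frequency \<open>\<omega>\<close>.  The cubic coefficient of this rotation is the left hand side, and it
  is bounded by the third derivative and the Lipschitz constant of \<open>S T\<close>.
\<close>
lemma (in smooth_flow) third_order_bound:
  assumes d1: "0 \<le> d1" and s: "0 < s"
  shows "\<exists>B. \<forall>N\<ge>8. 20 * real N ^ 3 * (weight s (int N))\<^sup>2 * T \<le> B"
proof -
  have tT: "T \<in> {-T..T}" using T by simp
  obtain M dd where dd: "0 < dd" and all_jets: "\<forall>a v p. norm a \<le> 1 \<longrightarrow> norm v \<le> 1 \<longrightarrow> p \<in> {1, 3, 5} \<longrightarrow>
      (\<exists>c. \<forall>x. 0 < x \<longrightarrow> x < dd \<longrightarrow> \<bar>inner v (S T (x *\<^sub>R a)) - (\<Sum>k<p. c k * x ^ k)\<bar> \<le> M * x ^ p)"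
    using C5_at_jets[OF C5[OF tT], of 1] by auto
  obtain K e where K: "0 < K" and e: "0 < e"
    and lip: "\<And>a b. a \<in> ball 0 e \<Longrightarrow> b \<in> ball 0 e \<Longrightarrow> norm (S T a - S T b) \<le> K * norm (a - b)"
    using C5_at_lipschitz[OF C5[OF tT]] by blast
  define q where "q = 8 * sqrt (\<Sum>m. ((1/2) ^ m * real m powr s)\<^sup>2)"
  have q0: "0 \<le> q" unfolding q_def by (simp add: suminf_nonneg[OF geometric_decay_summable(1)])
  have "20 * real N ^ 3 * (weight s (int N))\<^sup>2 * T \<le> M + (K * q + 1)" if N: "8 \<le> N" for N
  proof -
    define A where "A = 20 * real N ^ 3 * (weight s (int N))\<^sup>2 * T"
    \<comment> \<open>Testing with \<open>-\<i>\<close> selects the imaginary part, in which the first order term is absent.\<close>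
    define v where "v = single (int N) (cis (T * dispersion d1 d2 (int N)) * (- \<i>))"
    define h where "h = single (int N) 1"
    have A0: "0 \<le> A" using T by (simp add: A_def)
    have "\<exists>c. \<forall>x. 0 < x \<longrightarrow> x < dd \<longrightarrow> \<bar>inner v (S T (x *\<^sub>R h)) - (\<Sum>k<3. c k * x ^ k)\<bar> \<le> M * x ^ 3"
      by (rule all_jets[rule_format]) (auto simp: v_def h_def norm_mult)
    then obtain c where c: "\<And>x. 0 < x \<Longrightarrow> x < dd \<Longrightarrow> \<bar>inner v (S T (x *\<^sub>R h)) - (\<Sum>k<3. c k * x ^ k)\<bar> \<le> M * x ^ 3"
      by blast
    \<comment> \<open>Small enough for the sine to be linearized, and for the wave to stay where the flow is Lipschitz and unique.\<close>
    define \<delta> where "\<delta> = min (min (1/2) (1 / (A\<^sup>2 + 1))) (min e r / (1 + q))"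
    have \<delta>: "0 < \<delta>" using e r q0 by (simp add: \<delta>_def add_nonneg_pos)
    have "\<bar>A\<bar> \<le> M + (K * q + 1)"
    proof (rule jet_unique(2)[OF dd c \<delta>, where c' = "\<lambda>_. 0"])
      fix x assume x: "0 < x" "x < \<delta>"
      have x2: "x \<le> 1 / 2" "x \<le> 1 / (A\<^sup>2 + 1)" and xer: "x < min e r / (1 + q)" using x by (auto simp: \<delta>_def)
      interpret W: wave d1 d2 s x N using d1 s x x2 N by unfold_locales auto
      obtain c where "c 0 = 0" "c 1 = W.X" "c 2 = 0" "\<And>m. \<bar>c m\<bar> \<le> W.X ^ m"
        "\<And>m. (dispersion d1 d2 (int (m * N)) - m * W.\<omega>) * c m - 20 * real (m * N) ^ 3 * c m ^ 3 = - forcing N c m"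
        using W.amplitudes_exist by blast
      then interpret V: wave_solution d1 d2 s x N c by unfold_locales auto
      have near: "norm (V.orbit 0 - x *\<^sub>R h) \<le> q * x ^ 3"
        using V.orbit_near_single by (simp add: h_def q_def V.Q_def)
      have x3: "x ^ 3 \<le> x" using x x2 power_decreasing[of 1 3 x] by simp
      have "norm (V.orbit 0) \<le> norm (V.orbit 0 - x *\<^sub>R h) + norm (x *\<^sub>R h)"
        using norm_triangle_ineq[of "V.orbit 0 - x *\<^sub>R h" "x *\<^sub>R h"] by simp
      also have "\<dots> \<le> q * x + x" using near mult_left_mono[OF x3 q0] x by (intro add_mono) (auto simp: h_def)
      also have "\<dots> < min e r" using xer q0 by (simp add: pos_less_divide_eq algebra_simps add_pos_nonneg)
      finally have no: "norm (V.orbit 0) < e" "norm (V.orbit 0) < r" by auto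
      have "x * 1 \<le> x * (1 + q)" using x q0 by (intro mult_left_mono) auto
      also have "\<dots> < min e r" using xer q0 by (simp add: pos_less_divide_eq add_pos_nonneg)
      finally have nx: "norm (x *\<^sub>R h) < e" using x by (simp add: h_def)
      have "S T (V.orbit 0) = V.orbit T"
        by (rule uniq[OF no(2) V.solution_orbit tT])
      then have "norm (S T (x *\<^sub>R h) - V.orbit T) \<le> K * norm (x *\<^sub>R h - V.orbit 0)"
        using lip[of "x *\<^sub>R h" "V.orbit 0"] no nx by simp
      also have "\<dots> \<le> K * (q * x ^ 3)" using near K by (simp add: norm_minus_commute)
      finally have d: "norm (S T (x *\<^sub>R h) - V.orbit T) \<le> K * q * x ^ 3" by (simp add: mult.assoc)
      have "norm v = 1" by (simp add: v_def norm_mult)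
      then have 1: "\<bar>inner v (S T (x *\<^sub>R h)) - inner v (V.orbit T)\<bar> \<le> K * q * x ^ 3"
        using Cauchy_Schwarz_ineq2[of v "S T (x *\<^sub>R h) - V.orbit T"] d by (simp add: inner_diff_right)
      have phase: "cis (- (T * dispersion d1 d2 (int N))) * cis (W.\<omega> * T) = cis (- (A * x\<^sup>2))"
        by (simp add: cis_mult W.\<omega>_def W.X_def A_def power_mult_distrib algebra_simps)
      have "inner v (V.orbit T) = inner (- \<i>) (cis (- (T * dispersion d1 d2 (int N))) * (of_real x * cis (W.\<omega> * T)))"
        by (simp add: v_def inner_single inner_cis_mult V.coord_orbit_N)
      also have "\<dots> = inner (- \<i>) (of_real x * cis (- (A * x\<^sup>2)))"
        by (simp only: mult.left_commute phase)
      also have "\<dots> = x * sin (A * x\<^sup>2)" by (simp add: inner_complex_def)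
      finally have 2: "inner v (V.orbit T) = x * sin (A * x\<^sup>2)" .
      have "\<bar>sin (A * x\<^sup>2) - (\<Sum>m<2. sin_coeff m * (A * x\<^sup>2) ^ m)\<bar> \<le> inverse (fact 2) * \<bar>A * x\<^sup>2\<bar> ^ 2"
        by (rule Maclaurin_sin_bound)
      then have twice: "2 * \<bar>sin (A * x\<^sup>2) - A * x\<^sup>2\<bar> \<le> (A * x\<^sup>2)\<^sup>2"
        by (simp add: numeral_2_eq_2 sin_coeff_def)
      have half: "u \<le> z" if "2 * u \<le> z" "0 \<le> u" for u z :: real using that by linarith
      have "\<bar>sin (A * x\<^sup>2) - A * x\<^sup>2\<bar> \<le> (A * x\<^sup>2)\<^sup>2"
        by (rule half[OF twice abs_ge_zero])
      then have "x * \<bar>sin (A * x\<^sup>2) - A * x\<^sup>2\<bar> \<le> x * (A * x\<^sup>2)\<^sup>2" using x by (intro mult_left_mono) auto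
      moreover have "x * (A * x\<^sup>2)\<^sup>2 \<le> x ^ 3"
      proof -
        have "A\<^sup>2 * x \<le> 1"
        proof -
          have "x * (A\<^sup>2 + 1) \<le> 1" using x2(2) by (simp add: pos_le_divide_eq add_nonneg_pos)
          then show ?thesis using x by (simp add: algebra_simps)
        qed
        then have "(A\<^sup>2 * x) * (x * x ^ 3) \<le> 1 * (1 * x ^ 3)" using x x2 by (intro mult_mono) auto
        then show ?thesis by (simp add: power_mult_distrib power2_eq_square power_numeral_reduce mult_ac)
      qed
      moreover have "x * \<bar>sin (A * x\<^sup>2) - A * x\<^sup>2\<bar> = \<bar>x * sin (A * x\<^sup>2) - A * x ^ 3\<bar>"
      proof -
        have "x * sin (A * x\<^sup>2) - A * x ^ 3 = x * (sin (A * x\<^sup>2) - A * x\<^sup>2)"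
          by (simp add: power2_eq_square power3_eq_cube algebra_simps)
        then show ?thesis using x by (simp add: abs_mult)
      qed
      ultimately have "\<bar>inner v (S T (x *\<^sub>R h)) - A * x ^ 3\<bar> \<le> K * q * x ^ 3 + x ^ 3"
        using 1 unfolding 2 by linarith
      then show "\<bar>inner v (S T (x *\<^sub>R h)) - (\<Sum>k<3. 0 * x ^ k) - A * x ^ 3\<bar> \<le> (K * q + 1) * x ^ 3"
        by (simp add: distrib_right)
    qed
    then show ?thesis by (simp add: A_def)
  qed
  then show ?thesis by blast
qed

text \<open>
  \<open>N\<^sup>3 (1 + N\<^sup>2)\<^bsup>-s\<^esup>\<close> is bounded only if \<open>s \<ge> 3/2\<close>.
\<close>
lemma (in smooth_flow) exponent_at_least_three_halves:
  assumes d1: "0 \<le> d1" and s: "0 < s"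
  shows "3 / 2 \<le> s"
proof (rule ccontr)
  assume "\<not> 3 / 2 \<le> s"
  then have s': "3 - 2 * s > 0" by simp
  obtain B where B: "\<And>N. N \<ge> 8 \<Longrightarrow> 20 * real N ^ 3 * (weight s (int N))\<^sup>2 * T \<le> B"
    using third_order_bound[OF assms] by blast
  have lower: "real N powr (3 - 2 * s) \<le> B * 2 powr s / (20 * T)" if N: "N \<ge> 8" for N
  proof -
    have "1 + (real N)\<^sup>2 \<le> 2 * (real N)\<^sup>2" using N by simp
    then have "(2 * (real N)\<^sup>2) powr (- s) \<le> (1 + (real N)\<^sup>2) powr (- s)"
      using s by (intro powr_mono2') (auto simp: add_pos_nonneg)
    also have "(1 + (real N)\<^sup>2) powr (- s) = (weight s (int N))\<^sup>2"
      by (simp add: weight_def power2_eq_square flip: powr_add)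
    finally have "real N ^ 3 * (2 * (real N)\<^sup>2) powr (- s) \<le> real N ^ 3 * (weight s (int N))\<^sup>2"
      by (rule mult_left_mono) simp
    also have "(2 * (real N)\<^sup>2) powr (- s) = 2 powr (- s) * real N powr (- 2 * s)"
      using N by (simp add: powr_mult powr_powr flip: powr_numeral)
    also have "real N ^ 3 * (2 powr (- s) * real N powr (- 2 * s)) = 2 powr (- s) * real N powr (3 - 2 * s)"
      using N by (simp add: powr_diff powr_minus divide_inverse flip: powr_numeral)
    finally have "20 * T * (2 powr (- s) * real N powr (3 - 2 * s)) \<le> 20 * T * (real N ^ 3 * (weight s (int N))\<^sup>2)"
      using T by (intro mult_left_mono) auto
    also have "\<dots> \<le> B" using B[OF N] by (simp add: mult_ac)
    finally show ?thesis using T by (simp add: field_simps powr_minus)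
  qed
  have "filterlim (\<lambda>N. real N powr (3 - 2 * s)) at_top sequentially"
    using s' by real_asymp
  then have "\<forall>\<^sub>F N in sequentially. real N powr (3 - 2 * s) > B * 2 powr s / (20 * T)"
    by (simp add: filterlim_at_top_dense)
  then have "\<forall>\<^sub>F N in sequentially. N \<ge> 8 \<and> real N powr (3 - 2 * s) > B * 2 powr s / (20 * T)"
    by (rule eventually_conj[OF eventually_ge_at_top])
  then obtain N :: nat where "N \<ge> 8" "real N powr (3 - 2 * s) > B * 2 powr s / (20 * T)"
    using eventually_happens' sequentially_bot by blast
  then show False using lower[of N] by linarith
qed

section \<open>The flow map is not of class C5\<close>

theorem theorem1p16:
  fixes s d1 d2 :: real
  assumes "s > 0" and "d1 \<ge> 0" and "d2 \<ge> 0"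
  shows "\<not> (\<exists>T>0. \<exists>r>0. \<exists>S :: real \<Rightarrow> ell2 \<Rightarrow> ell2.
              unique_local_flow d1 d2 s T r S \<and> (\<forall>t\<in>{-T..T}. C5_at (S t) 0))"
proof
  assume "\<exists>T>0. \<exists>r>0. \<exists>S :: real \<Rightarrow> ell2 \<Rightarrow> ell2.
              unique_local_flow d1 d2 s T r S \<and> (\<forall>t\<in>{-T..T}. C5_at (S t) 0)"
  then obtain T r and S :: "real \<Rightarrow> ell2 \<Rightarrow> ell2" where "T > 0" "r > 0"
    "unique_local_flow d1 d2 s T r S" "\<forall>t\<in>{-T..T}. C5_at (S t) 0"
    by blast
  then interpret smooth_flow d1 d2 s T r S
    by unfold_locales auto
  show False
    using exponent_less_three_halves[OF assms(2)] exponent_at_least_three_halves[OF assms(2,1)] by simp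
qed

end
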